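(* Let $h$ be a mixing density. Each of the following three conditions is sufficient for the corresponding DA Markov operator $K$ to be trace-class. (1) $h$ is zero near the origin. (2) There exist $\kappa \in \mathcal{K}$, $\zeta \in (1,2)$ and $g \in \mathcal{C}(\kappa,\zeta)$ such that $\lim_{u \to 0} \frac{h(u)}{g(u)}$ exists and lies in $(0,\infty)$. (3) There exist $\kappa \in \mathcal{K}$, $\zeta \in (1,2)$ and $g \in \mathcal{C}(\kappa,\zeta)$ such that both $u^{d/2} g(u)$ and $\frac{h(u)}{g(u)}$ are non-decreasing in a neighborhood of the origin.
   Context: Setting and standing assumptions. $n,p,d$ are positive integers, $a\in\mathbb{R}$, $\mathbb{R}_+=(0,\infty)$, and $\mathcal{S}_d$ is the space of $d\times d$ (real symmetric) positive definite matrices. $X$ is a fixed $n\times p$ real matrix with $i$th row $x_i^T$, $y$ is a fixed $n\times d$ real matrix with $i$th row $y_i^T$, and $\Lambda=(X:y)$ is the $n\times(p+d)$ concatenated matrix. A mixing density is a probability density $h:(0,\infty)\to[0,\infty)$. Throughout it is assumed that (S1) $\mathrm{rank}(\Lambda)=p+d$; (S2) $n>p+2d-2a$; (S3) $\int_0^\infty u^{d/2}h(u)\,du<\infty$; (S4) $\int_0^\infty u^{-\frac{n-p+2a-2d-1}{2}}h(u)\,du<\infty$. Posterior. For $\beta\in\mathbb{R}^{p\times d}$, $\Sigma\in\mathcal{S}_d$ let $$f(y|\beta,\Sigma)=\prod_{i=1}^n\left[\int_0^\infty \frac{u^{d/2}}{(2\pi)^{d/2}|\Sigma|^{1/2}}\exp\left\{-\frac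 u2 (y_i-\beta^Tx_i)^T\Sigma^{-1}(y_i-\beta^Tx_i)\right\}h(u)\,du\right],$$ the prior be $\omega(\beta,\Sigma)= |\Sigma|^{-a}I_{\mathcal{S}_d}(\Sigma)$, and $\pi(\beta,\Sigma|y)=f(y|\beta,\Sigma)\omega(\beta,\Sigma)/m(y)$, where $m(y)=\int_{\mathcal{S}_d}\int_{\mathbb{R}^{p\times d}}f(y|\beta,\Sigma)\omega(\beta,\Sigma)\,d\beta\,d\Sigma$, which is finite under (S1)–(S4). DA Markov chain. For $s\ge0$ let $\psi(u;s)=b(s)u^{d/2}e^{-su/2}h(u)$, $u\in\mathbb{R}_+$, with $b(s)$ the normalizing constant making it a probability density. For $z\in\mathbb{R}_+^n$ let $Q=Q(z)$ be the $n\times n$ diagonal matrix with $i$th diagonal element $z_i^{-1}$, $\Omega=(X^TQ^{-1}X)^{-1}$, $\mu=(X^TQ^{-1}X)^{-1}X^TQ^{-1}y$. Let $\pi(z|\beta,\Sigma,y)=\prod_{i=1}^n\psi\big(z_i;(\beta^Tx_i-y_i)^T\Sigma^{-1}(\beta^Tx_i-y_i)\big)$; let $\pi(\Sigma|z,y)$ be the $\mathrm{IW}_d\big(n-p+2a-d-1,(y^TQ^{-1}y-\mu^T\Omega^{-1}\mu)^{-1}\big)$ density; and let $\pi(\beta|\Sigma,z,y)$ be the $\mathrm{N}_{p,d}(\mu,\Omega,\Sigma)$ density. Here $\mathrm{N}_{r,c}(\theta,A,B)$ (matrix normal; $\theta$ is $r\times c$, $A$ is $r\times r$ and $B$ is $c\times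 c$ positive definite) has density $(2\pi)^{-rc/2}|A|^{-c/2}|B|^{-r/2}\exp[-\frac12\mathrm{tr}\{A^{-1}(z-\theta)B^{-1}(z-\theta)^T\}]$ on $\mathbb{R}^{r\times c}$, and $\mathrm{IW}_r(m,\Theta)$ (inverse Wishart; $m>r-1$, $\Theta$ is $r\times r$ positive definite) has density proportional to $|w|^{-\frac{m+r+1}{2}}\exp\{-\frac12\mathrm{tr}(\Theta^{-1}w^{-1})\}$ on $\mathcal{S}_r$. The DA Markov chain on $\mathsf{X}=\mathbb{R}^{p\times d}\times\mathcal{S}_d$ has transition density $$k\big((\beta',\Sigma')|(\beta,\Sigma)\big)=\int_{\mathbb{R}_+^n}\pi(\beta'|\Sigma',z,y)\,\pi(\Sigma'|z,y)\,\pi(z|\beta,\Sigma,y)\,dz.$$ Operator. $L_0^2$ is the Hilbert space of functions $f:\mathsf{X}\to\mathbb{R}$ with $\int_{\mathsf{X}} f^2\,\pi(\cdot|y)<\infty$ and $\int_{\mathsf{X}} f\,\pi(\cdot|y)=0$, with inner product $\langle f_1,f_2\rangle=\int_{\mathsf{X}} f_1f_2\,\pi(\beta,\Sigma|y)\,d\beta\,d\Sigma$. The DA Markov operator $K:L_0^2\to L_0^2$ is $(Kf)(\beta,\Sigma)=\int_{\mathsf{X}}f(\beta',\Sigma')\,k((\beta',\Sigma')|(\beta,\Sigma))\,d\beta'\,d\Sigma'$; it is self-adjoint and positive. Such an operator is trace-class if it is compact and its eigenvalues are summable. Function classes. $h$ is zero near the origin if there is $\eta>0$ with $h(u)=0$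 for all $u\in(0,\eta)$. A neighborhood of the origin means an interval $(0,\eta)$ with $\eta>0$, and limits $u\to0$ are from the right. $\mathcal{A}$ is the set of functions $g:\mathbb{R}_+\to[0,\infty)$ that are strictly positive and differentiable in a neighborhood of the origin. $\mathcal{K}=\{\kappa\in\mathcal{A}:\int_0^\eta\frac{1}{\kappa(u)}\,du<\infty\text{ for some }\eta>0\}$. For $\kappa\in\mathcal{K}$ and $\zeta\in(1,2)$, $\mathcal{C}(\kappa,\zeta)$ is the set of $g\in\mathcal{A}$ such that: (i) $u^{d/2}g(u)$ is bounded in a neighborhood of the origin; (ii) $\lim_{u\to0}\kappa(u)u^{d/2}g(u)=0$; (iii) there exist $l_1,l_2\in\mathbb{R}$ such that $\lim_{u\to0}\big(\kappa'(u)+\frac d2\frac{\kappa(u)}{u}\big)\frac{g(u)}{g(\zeta u)}=l_1$ and $\lim_{u\to0}\frac{\kappa(u)g'(u)}{g(\zeta u)}=l_2$. *)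

theory Defs
  imports "HOL-Analysis.Analysis"
begin

definition spd :: "(real^'d^'d) set" where
  "spd = {S. transpose S = S \<and> (\<forall>v. v \<noteq> 0 \<longrightarrow> 0 < v \<bullet> (S *v v))}"

text \<open>
  The differential of a symmetric matrix argument is the product of the differentials of its
  distinct entries. The entries in positions (i,j) and (j,i) share the coordinate indexed by
  the unordered pair, i.e. by the set with elements i and j (a singleton on the diagonal).
\<close>

definition lborel_sym :: "(real^'d^'d) measure" where
  "lborel_sym = distr (Pi\<^sub>M {{i, j} | i j :: 'd. True} (\<lambda>_. lborel)) borel (\<lambda>w. \<chi> i j. w {i, j})"

definition lborel_spd :: "(real^'d^'d) measure" where
  "lborel_spd = restrict_space lborel_sym spd"

definition matrix_normal_density ::
    "real^'c^'r \<Rightarrow> real^'r^'r \<Rightarrow> real^'c^'c \<Rightarrow> real^'c^'r \<Rightarrow> real" where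
  "matrix_normal_density \<theta> A B z =
     (2 * pi) powr (- (real CARD('r) * real CARD('c) / 2))
     * det A powr (- (real CARD('c) / 2)) * det B powr (- (real CARD('r) / 2))
     * exp (- (1/2) * trace (matrix_inv A ** (z - \<theta>) ** matrix_inv B ** transpose (z - \<theta>)))"

definition inv_wishart_kernel :: "real \<Rightarrow> real^'r^'r \<Rightarrow> real^'r^'r \<Rightarrow> real" where
  "inv_wishart_kernel m \<Theta> w =
     det w powr (- ((m + real CARD('r) + 1) / 2))
     * exp (- (1/2) * trace (matrix_inv \<Theta> ** matrix_inv w))"

definition inv_wishart_density :: "real \<Rightarrow> real^'r^'r \<Rightarrow> real^'r^'r \<Rightarrow> real" where
  "inv_wishart_density m \<Theta> w =
     inv_wishart_kernel m \<Theta> w / (\<integral>w'. inv_wishart_kernel m \<Theta> w' \<partial>lborel_spd)"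

definition mixing_density :: "(real \<Rightarrow> real) \<Rightarrow> bool" where
  "mixing_density h \<longleftrightarrow>
     (\<forall>u>0. 0 \<le> h u) \<and> set_integrable lborel {0<..} h \<and> (LBINT u:{0<..}. h u) = 1"

definition concat_cols :: "real^'p^'n \<Rightarrow> real^'d^'n \<Rightarrow> real^('p + 'd)^'n" where
  "concat_cols X y = (\<chi> i j. case j of Inl k \<Rightarrow> X $ i $ k | Inr k \<Rightarrow> y $ i $ k)"

text \<open>The squared scaled residual of observation \<open>i\<close>; \<open>X $ i\<close> and \<open>y $ i\<close> are rows.\<close>

definition resid_form ::
    "real^'p^'n \<Rightarrow> real^'d^'n \<Rightarrow> real^'d^'p \<Rightarrow> real^'d^'d \<Rightarrow> 'n \<Rightarrow> real" where
  "resid_form X y \<beta> \<Sigma> i =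
     (y $ i - transpose \<beta> *v (X $ i)) \<bullet> (matrix_inv \<Sigma> *v (y $ i - transpose \<beta> *v (X $ i)))"

definition likelihood ::
    "real^'p^'n \<Rightarrow> real^'d^'n \<Rightarrow> (real \<Rightarrow> real) \<Rightarrow> real^'d^'p \<Rightarrow> real^'d^'d \<Rightarrow> real" where
  "likelihood X y h \<beta> \<Sigma> =
     (\<Prod>i\<in>UNIV. LBINT u:{0<..}.
        u powr (real CARD('d) / 2) / ((2 * pi) powr (real CARD('d) / 2) * det \<Sigma> powr (1/2))
        * exp (- (u / 2) * resid_form X y \<beta> \<Sigma> i) * h u)"

definition prior :: "real \<Rightarrow> real^'d^'d \<Rightarrow> real" where
  "prior a \<Sigma> = det \<Sigma> powr (- a) * indicator spd \<Sigma>"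

definition marginal :: "real^'p^'n \<Rightarrow> real^'d^'n \<Rightarrow> real \<Rightarrow> (real \<Rightarrow> real) \<Rightarrow> real" where
  "marginal X y a h =
     (\<integral>\<Sigma>. (\<integral>\<beta>. likelihood X y h \<beta> \<Sigma> * prior a \<Sigma> \<partial>lborel) \<partial>lborel_spd)"

definition posterior_density ::
    "real^'p^'n \<Rightarrow> real^'d^'n \<Rightarrow> real \<Rightarrow> (real \<Rightarrow> real) \<Rightarrow> (real^'d^'p) \<times> (real^'d^'d) \<Rightarrow> real" where
  "posterior_density X y a h = (\<lambda>(\<beta>, \<Sigma>).
     likelihood X y h \<beta> \<Sigma> * prior a \<Sigma> / marginal X y a h)"

definition state_measure :: "((real^'d^'p) \<times> (real^'d^'d)) measure" where
  "state_measure = lborel \<Otimes>\<^sub>M lborel_spd"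

definition posterior ::
    "real^'p^'n \<Rightarrow> real^'d^'n \<Rightarrow> real \<Rightarrow> (real \<Rightarrow> real) \<Rightarrow> ((real^'d^'p) \<times> (real^'d^'d)) measure" where
  "posterior X y a h = density state_measure (\<lambda>x. ennreal (posterior_density X y a h x))"

definition psi :: "nat \<Rightarrow> (real \<Rightarrow> real) \<Rightarrow> real \<Rightarrow> real \<Rightarrow> real" where
  "psi d h s u =
     u powr (real d / 2) * exp (- (s * u / 2)) * h u
     / (LBINT v:{0<..}. v powr (real d / 2) * exp (- (s * v / 2)) * h v)"

definition Q_mat :: "real^'n \<Rightarrow> real^'n^'n" where
  "Q_mat z = (\<chi> i j. if i = j then inverse (z $ i) else 0)"

definition Omega_mat :: "real^'p^'n \<Rightarrow> real^'n \<Rightarrow> real^'p^'p" where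
  "Omega_mat X z = matrix_inv (transpose X ** matrix_inv (Q_mat z) ** X)"

definition mu_mat :: "real^'p^'n \<Rightarrow> real^'d^'n \<Rightarrow> real^'n \<Rightarrow> real^'d^'p" where
  "mu_mat X y z =
     matrix_inv (transpose X ** matrix_inv (Q_mat z) ** X)
     ** transpose X ** matrix_inv (Q_mat z) ** y"

definition cond_z ::
    "real^'p^'n \<Rightarrow> real^'d^'n \<Rightarrow> (real \<Rightarrow> real) \<Rightarrow> real^'d^'p \<Rightarrow> real^'d^'d \<Rightarrow> real^'n \<Rightarrow> real" where
  "cond_z X y h \<beta> \<Sigma> z = (\<Prod>i\<in>UNIV. psi CARD('d) h (resid_form X y \<beta> \<Sigma> i) (z $ i))"

definition cond_Sigma ::
    "real^'p^'n \<Rightarrow> real^'d^'n \<Rightarrow> real \<Rightarrow> real^'n \<Rightarrow> real^'d^'d \<Rightarrow> real" where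
  "cond_Sigma X y a z \<Sigma> =
     inv_wishart_density
       (real CARD('n) - real CARD('p) + 2 * a - real CARD('d) - 1)
       (matrix_inv (transpose y ** matrix_inv (Q_mat z) ** y
          - transpose (mu_mat X y z) ** matrix_inv (Omega_mat X z) ** mu_mat X y z))
       \<Sigma>"

definition cond_beta ::
    "real^'p^'n \<Rightarrow> real^'d^'n \<Rightarrow> real^'d^'d \<Rightarrow> real^'n \<Rightarrow> real^'d^'p \<Rightarrow> real" where
  "cond_beta X y \<Sigma> z \<beta> = matrix_normal_density (mu_mat X y z) (Omega_mat X z) \<Sigma> \<beta>"

text \<open>\<open>DA_density X y a h x' x\<close> is the density of moving to \<open>x'\<close> from \<open>x\<close>.\<close>

definition DA_density ::
    "real^'p^'n \<Rightarrow> real^'d^'n \<Rightarrow> real \<Rightarrow> (real \<Rightarrow> real)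
     \<Rightarrow> (real^'d^'p) \<times> (real^'d^'d) \<Rightarrow> (real^'d^'p) \<times> (real^'d^'d) \<Rightarrow> real" where
  "DA_density X y a h = (\<lambda>(\<beta>', \<Sigma>') (\<beta>, \<Sigma>).
     LBINT z:{z. \<forall>i. 0 < z $ i}.
       cond_beta X y \<Sigma>' z \<beta>' * cond_Sigma X y a z \<Sigma>' * cond_z X y h \<beta> \<Sigma> z)"

definition DA_operator ::
    "real^'p^'n \<Rightarrow> real^'d^'n \<Rightarrow> real \<Rightarrow> (real \<Rightarrow> real)
     \<Rightarrow> ((real^'d^'p) \<times> (real^'d^'d) \<Rightarrow> real) \<Rightarrow> (real^'d^'p) \<times> (real^'d^'d) \<Rightarrow> real" where
  "DA_operator X y a h f x = (\<integral>x'. f x' * DA_density X y a h x' x \<partial>state_measure)"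

text \<open>
  Elements of the Hilbert space are represented by functions, and equality of elements is
  equality almost everywhere.
\<close>

definition L20 :: "'a measure \<Rightarrow> ('a \<Rightarrow> real) set" where
  "L20 M = {f \<in> borel_measurable M.
     integrable M (\<lambda>x. (f x)\<^sup>2) \<and> has_bochner_integral M f 0}"

definition L2_inner :: "'a measure \<Rightarrow> ('a \<Rightarrow> real) \<Rightarrow> ('a \<Rightarrow> real) \<Rightarrow> real" where
  "L2_inner M f g = (\<integral>x. f x * g x \<partial>M)"

definition L2_norm :: "'a measure \<Rightarrow> ('a \<Rightarrow> real) \<Rightarrow> real" where
  "L2_norm M f = sqrt (L2_inner M f f)"

text \<open>
  The trace-class property below is meant for positive self-adjoint operators on this space.
  Self-adjointness on the whole space implies that the operator is linear and respects
  equality almost everywhere, so these need not be required separately.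
\<close>

definition pos_selfadjoint_on_L20 ::
    "'a measure \<Rightarrow> (('a \<Rightarrow> real) \<Rightarrow> 'a \<Rightarrow> real) \<Rightarrow> bool" where
  "pos_selfadjoint_on_L20 M T \<longleftrightarrow>
     (\<forall>f\<in>L20 M. T f \<in> L20 M) \<and>
     (\<forall>f\<in>L20 M. \<forall>g\<in>L20 M. L2_inner M (T f) g = L2_inner M f (T g)) \<and>
     (\<forall>f\<in>L20 M. 0 \<le> L2_inner M (T f) f)"

definition compact_on_L20 :: "'a measure \<Rightarrow> (('a \<Rightarrow> real) \<Rightarrow> 'a \<Rightarrow> real) \<Rightarrow> bool" where
  "compact_on_L20 M T \<longleftrightarrow>
     (\<forall>f :: nat \<Rightarrow> 'a \<Rightarrow> real.
        (\<forall>k. f k \<in> L20 M) \<and> (\<exists>C. \<forall>k. L2_norm M (f k) \<le> C) \<longrightarrow>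
        (\<exists>g\<in>L20 M. \<exists>r :: nat \<Rightarrow> nat. strict_mono r \<and>
           (\<lambda>k. L2_norm M (\<lambda>x. T (f (r k)) x - g x)) \<longlonglongrightarrow> 0))"

definition eigenspace :: "'a measure \<Rightarrow> (('a \<Rightarrow> real) \<Rightarrow> 'a \<Rightarrow> real) \<Rightarrow> real \<Rightarrow> ('a \<Rightarrow> real) set" where
  "eigenspace M T l = {f \<in> L20 M. AE x in M. T f x = l * f x}"

definition eigenvalues :: "'a measure \<Rightarrow> (('a \<Rightarrow> real) \<Rightarrow> 'a \<Rightarrow> real) \<Rightarrow> real set" where
  "eigenvalues M T = {l. \<exists>f\<in>eigenspace M T l. \<not> (AE x in M. f x = 0)}"

text \<open>The dimension of the eigenspace modulo equality almost everywhere.\<close>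

definition multiplicity_on_L20 ::
    "'a measure \<Rightarrow> (('a \<Rightarrow> real) \<Rightarrow> 'a \<Rightarrow> real) \<Rightarrow> real \<Rightarrow> enat" where
  "multiplicity_on_L20 M T l =
     Sup {enat k | k. \<exists>e :: nat \<Rightarrow> 'a \<Rightarrow> real.
        (\<forall>i<k. e i \<in> eigenspace M T l) \<and>
        (\<forall>c :: nat \<Rightarrow> real. (AE x in M. (\<Sum>i<k. c i * e i x) = 0) \<longrightarrow> (\<forall>i<k. c i = 0))}"

text \<open>
  The eigenvalues are summed with multiplicity; a possible eigenvalue 0 contributes 0 even if
  its multiplicity is infinite.
\<close>

definition trace_class_on_L20 ::
    "'a measure \<Rightarrow> (('a \<Rightarrow> real) \<Rightarrow> 'a \<Rightarrow> real) \<Rightarrow> bool" where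
  "trace_class_on_L20 M T \<longleftrightarrow>
     pos_selfadjoint_on_L20 M T \<and> compact_on_L20 M T \<and>
     (\<Sum>\<^sub>\<infinity>l\<in>eigenvalues M T. ennreal_of_enat (multiplicity_on_L20 M T l) * ennreal l) < \<infinity>"

definition zero_near_origin :: "(real \<Rightarrow> real) \<Rightarrow> bool" where
  "zero_near_origin h \<longleftrightarrow> (\<exists>\<eta>>0. \<forall>u\<in>{0<..<\<eta>}. h u = 0)"

definition class_A :: "(real \<Rightarrow> real) set" where
  "class_A = {g. (\<forall>u>0. 0 \<le> g u) \<and> (\<exists>\<eta>>0. \<forall>u\<in>{0<..<\<eta>}. 0 < g u \<and> g differentiable (at u))}"

text \<open>
  The convention \<open>1 / 0 = 0\<close> does no harm below: \<open>\<eta>\<close> can be shrunk until \<open>\<kappa>\<close> is positive on the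
  whole interval.
\<close>

definition class_K :: "(real \<Rightarrow> real) set" where
  "class_K = {\<kappa> \<in> class_A. \<exists>\<eta>>0. set_integrable lborel {0<..<\<eta>} (\<lambda>u. 1 / \<kappa> u)}"

definition class_C :: "nat \<Rightarrow> (real \<Rightarrow> real) \<Rightarrow> real \<Rightarrow> (real \<Rightarrow> real) set" where
  "class_C d \<kappa> \<zeta> = {g \<in> class_A.
     (\<exists>\<eta>>0. \<exists>B. \<forall>u\<in>{0<..<\<eta>}. \<bar>u powr (real d / 2) * g u\<bar> \<le> B) \<and>
     ((\<lambda>u. \<kappa> u * u powr (real d / 2) * g u) \<longlongrightarrow> 0) (at_right 0) \<and>
     (\<exists>l1. ((\<lambda>u. (deriv \<kappa> u + real d / 2 * (\<kappa> u / u)) * (g u / g (\<zeta> * u))) \<longlongrightarrow> l1) (at_right 0)) \<and>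
     (\<exists>l2. ((\<lambda>u. \<kappa> u * deriv g u / g (\<zeta> * u)) \<longlongrightarrow> l2) (at_right 0))}"

end

theory Submission
  imports Defs "HOL-Library.Diagonal_Subsequence" "HOL-Probability.Distributions"
begin

text \<open>
  Write \<open>E(x,z)\<close> for the factor of the joint density of the state \<open>x = (\<beta>,\<Sigma>)\<close> and the latent vector \<open>z\<close>
  that depends on \<open>x\<close>, and \<open>c(z) = \<integral> E(x,z) dx\<close>. With respect to the posterior the operator has the kernel
  \<open>q(x,x') = \<integral> \<phi>(x,z) \<phi>(x',z) dz\<close> for a nonnegative \<open>\<phi>\<close>, so it is symmetric and positive, and \<open>q 1 = 1\<close>.
  If \<open>\<integral>\<integral> \<phi>(x,z)\<^sup>2 dz dx\<close> is finite, then \<open>q\<close> is square integrable, which turns weak convergence into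
  norm convergence and gives compactness, and Bessel's inequality for \<open>\<phi>(\<cdot>,z)\<close> bounds every sum of
  eigenvalues by this integral.

  The integral is \<open>\<integral>\<integral> \<pi>(x|z) \<pi>(z|x) dx dz\<close>. Put \<open>\<psi>(u) = u\<^bsup>d/2\<^esup> h(u)\<close> and \<open>\<Psi>(t) = \<integral>\<^sub>0\<^sup>t \<psi>\<close>. The normalizing
  constant of \<open>\<psi>(u) e\<^bsup>-ru/2\<^esup>\<close> is at least \<open>e\<^bsup>-r\<zeta>u/2\<^esup> \<Psi>(\<zeta>u)\<close>, and the remaining
  factor \<open>e\<^bsup>-(2-\<zeta>)ru/2\<^esup>\<close> can be integrated over \<open>x\<close> by the homogeneity of \<open>c\<close>. Hence the integral is at most a
  constant times the \<open>n\<close>-th power of \<open>\<integral> \<psi>(u) / \<Psi>(\<zeta>u) du\<close>. The conditions of the theorem make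
  \<open>\<psi>(u) / \<Psi>(\<zeta>u)\<close> integrable near 0: for \<open>g\<close> in the class, \<open>\<gamma>(u) = u\<^bsup>d/2\<^esup> g(u)\<close> satisfies
  \<open>(\<kappa>\<gamma>)'(u) \<le> C \<gamma>(\<zeta>u)\<close>, so \<open>\<gamma>(u) / \<integral>\<^sub>0\<^bsup>\<zeta>u\<^esup> \<gamma> \<le> C / \<kappa>(u)\<close>.
\<close>

section \<open>Square-integrable functions and weak subsequences\<close>

definition L2 :: "'a measure \<Rightarrow> ('a \<Rightarrow> real) set" where
  "L2 M = {f \<in> borel_measurable M. integrable M (\<lambda>x. (f x)\<^sup>2)}"

lemma L2_measurable [measurable_dest]: "f \<in> L2 M \<Longrightarrow> f \<in> borel_measurable M"
  by (simp add: L2_def)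

lemma L2_square_integrable: "f \<in> L2 M \<Longrightarrow> integrable M (\<lambda>x. (f x)\<^sup>2)"
  by (simp add: L2_def)

lemma L2_I:
  assumes "f \<in> borel_measurable M" "integrable M (\<lambda>x. (f x)\<^sup>2)"
  shows "f \<in> L2 M"
  using assms by (simp add: L2_def)

lemma abs_mult_le_sum_squares: "\<bar>a * b\<bar> \<le> a\<^sup>2 + (b\<^sup>2 :: real)"
proof -
  have "0 \<le> (\<bar>a\<bar> - \<bar>b\<bar>)\<^sup>2" by simp
  then have "2 * (\<bar>a\<bar> * \<bar>b\<bar>) \<le> a\<^sup>2 + b\<^sup>2" by (simp add: power2_diff)
  moreover have "0 \<le> \<bar>a\<bar> * \<bar>b\<bar>" by simp
  ultimately show ?thesis by (simp only: abs_mult)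
qed

lemma L2_mult_integrable:
  assumes "f \<in> L2 M" "g \<in> L2 M"
  shows "integrable M (\<lambda>x. f x * g x)"
proof (rule Bochner_Integration.integrable_bound)
  show "integrable M (\<lambda>x. (f x)\<^sup>2 + (g x)\<^sup>2)"
    using assms by (auto simp: L2_def)
  show "(\<lambda>x. f x * g x) \<in> borel_measurable M"
    using assms by (auto simp: L2_def)
qed (auto intro: order_trans[OF abs_mult_le_sum_squares])

lemma L2_add:
  assumes f: "f \<in> L2 M" and g: "g \<in> L2 M"
  shows "(\<lambda>x. f x + g x) \<in> L2 M"
proof (rule L2_I)
  show "(\<lambda>x. f x + g x) \<in> borel_measurable M" using f g by (auto simp: L2_def)
  have "integrable M (\<lambda>x. (f x)\<^sup>2 + (g x)\<^sup>2 + 2 * (f x * g x))"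
    using f g L2_mult_integrable[OF f g] by (auto simp: L2_def)
  then show "integrable M (\<lambda>x. (f x + g x)\<^sup>2)"
    by (simp add: power2_sum mult.assoc)
qed

lemma L2_cmult: "f \<in> L2 M \<Longrightarrow> (\<lambda>x. c * f x) \<in> L2 M"
  by (auto simp: L2_def power_mult_distrib)

lemma L2_diff:
  assumes f: "f \<in> L2 M" and g: "g \<in> L2 M"
  shows "(\<lambda>x. f x - g x) \<in> L2 M"
  using L2_add[OF f L2_cmult[OF g, of "-1"]] by simp

lemma L2_sum:
  assumes "\<And>i. i \<in> I \<Longrightarrow> f i \<in> L2 M"
  shows "(\<lambda>x. \<Sum>i\<in>I. f i x) \<in> L2 M"
  using assms
proof (induction I rule: infinite_finite_induct)
  case (insert i I)
  then show ?case using L2_add[of "f i" M "\<lambda>x. \<Sum>i\<in>I. f i x"] by simp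
qed (auto simp: L2_def)

lemma L2_Cauchy_Schwarz:
  assumes f: "f \<in> L2 M" and g: "g \<in> L2 M"
  shows "(\<integral>x. f x * g x \<partial>M)\<^sup>2 \<le> (\<integral>x. (f x)\<^sup>2 \<partial>M) * (\<integral>x. (g x)\<^sup>2 \<partial>M)"
proof -
  have [measurable]: "f \<in> borel_measurable M" "g \<in> borel_measurable M"
    using f g by (auto simp: L2_def)
  have e: "(\<integral>\<^sup>+x. ennreal \<bar>f x\<bar> * ennreal \<bar>g x\<bar> \<partial>M) = ennreal (\<integral>x. \<bar>f x * g x\<bar> \<partial>M)"
    using integrable_abs[OF L2_mult_integrable[OF f g]]
    by (subst nn_integral_eq_integral[symmetric]) (auto simp: abs_mult ennreal_mult)
  have sq: "(\<integral>\<^sup>+x. (ennreal \<bar>k x\<bar>)\<^sup>2 \<partial>M) = ennreal (\<integral>x. (k x)\<^sup>2 \<partial>M)" if "k \<in> L2 M" for k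
    using that by (subst nn_integral_eq_integral[symmetric]) (auto simp: L2_def ennreal_power)
  have "ennreal ((\<integral>x. \<bar>f x * g x\<bar> \<partial>M)\<^sup>2) \<le> ennreal ((\<integral>x. (f x)\<^sup>2 \<partial>M) * (\<integral>x. (g x)\<^sup>2 \<partial>M))"
    using Cauchy_Schwarz_nn_integral[of "\<lambda>x. ennreal \<bar>f x\<bar>" M "\<lambda>x. ennreal \<bar>g x\<bar>"]
    unfolding e sq[OF f] sq[OF g] by (simp add: ennreal_power ennreal_mult)
  then have "(\<integral>x. \<bar>f x * g x\<bar> \<partial>M)\<^sup>2 \<le> (\<integral>x. (f x)\<^sup>2 \<partial>M) * (\<integral>x. (g x)\<^sup>2 \<partial>M)"
    by (subst (asm) ennreal_le_iff) auto
  moreover have "(\<integral>x. f x * g x \<partial>M)\<^sup>2 \<le> (\<integral>x. \<bar>f x * g x\<bar> \<partial>M)\<^sup>2"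
    by (rule power2_le_iff_abs_le[THEN iffD2]) (auto intro: integral_abs_bound)
  ultimately show ?thesis by linarith
qed

lemma L2_functional_convergent_closed:
  fixes F :: "nat \<Rightarrow> 'a \<Rightarrow> real"
  assumes F: "\<And>k. F k \<in> L2 M" "\<And>k. (\<integral>x. (F k x)\<^sup>2 \<partial>M) \<le> C"
    and u: "\<And>j. u j \<in> L2 M" "g \<in> L2 M"
    and lim: "(\<lambda>j. \<integral>x. (u j x - g x)\<^sup>2 \<partial>M) \<longlonglongrightarrow> 0"
    and cv: "\<And>j. convergent (\<lambda>k. \<integral>x. u j x * F k x \<partial>M)"
  shows "convergent (\<lambda>k. \<integral>x. g x * F k x \<partial>M)"
proof -
  have C0: "0 \<le> C" using F(2)[of 0] by (auto intro: order_trans[rotated])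
  have near: "(\<integral>x. u j x * F k x \<partial>M) - (\<integral>x. g x * F k x \<partial>M) = (\<integral>x. (u j x - g x) * F k x \<partial>M)" for j k
    using L2_mult_integrable[OF u(1)[of j] F(1)[of k]] L2_mult_integrable[OF u(2) F(1)[of k]]
    by (simp add: left_diff_distrib)
  have bd: "((\<integral>x. u j x * F k x \<partial>M) - (\<integral>x. g x * F k x \<partial>M))\<^sup>2 \<le> (\<integral>x. (u j x - g x)\<^sup>2 \<partial>M) * C" for j k
    unfolding near
    by (rule order_trans[OF L2_Cauchy_Schwarz[OF L2_diff[OF u(1) u(2)] F(1)]])
       (intro mult_left_mono F(2), simp)
  have "Cauchy (\<lambda>k. \<integral>x. g x * F k x \<partial>M)"
    unfolding Cauchy_iff
  proof safe
    fix e :: real assume e: "0 < e"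
    have "(\<lambda>j. (\<integral>x. (u j x - g x)\<^sup>2 \<partial>M) * C) \<longlonglongrightarrow> 0"
      using tendsto_mult_right[OF lim, of C] by simp
    then have "eventually (\<lambda>j. (\<integral>x. (u j x - g x)\<^sup>2 \<partial>M) * C < (e/3)\<^sup>2) sequentially"
      using e by (intro order_tendstoD) auto
    then obtain j where j: "(\<integral>x. (u j x - g x)\<^sup>2 \<partial>M) * C < (e/3)\<^sup>2"
      by (auto simp: eventually_sequentially)
    have d: "\<bar>(\<integral>x. u j x * F k x \<partial>M) - (\<integral>x. g x * F k x \<partial>M)\<bar> < e/3" for k
      using power2_less_imp_less[of "\<bar>(\<integral>x. u j x * F k x \<partial>M) - (\<integral>x. g x * F k x \<partial>M)\<bar>" "e/3"]
        le_less_trans[OF bd j, of k] e by simp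
    obtain N where N: "\<And>m n. m \<ge> N \<Longrightarrow> n \<ge> N \<Longrightarrow> \<bar>(\<integral>x. u j x * F m x \<partial>M) - (\<integral>x. u j x * F n x \<partial>M)\<bar> < e/3"
      using convergent_Cauchy[OF cv[of j]] e unfolding Cauchy_iff
      by (metis real_norm_def divide_pos_pos zero_less_numeral)
    show "\<exists>N. \<forall>m\<ge>N. \<forall>n\<ge>N. norm ((\<integral>x. g x * F m x \<partial>M) - (\<integral>x. g x * F n x \<partial>M)) < e"
    proof (intro exI allI impI)
      fix m n assume "m \<ge> N" "n \<ge> N"
      from N[OF this] d[of m] d[of n] show "norm ((\<integral>x. g x * F m x \<partial>M) - (\<integral>x. g x * F n x \<partial>M)) < e"
        unfolding real_norm_def by linarith
    qed
  qed
  then show ?thesis by (rule Cauchy_convergent)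
qed

lemma countable_Int_stable_borel_generator:
  obtains G :: "'a::second_countable_topology set set"
  where "countable G" "Int_stable G" "G \<noteq> {}" "sets borel = sigma_sets UNIV G"
proof -
  obtain B :: "'a set set" where B: "countable B" "topological_basis B"
    using ex_countable_basis by blast
  define G where "G = Inter ` {F. finite F \<and> F \<subseteq> B}"
  have "countable G" unfolding G_def
    using countable_Collect_finite_subset[OF B(1)] by blast
  moreover have "Int_stable G"
    unfolding Int_stable_def G_def
  proof safe
    fix F F' assume "finite F" "F \<subseteq> B" "finite F'" "F' \<subseteq> B"
    then show "\<Inter>F \<inter> \<Inter>F' \<in> Inter ` {F. finite F \<and> F \<subseteq> B}"
      by (intro image_eqI[of _ _ "F \<union> F'"]) auto
  qed
  moreover have "G \<noteq> {}" unfolding G_def by auto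
  moreover have "sets borel = sigma_sets UNIV G"
  proof -
    have "sets (borel :: 'a measure) = sigma_sets UNIV B"
      by (subst borel_eq_countable_basis[OF B]) (simp add: sets_measure_of)
    moreover have "sigma_sets UNIV B = sigma_sets UNIV G"
    proof (rule sigma_sets_eqI)
      fix b assume "b \<in> B"
      then have "b \<in> G" unfolding G_def by (intro image_eqI[of _ _ "{b}"]) auto
      then show "b \<in> sigma_sets UNIV G" by auto
    next
      fix g assume "g \<in> G"
      then obtain F where F: "finite F" "F \<subseteq> B" "g = \<Inter>F" unfolding G_def by auto
      have "open b" if "b \<in> F" for b using F B(2) that topological_basis_open by blast
      then have "open g" using F by (auto intro: open_Inter)
      then have "g \<in> sets borel" by simp
      then show "g \<in> sigma_sets UNIV B" using calculation by simp
    qed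
    ultimately show ?thesis by simp
  qed
  ultimately show ?thesis using that by blast
qed

lemma L2_functional_convergent_Dynkin:
  fixes M :: "'a::topological_space measure"
  assumes fin: "finite_measure M" and sets: "sets M = sets (restrict_space borel S)"
    and G: "Int_stable G" "sets borel = sigma_sets UNIV G"
    and F: "\<And>k. F k \<in> L2 M" "\<And>k. (\<integral>x. (F k x)\<^sup>2 \<partial>M) \<le> C"
    and one: "convergent (\<lambda>k. \<integral>x. F k x \<partial>M)"
    and gen: "\<And>A. A \<in> G \<Longrightarrow> convergent (\<lambda>k. \<integral>x. indicator A x * F k x \<partial>M)"
    and g: "g \<in> L2 M"
  shows "convergent (\<lambda>k. \<integral>x. g x * F k x \<partial>M)"
proof -
  interpret finite_measure M by fact
  have sp: "space M = S" using sets_eq_imp_space_eq[OF sets] by (simp add: space_restrict_space)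
  have Fint: "integrable M (F k)" for k
  proof -
    have "(\<lambda>_. 1) \<in> L2 M" by (simp add: L2_def)
    from L2_mult_integrable[OF this F(1)] show ?thesis by simp
  qed
  have ms: "A \<inter> space M \<in> sets M" if "A \<in> sets borel" for A
    using that unfolding sets sp by (auto simp: sets_restrict_space)
  have mi: "(indicator A :: 'a \<Rightarrow> real) \<in> borel_measurable M" if "A \<in> sets borel" for A
  proof -
    have "(indicator (A \<inter> space M) :: 'a \<Rightarrow> real) \<in> borel_measurable M"
      using ms[OF that] by simp
    then show ?thesis by (subst measurable_cong[where g="indicator (A \<inter> space M)"]) (auto simp: indicator_def)
  qed
  have L2i: "(indicator A :: 'a \<Rightarrow> real) \<in> L2 M" if "A \<in> sets borel" for A
    by (rule L2_I[OF mi[OF that]], rule integrable_const_bound[where B=1])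
       (use borel_measurable_power[OF mi[OF that], of 2] in \<open>auto simp: indicator_def\<close>)
  have subset_Pow: "G \<subseteq> Pow UNIV" by simp
  have ind: "convergent (\<lambda>k. \<integral>x. indicator A x * F k x \<partial>M)" if A: "A \<in> sets borel" for A
    using G(1) subset_Pow A[unfolded G(2)]
  proof (induction A rule: sigma_sets_induct_disjoint)
    case (compl A)
    have A: "A \<in> sets borel" using compl G(2) by auto
    have "(\<integral>x. indicator (UNIV - A) x * F k x \<partial>M) = (\<integral>x. F k x \<partial>M) - (\<integral>x. indicator A x * F k x \<partial>M)" for k
    proof -
      have "(\<integral>x. indicator (UNIV - A) x * F k x \<partial>M) = (\<integral>x. F k x - indicator A x * F k x \<partial>M)"
        by (rule Bochner_Integration.integral_cong) (auto simp: indicator_def)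
      then show ?thesis using Fint L2_mult_integrable[OF L2i[OF A] F(1)[of k]] by simp
    qed
    then show ?case using convergent_diff[OF one compl(2)] by simp
  next
    case (union A)
    have A: "A i \<in> sets borel" for i using union(2) G(2) by auto
    define u where "u n = (indicator (\<Union>i<n. A i) :: 'a \<Rightarrow> real)" for n :: nat
    have uL2: "u n \<in> L2 M" for n unfolding u_def using A by (intro L2i) auto
    have UL2: "indicator (\<Union>i. A i) \<in> L2 M" using A by (intro L2i) auto
    show ?case
    proof (rule L2_functional_convergent_closed[OF F uL2 UL2])
      have "(\<lambda>n. \<integral>x. (u n x - indicator (\<Union>i. A i) x)\<^sup>2 \<partial>M) \<longlonglongrightarrow> (\<integral>x. 0 \<partial>M)"
      proof (rule integral_dominated_convergence[where w="\<lambda>_. 1"])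
        show "AE x in M. (\<lambda>n. (u n x - indicator (\<Union>i. A i) x)\<^sup>2) \<longlonglongrightarrow> 0"
        proof (rule AE_I2)
          fix x
          have "(\<lambda>n. u n x) \<longlonglongrightarrow> indicator (\<Union>i. A i) x"
            unfolding u_def by (rule LIMSEQ_indicator_UN)
          from tendsto_diff[OF this tendsto_const[of "indicator (\<Union>i. A i) x"]]
          have "(\<lambda>n. u n x - indicator (\<Union>i. A i) x) \<longlonglongrightarrow> 0" by simp
          from tendsto_power[OF this, of 2] show "(\<lambda>n. (u n x - indicator (\<Union>i. A i) x)\<^sup>2) \<longlonglongrightarrow> 0" by simp
        qed
        fix n
        show "(\<lambda>x. (u n x - indicator (\<Union>i. A i) x)\<^sup>2) \<in> borel_measurable M"
          by (intro borel_measurable_power borel_measurable_diff L2_measurable uL2 UL2)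
        show "AE x in M. norm ((u n x - indicator (\<Union>i. A i) x)\<^sup>2) \<le> 1"
          by (auto simp: u_def indicator_def)
      qed auto
      then show "(\<lambda>n. \<integral>x. (u n x - indicator (\<Union>i. A i) x)\<^sup>2 \<partial>M) \<longlonglongrightarrow> 0" by simp
      fix n
      have dis: "u n x = (\<Sum>i<n. indicator (A i) x)" for x
        unfolding u_def using union(1)
        by (subst indicator_UN_disjoint) (auto simp: disjoint_family_on_def)
      have "(\<integral>x. u n x * F k x \<partial>M) = (\<Sum>i<n. \<integral>x. indicator (A i) x * F k x \<partial>M)" for k
        unfolding dis sum_distrib_right
        by (rule Bochner_Integration.integral_sum) (rule L2_mult_integrable[OF L2i[OF A] F(1)])
      then show "convergent (\<lambda>k. \<integral>x. u n x * F k x \<partial>M)"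
        using union(3) by (auto intro: convergent_sum)
    qed
  qed (auto intro: gen convergent_const)
  have pos: "convergent (\<lambda>k. \<integral>x. v x * F k x \<partial>M)" if "v \<in> L2 M" "\<And>x. 0 \<le> v x" for v
  proof -
    have vm: "v \<in> borel_measurable M" using that by (simp add: L2_def)
    from vm that(2) have "integrable M (\<lambda>x. (v x)\<^sup>2) \<longrightarrow> convergent (\<lambda>k. \<integral>x. v x * F k x \<partial>M)"
    proof (induction v rule: borel_measurable_induct_real)
      case (set A)
      then obtain B where B: "B \<in> sets borel" "A = S \<inter> B"
        unfolding sets by (auto simp: sets_restrict_space)
      have "(\<integral>x. indicator A x * F k x \<partial>M) = (\<integral>x. indicator B x * F k x \<partial>M)" for k
        by (rule Bochner_Integration.integral_cong) (auto simp: B sp indicator_def)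
      then show ?case using ind[OF B(1)] by simp
    next
      case (mult u c)
      show ?case
      proof
        assume i: "integrable M (\<lambda>x. (c * u x)\<^sup>2)"
        show "convergent (\<lambda>k. \<integral>x. c * u x * F k x \<partial>M)"
        proof (cases "c = 0")
          case True then show ?thesis by (simp add: convergent_const)
        next
          case False
          then have "integrable M (\<lambda>x. (u x)\<^sup>2)"
            using i by (simp add: power_mult_distrib)
          then have "convergent (\<lambda>k. \<integral>x. u x * F k x \<partial>M)" using mult by blast
          then show ?thesis by (simp add: mult.assoc convergent_mult_const_iff False)
        qed
      qed
    next
      case (add u v)
      show ?case
      proof
        assume i: "integrable M (\<lambda>x. (v x + u x)\<^sup>2)"
        have iu: "integrable M (\<lambda>x. (u x)\<^sup>2)"
          by (rule Bochner_Integration.integrable_bound[OF i])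
             (use add in \<open>auto intro!: power_mono\<close>)
        have iv: "integrable M (\<lambda>x. (v x)\<^sup>2)"
          by (rule Bochner_Integration.integrable_bound[OF i])
             (use add in \<open>auto intro!: power_mono\<close>)
        have "u \<in> L2 M" "v \<in> L2 M" using iu iv add by (auto simp: L2_def)
        then have "(\<integral>x. (v x + u x) * F k x \<partial>M) = (\<integral>x. v x * F k x \<partial>M) + (\<integral>x. u x * F k x \<partial>M)" for k
          unfolding distrib_right by (intro Bochner_Integration.integral_add L2_mult_integrable F)
        then show "convergent (\<lambda>k. \<integral>x. (v x + u x) * F k x \<partial>M)"
          using add.IH iu iv by (auto intro: convergent_add)
      qed
    next
      case (seq U)
      show ?case
      proof
        assume i: "integrable M (\<lambda>x. (v x)\<^sup>2)"
        have vm: "v \<in> borel_measurable M" by fact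
        have le: "U j x \<le> v x" if "x \<in> space M" for j x
          using seq(4)[OF that] \<open>incseq U\<close> by (intro incseq_le) (auto simp: incseq_def le_fun_def)
        have iU: "integrable M (\<lambda>x. (U j x)\<^sup>2)" for j
          by (rule Bochner_Integration.integrable_bound[OF i])
             (use seq le in \<open>auto intro!: power_mono\<close>)
        have v: "v \<in> L2 M" and U: "\<And>j. U j \<in> L2 M" using i iU seq vm by (auto simp: L2_def)
        show "convergent (\<lambda>k. \<integral>x. v x * F k x \<partial>M)"
        proof (rule L2_functional_convergent_closed[OF F U v])
          have "(\<lambda>n. \<integral>x. (U n x - v x)\<^sup>2 \<partial>M) \<longlonglongrightarrow> (\<integral>x. 0 \<partial>M)"
          proof (rule integral_dominated_convergence[where w="\<lambda>x. (v x)\<^sup>2"])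
            show "AE x in M. (\<lambda>n. (U n x - v x)\<^sup>2) \<longlonglongrightarrow> 0"
            proof (rule AE_I2)
              fix x assume "x \<in> space M"
              from tendsto_diff[OF seq(4)[OF this] tendsto_const[of "v x"]]
              have "(\<lambda>n. U n x - v x) \<longlonglongrightarrow> 0" by simp
              from tendsto_power[OF this, of 2] show "(\<lambda>n. (U n x - v x)\<^sup>2) \<longlonglongrightarrow> 0" by simp
            qed
            show "AE x in M. norm ((U n x - v x)\<^sup>2) \<le> (v x)\<^sup>2" for n
            proof (rule AE_I2)
              fix x assume x: "x \<in> space M"
              have "\<bar>U n x - v x\<bar> \<le> \<bar>v x\<bar>" using le[OF x, of n] seq(2)[of n x] by simp
              then show "norm ((U n x - v x)\<^sup>2) \<le> (v x)\<^sup>2"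
                by (simp add: abs_le_square_iff)
            qed
            show "(\<lambda>x. (U n x - v x)\<^sup>2) \<in> borel_measurable M" for n
              by (intro borel_measurable_power borel_measurable_diff L2_measurable U v)
          qed (use i in auto)
          then show "(\<lambda>n. \<integral>x. (U n x - v x)\<^sup>2 \<partial>M) \<longlonglongrightarrow> 0" by simp
        qed (use seq iU in auto)
      qed
    qed
    then show ?thesis using that by (auto simp: L2_def)
  qed
  have gm: "g \<in> borel_measurable M" using g by (simp add: L2_def)
  have pp: "(\<lambda>x. max 0 (g x)) \<in> L2 M"
    by (rule L2_I, use gm in simp,
        rule Bochner_Integration.integrable_bound[OF L2_square_integrable[OF g]])
       (use gm in \<open>auto simp: max_def\<close>)
  have nn: "(\<lambda>x. max 0 (- g x)) \<in> L2 M"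
    by (rule L2_I, use gm in simp,
        rule Bochner_Integration.integrable_bound[OF L2_square_integrable[OF g]])
       (use gm in \<open>auto simp: max_def\<close>)
  have "(\<integral>x. g x * F k x \<partial>M) = (\<integral>x. max 0 (g x) * F k x \<partial>M) - (\<integral>x. max 0 (- g x) * F k x \<partial>M)" for k
  proof -
    have "(\<integral>x. g x * F k x \<partial>M) = (\<integral>x. max 0 (g x) * F k x - max 0 (- g x) * F k x \<partial>M)"
      by (rule Bochner_Integration.integral_cong) (auto simp: max_def)
    then show ?thesis
      using L2_mult_integrable[OF pp F(1)[of k]] L2_mult_integrable[OF nn F(1)[of k]] by simp
  qed
  then show ?thesis using convergent_diff[OF pos[OF pp] pos[OF nn]] by simp
qed

lemma L2_weak_subsequence:
  fixes M :: "'a::second_countable_topology measure"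
  assumes fin: "finite_measure M" and sets: "sets M = sets (restrict_space borel S)"
    and f: "\<And>k. f k \<in> L2 M" "\<And>k. (\<integral>x. (f k x)\<^sup>2 \<partial>M) \<le> C"
  obtains r :: "nat \<Rightarrow> nat" where "strict_mono r"
    "\<And>g. g \<in> L2 M \<Longrightarrow> convergent (\<lambda>k. \<integral>x. g x * f (r k) x \<partial>M)"
proof -
  interpret finite_measure M by fact
  have sp: "space M = S" using sets_eq_imp_space_eq[OF sets] by (simp add: space_restrict_space)
  have C0: "0 \<le> C" using f(2)[of 0] by (auto intro: order_trans[rotated])
  obtain G :: "'a set set" where G: "countable G" "Int_stable G" "G \<noteq> {}" "sets borel = sigma_sets UNIV G"
    by (rule countable_Int_stable_borel_generator)
  define A where "A n = (case n of 0 \<Rightarrow> UNIV | Suc m \<Rightarrow> from_nat_into G m)" for n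
  have Ab: "A n \<in> sets borel" for n
    unfolding A_def G(4) using from_nat_into[OF G(3)] 
    by (auto split: nat.split intro: sigma_sets_top)
  have AL: "(indicator (A n) :: 'a \<Rightarrow> real) \<in> L2 M" for n
  proof -
    have "(indicator (A n \<inter> space M) :: 'a \<Rightarrow> real) \<in> borel_measurable M"
      using Ab[of n] unfolding sp by (intro borel_measurable_indicator) (auto simp: sets sets_restrict_space)
    then have m: "(indicator (A n) :: 'a \<Rightarrow> real) \<in> borel_measurable M"
      by (subst measurable_cong[where g="indicator (A n \<inter> space M)"]) (auto simp: indicator_def)
    show ?thesis
      by (rule L2_I[OF m], rule integrable_const_bound[where B=1]) (use borel_measurable_power[OF m, of 2] in \<open>auto simp: indicator_def\<close>)
  qed
  let ?I = "\<lambda>n k. \<integral>x. indicator (A n) x * f k x \<partial>M"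
  have bd: "\<bar>?I n k\<bar> \<le> sqrt ((\<integral>x. (indicator (A n) x)\<^sup>2 \<partial>M) * C)" for n k
  proof -
    have "(?I n k)\<^sup>2 \<le> (\<integral>x. (indicator (A n) x)\<^sup>2 \<partial>M) * C"
      by (rule order_trans[OF L2_Cauchy_Schwarz[OF AL f(1)]])
         (intro mult_left_mono f(2), simp)
    then show ?thesis using real_sqrt_le_mono by fastforce
  qed
  interpret sub: subseqs "\<lambda>n s. convergent (\<lambda>k. ?I n (s k))"
  proof
    fix n and s :: "nat \<Rightarrow> nat"
    let ?K = "sqrt ((\<integral>x. (indicator (A n) x)\<^sup>2 \<partial>M) * C)"
    have "bounded (range (\<lambda>k. ?I n (s k)))"
      unfolding bounded_iff using bd[of n] by (intro exI[of _ ?K]) auto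
    from bounded_imp_convergent_subsequence[OF this] show "\<exists>r'. strict_mono r' \<and> convergent (\<lambda>k. ?I n ((s \<circ> r') k))"
      by (auto simp: convergent_def o_def)
  qed
  have cv: "convergent (\<lambda>k. ?I n (sub.diagseq k))" for n
  proof -
    have "convergent (\<lambda>k. ?I n ((sub.diagseq \<circ> (+) (Suc n)) k))"
    proof (rule sub.diagseq_holds)
      fix r s :: "nat \<Rightarrow> nat" and n
      assume "strict_mono r" "convergent (\<lambda>k. ?I n (s k))"
      then show "convergent (\<lambda>k. ?I n ((s \<circ> r) k))"
        using convergent_subseq_convergent[of "\<lambda>k. ?I n (s k)" r] by (simp add: o_def)
    qed
    then have "convergent (\<lambda>k. ?I n (sub.diagseq (k + Suc n)))" by (simp add: o_def add.commute)
    then show ?thesis by (subst (asm) convergent_ignore_initial_segment)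
  qed
  have "convergent (\<lambda>k. \<integral>x. g x * f (sub.diagseq k) x \<partial>M)" if g: "g \<in> L2 M" for g
  proof (rule L2_functional_convergent_Dynkin[OF fin sets G(2,4) f(1) f(2) _ _ g])
    show "convergent (\<lambda>k. \<integral>x. f (sub.diagseq k) x \<partial>M)" using cv[of 0] by (simp add: A_def)
    fix B assume "B \<in> G"
    then obtain n where "B = from_nat_into G n" using G(1) by (metis from_nat_into_to_nat_on)
    then show "convergent (\<lambda>k. \<integral>x. indicator B x * f (sub.diagseq k) x \<partial>M)"
      using cv[of "Suc n"] by (simp add: A_def)
  qed
  then show ?thesis using that[OF sub.subseq_diagseq] by blast
qed

section \<open>Positive operators of mixture type\<close>

locale mixture_operator = M: finite_measure M + N: sigma_finite_measure N
  for M :: "'a::second_countable_topology measure" and N :: "'b measure" +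
  fixes S :: "'a set" and \<phi> :: "'a \<Rightarrow> 'b \<Rightarrow> real" and T :: "('a \<Rightarrow> real) \<Rightarrow> 'a \<Rightarrow> real"
  assumes sets_M: "sets M = sets (restrict_space borel S)"
    and \<phi>_measurable: "case_prod \<phi> \<in> borel_measurable (M \<Otimes>\<^sub>M N)"
    and \<phi>_nonneg: "\<And>x z. 0 \<le> \<phi> x z"
    and trace_finite: "(\<integral>\<^sup>+x. \<integral>\<^sup>+z. ennreal ((\<phi> x z)\<^sup>2) \<partial>N \<partial>M) < \<infinity>"
    and markov: "AE x in M. (\<integral>\<^sup>+x'. \<integral>\<^sup>+z. ennreal (\<phi> x z * \<phi> x' z) \<partial>N \<partial>M) = 1"
    and T_eq: "\<And>f x. f \<in> L20 M \<Longrightarrow> x \<in> space M \<Longrightarrow>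
      T f x = (\<integral>x'. f x' * (\<integral>z. \<phi> x z * \<phi> x' z \<partial>N) \<partial>M)"
begin

sublocale MN: pair_sigma_finite M N ..
sublocale MM: pair_sigma_finite M M ..
sublocale MMM: sigma_finite_measure "M \<Otimes>\<^sub>M M" by (intro sigma_finite_pair_measure M.sigma_finite_measure_axioms)
sublocale MMN: pair_sigma_finite "M \<Otimes>\<^sub>M M" N ..

lemma \<phi>_measurable_pair [measurable]:
  assumes "f \<in> measurable L M" "g \<in> measurable L N"
  shows "(\<lambda>w. \<phi> (f w) (g w)) \<in> borel_measurable L"
  using measurable_compose[OF measurable_Pair[OF assms] \<phi>_measurable] by simp

definition q :: "'a \<Rightarrow> 'a \<Rightarrow> real" where
  "q x x' = (\<integral>z. \<phi> x z * \<phi> x' z \<partial>N)"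

definition K :: "('a \<Rightarrow> real) \<Rightarrow> 'a \<Rightarrow> real" where
  "K f x = (\<integral>x'. f x' * q x x' \<partial>M)"

definition analysis :: "('a \<Rightarrow> real) \<Rightarrow> 'b \<Rightarrow> real" where
  "analysis f z = (\<integral>x. f x * \<phi> x z \<partial>M)"

definition r2 :: "'a \<Rightarrow> real" where
  "r2 x = (\<integral>z. (\<phi> x z)\<^sup>2 \<partial>N)"

lemma q_measurable [measurable]:
  assumes [measurable]: "f \<in> measurable L M" "g \<in> measurable L M"
  shows "(\<lambda>w. q (f w) (g w)) \<in> borel_measurable L"
  unfolding q_def by measurable

lemma K_measurable [measurable]:
  assumes [measurable]: "f \<in> borel_measurable M"
  shows "K f \<in> borel_measurable M"
  unfolding K_def by measurable

lemma analysis_measurable [measurable]: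
  assumes [measurable]: "f \<in> borel_measurable M"
  shows "analysis f \<in> borel_measurable N"
  unfolding analysis_def by measurable

lemma square_integrable_pair: "integrable (M \<Otimes>\<^sub>M N) (\<lambda>(x, z). (\<phi> x z)\<^sup>2)"
proof (rule integrableI_bounded)
  have "(\<integral>\<^sup>+ w. ennreal (norm (case w of (x, z) \<Rightarrow> (\<phi> x z)\<^sup>2)) \<partial>(M \<Otimes>\<^sub>M N))
      = (\<integral>\<^sup>+x. \<integral>\<^sup>+z. ennreal ((\<phi> x z)\<^sup>2) \<partial>N \<partial>M)"
    by (subst N.nn_integral_fst[symmetric]) auto
  then show "(\<integral>\<^sup>+ w. ennreal (norm (case w of (x, z) \<Rightarrow> (\<phi> x z)\<^sup>2)) \<partial>(M \<Otimes>\<^sub>M N)) < \<infinity>"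
    using trace_finite by simp
qed measurable

lemma AE_row_L2: "AE x in M. \<phi> x \<in> L2 N"
  using MN.AE_integrable_fst'[OF square_integrable_pair]
  by (auto simp: L2_def)

lemma AE_column_L2: "AE z in N. (\<lambda>x. \<phi> x z) \<in> L2 M"
proof -
  have "AE z in N. integrable M (\<lambda>x. (\<phi> x z)\<^sup>2)"
    using MN.AE_integrable_snd[OF square_integrable_pair] by simp
  then show ?thesis by (auto simp: L2_def)
qed

lemma r2_integrable: "integrable M r2"
  using MN.integrable_fst'[OF square_integrable_pair] by (simp add: r2_def[abs_def])

lemma r2_nonneg: "0 \<le> r2 x"
  by (simp add: r2_def)

lemma column_norm_integrable: "integrable N (\<lambda>z. \<integral>x. (\<phi> x z)\<^sup>2 \<partial>M)"
  using MN.integrable_snd[OF square_integrable_pair] by simp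

lemma q_square_le:
  assumes "\<phi> x \<in> L2 N" "\<phi> x' \<in> L2 N"
  shows "(q x x')\<^sup>2 \<le> r2 x * r2 x'"
  unfolding q_def r2_def by (rule L2_Cauchy_Schwarz[OF assms])

lemma AE_q_L2: "AE x in M. q x \<in> L2 M \<and> (\<integral>x'. (q x x')\<^sup>2 \<partial>M) \<le> r2 x * (\<integral>x'. r2 x' \<partial>M)"
proof -
  have "AE x in M. x \<in> space M" by simp
  with AE_row_L2 show ?thesis
  proof eventually_elim
    case (elim x)
    have qm: "q x \<in> borel_measurable M" using elim(2) by measurable
    have le: "AE x' in M. (q x x')\<^sup>2 \<le> r2 x * r2 x'"
      using AE_row_L2 by eventually_elim (rule q_square_le[OF elim(1)])
    have i: "integrable M (\<lambda>x'. r2 x * r2 x')" using r2_integrable by simp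
    have qi: "integrable M (\<lambda>x'. (q x x')\<^sup>2)"
      by (rule Bochner_Integration.integrable_bound[OF i]) (use le qm in auto)
    have "(\<integral>x'. (q x x')\<^sup>2 \<partial>M) \<le> (\<integral>x'. r2 x * r2 x' \<partial>M)"
      by (rule integral_mono_AE[OF qi i le])
    then show ?case using qi qm by (simp add: L2_def)
  qed
qed

lemma AE_K_square_le:
  assumes f: "f \<in> L2 M"
  shows "AE x in M. (K f x)\<^sup>2 \<le> (\<integral>x. (f x)\<^sup>2 \<partial>M) * ((\<integral>x. r2 x \<partial>M) * r2 x)"
  using AE_q_L2
proof eventually_elim
  case (elim x)
  have "(K f x)\<^sup>2 \<le> (\<integral>x. (f x)\<^sup>2 \<partial>M) * (\<integral>x'. (q x x')\<^sup>2 \<partial>M)"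
    unfolding K_def using elim by (intro L2_Cauchy_Schwarz f) auto
  also have "\<dots> \<le> (\<integral>x. (f x)\<^sup>2 \<partial>M) * ((\<integral>x. r2 x \<partial>M) * r2 x)"
    using elim by (intro mult_left_mono) (auto simp: mult.commute)
  finally show ?case .
qed

lemma K_L2:
  assumes f: "f \<in> L2 M"
  shows "K f \<in> L2 M"
proof (rule L2_I)
  have [measurable]: "f \<in> borel_measurable M" using f by (rule L2_measurable)
  show "K f \<in> borel_measurable M" by measurable
  show "integrable M (\<lambda>x. (K f x)\<^sup>2)"
  proof (rule Bochner_Integration.integrable_bound)
    show "integrable M (\<lambda>x. (\<integral>x. (f x)\<^sup>2 \<partial>M) * ((\<integral>x. r2 x \<partial>M) * r2 x))"
      using r2_integrable by simp
    show "AE x in M. norm ((K f x)\<^sup>2) \<le> norm ((\<integral>x. (f x)\<^sup>2 \<partial>M) * ((\<integral>x. r2 x \<partial>M) * r2 x))"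
      using AE_K_square_le[OF f] by eventually_elim simp
  qed measurable
qed

lemma triple_integrable:
  assumes f: "f \<in> L2 M" and g: "g \<in> L2 M"
  shows "integrable ((M \<Otimes>\<^sub>M M) \<Otimes>\<^sub>M N) (\<lambda>((x, x'), z). (g x * \<phi> x z) * (f x' * \<phi> x' z))"
proof -
  have [measurable]: "f \<in> borel_measurable M" "g \<in> borel_measurable M"
    using f g by (auto intro: L2_measurable)
  have bound: "\<bar>(g x * \<phi> x z) * (f x' * \<phi> x' z)\<bar> \<le> (f x')\<^sup>2 * (\<phi> x z)\<^sup>2 + (g x)\<^sup>2 * (\<phi> x' z)\<^sup>2" for x x' z
    using abs_mult_le_sum_squares[of "f x' * \<phi> x z" "g x * \<phi> x' z"]
    by (simp add: power_mult_distrib ac_simps)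
  let ?n = "\<lambda>f. \<integral>\<^sup>+x. ennreal ((f x)\<^sup>2) \<partial>M"
  let ?t = "\<integral>\<^sup>+x. \<integral>\<^sup>+z. ennreal ((\<phi> x z)\<^sup>2) \<partial>N \<partial>M"
  have fin: "?n h < \<infinity>" if "h \<in> L2 M" for h
    using that by (subst nn_integral_eq_integral) (auto simp: L2_def)
  show ?thesis
  proof (rule integrableI_bounded)
    have "(\<integral>\<^sup>+w. ennreal (norm ((\<lambda>((x, x'), z). (g x * \<phi> x z) * (f x' * \<phi> x' z)) w)) \<partial>((M \<Otimes>\<^sub>M M) \<Otimes>\<^sub>M N))
      \<le> (\<integral>\<^sup>+w. (case w of ((x, x'), z) \<Rightarrow> ennreal ((f x')\<^sup>2) * ennreal ((\<phi> x z)\<^sup>2)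
           + ennreal ((g x)\<^sup>2) * ennreal ((\<phi> x' z)\<^sup>2)) \<partial>((M \<Otimes>\<^sub>M M) \<Otimes>\<^sub>M N))"
      using bound by (intro nn_integral_mono)
        (auto simp: ennreal_mult[symmetric] ennreal_plus[symmetric] simp del: ennreal_plus)
    also have "\<dots> = (\<integral>\<^sup>+x. \<integral>\<^sup>+x'. \<integral>\<^sup>+z. ennreal ((f x')\<^sup>2) * ennreal ((\<phi> x z)\<^sup>2)
           + ennreal ((g x)\<^sup>2) * ennreal ((\<phi> x' z)\<^sup>2) \<partial>N \<partial>M \<partial>M)"
      by (subst N.nn_integral_fst[symmetric], measurable)
         (subst M.nn_integral_fst[symmetric], auto)
    also have "\<dots> = ?n f * ?t + ?n g * ?t"
    proof -
      define Q where "Q x = (\<integral>\<^sup>+z. ennreal ((\<phi> x z)\<^sup>2) \<partial>N)" for x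
      have [measurable]: "Q \<in> borel_measurable M" unfolding Q_def by measurable
      have "(\<integral>\<^sup>+x. \<integral>\<^sup>+x'. \<integral>\<^sup>+z. ennreal ((f x')\<^sup>2) * ennreal ((\<phi> x z)\<^sup>2)
           + ennreal ((g x)\<^sup>2) * ennreal ((\<phi> x' z)\<^sup>2) \<partial>N \<partial>M \<partial>M)
        = (\<integral>\<^sup>+x. \<integral>\<^sup>+x'. ennreal ((f x')\<^sup>2) * Q x + ennreal ((g x)\<^sup>2) * Q x' \<partial>M \<partial>M)"
        unfolding Q_def
        by (intro nn_integral_cong) (simp add: nn_integral_add nn_integral_cmult)
      also have "\<dots> = (\<integral>\<^sup>+x. ?n f * Q x + ennreal ((g x)\<^sup>2) * (\<integral>\<^sup>+x. Q x \<partial>M) \<partial>M)"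
        by (intro nn_integral_cong) (simp add: nn_integral_add nn_integral_cmult nn_integral_multc)
      also have "\<dots> = ?n f * (\<integral>\<^sup>+x. Q x \<partial>M) + ?n g * (\<integral>\<^sup>+x. Q x \<partial>M)"
        by (simp add: nn_integral_add nn_integral_cmult nn_integral_multc)
      finally show ?thesis unfolding Q_def .
    qed
    also have "\<dots> < \<infinity>"
      using trace_finite fin[OF f] fin[OF g] by (simp add: ennreal_mult_less_top)
    finally show "(\<integral>\<^sup>+w. ennreal (norm ((\<lambda>((x, x'), z). (g x * \<phi> x z) * (f x' * \<phi> x' z)) w)) \<partial>((M \<Otimes>\<^sub>M M) \<Otimes>\<^sub>M N)) < \<infinity>" .
  qed (unfold case_prod_beta', measurable)
qed

lemma K_form:
  assumes f: "f \<in> L2 M" and g: "g \<in> L2 M"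
  shows "integrable N (\<lambda>z. analysis g z * analysis f z)"
    and "(\<integral>x. g x * K f x \<partial>M) = (\<integral>z. analysis g z * analysis f z \<partial>N)"
proof -
  let ?F = "\<lambda>w z. (case w of (x, x') \<Rightarrow> \<lambda>z. (g x * \<phi> x z) * (f x' * \<phi> x' z)) z"
  have F: "integrable ((M \<Otimes>\<^sub>M M) \<Otimes>\<^sub>M N) (case_prod ?F)"
    using triple_integrable[OF f g] by (simp add: case_prod_beta')
  have [measurable]: "f \<in> borel_measurable M" "g \<in> borel_measurable M"
    using f g by (auto intro: L2_measurable)
  have A: "AE z in N. (\<integral>w. ?F w z \<partial>(M \<Otimes>\<^sub>M M)) = analysis g z * analysis f z"
    using MMN.AE_integrable_snd[OF F]
  proof eventually_elim
    case (elim z)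
    have "(\<integral>w. ?F w z \<partial>(M \<Otimes>\<^sub>M M)) = (\<integral>x. \<integral>x'. (g x * \<phi> x z) * (f x' * \<phi> x' z) \<partial>M \<partial>M)"
      using MM.integral_fst'[OF elim] by simp
    then show ?case by (simp add: analysis_def)
  qed
  have Am: "(\<lambda>z. \<integral>w. ?F w z \<partial>(M \<Otimes>\<^sub>M M)) \<in> borel_measurable N"
    using MMN.integrable_snd[OF F] by auto
  show "integrable N (\<lambda>z. analysis g z * analysis f z)"
    using MMN.integrable_snd[OF F] A Am
    by (subst (asm) integrable_cong_AE[where g="\<lambda>z. analysis g z * analysis f z"]) auto
  have "(\<integral>z. analysis g z * analysis f z \<partial>N) = (\<integral>z. \<integral>w. ?F w z \<partial>(M \<Otimes>\<^sub>M M) \<partial>N)"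
    by (rule integral_cong_AE) (use A Am in auto)
  also have "\<dots> = (\<integral>w. \<integral>z. ?F w z \<partial>N \<partial>(M \<Otimes>\<^sub>M M))"
    using MMN.integral_snd[OF F] MMN.integral_fst'[OF F] by simp
  also have "\<dots> = (\<integral>x. \<integral>x'. \<integral>z. ?F (x, x') z \<partial>N \<partial>M \<partial>M)"
    using MMN.integrable_fst'[OF F] by (subst MM.integral_fst') (auto simp: )
  also have "\<dots> = (\<integral>x. g x * K f x \<partial>M)"
  proof (rule Bochner_Integration.integral_cong[OF refl])
    fix x
    have "(\<integral>z. ?F (x, x') z \<partial>N) = g x * (f x' * q x x')" for x'
      unfolding q_def by (simp flip: integral_mult_right_zero) (simp add: ac_simps)
    then show "(\<integral>x'. \<integral>z. ?F (x, x') z \<partial>N \<partial>M) = g x * K f x"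
      by (simp add: K_def)
  qed
  finally show "(\<integral>x. g x * K f x \<partial>M) = (\<integral>z. analysis g z * analysis f z \<partial>N)" ..
qed

lemma K_symmetric:
  assumes "f \<in> L2 M" "g \<in> L2 M"
  shows "(\<integral>x. K f x * g x \<partial>M) = (\<integral>x. f x * K g x \<partial>M)"
  using K_form(2)[OF assms] K_form(2)[OF assms(2,1)] by (simp add: mult.commute)

lemma const_L2: "(\<lambda>_. c) \<in> L2 M"
  by (simp add: L2_def)

lemma AE_K_one: "AE x in M. K (\<lambda>_. 1) x = 1"
proof -
  have "AE x in M. x \<in> space M" by simp
  with markov AE_row_L2 show ?thesis
  proof eventually_elim
    case (elim x)
    have [measurable]: "q x \<in> borel_measurable M" using elim(3) by measurable
    have "(\<integral>\<^sup>+x'. ennreal (q x x') \<partial>M) = (\<integral>\<^sup>+x'. \<integral>\<^sup>+z. ennreal (\<phi> x z * \<phi> x' z) \<partial>N \<partial>M)"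
    proof (rule nn_integral_cong_AE)
      show "AE x' in M. ennreal (q x x') = (\<integral>\<^sup>+z. ennreal (\<phi> x z * \<phi> x' z) \<partial>N)"
        using AE_row_L2
        by eventually_elim
           (auto simp: q_def \<phi>_nonneg intro!: nn_integral_eq_integral[symmetric] L2_mult_integrable elim)
    qed
    then have "(\<integral>\<^sup>+x'. ennreal (q x x') \<partial>M) = 1" using elim by simp
    moreover have "0 \<le> q x x'" for x' unfolding q_def by (simp add: \<phi>_nonneg)
    ultimately have "(\<integral>x'. q x x' \<partial>M) = 1"
      by (subst integral_eq_nn_integral) auto
    then show ?case by (simp add: K_def)
  qed
qed

lemma K_mean:
  assumes f: "f \<in> L2 M"
  shows "(\<integral>x. K f x \<partial>M) = (\<integral>x. f x \<partial>M)"
proof -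
  have [measurable]: "f \<in> borel_measurable M" using f by (rule L2_measurable)
  have "(\<integral>x. K f x \<partial>M) = (\<integral>x. f x * K (\<lambda>_. 1) x \<partial>M)"
    using K_symmetric[OF f const_L2[of 1]] by simp
  also have "\<dots> = (\<integral>x. f x \<partial>M)"
  proof (rule integral_cong_AE)
    show "AE x in M. f x * K (\<lambda>_. 1) x = f x"
      using AE_K_one by eventually_elim simp
  qed measurable
  finally show ?thesis .
qed

lemma L2_integrable: "f \<in> L2 M \<Longrightarrow> integrable M f"
  using L2_mult_integrable[OF const_L2[of 1], of f] by simp

lemma L20_iff: "f \<in> L20 M \<longleftrightarrow> f \<in> L2 M \<and> (\<integral>x. f x \<partial>M) = 0"
  using L2_integrable[of f] unfolding L20_def L2_def has_bochner_integral_iff by blast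

lemma K_L20:
  assumes f: "f \<in> L20 M"
  shows "K f \<in> L20 M"
  using f K_L2 K_mean by (auto simp: L20_iff)

lemma T_eq_K:
  assumes "f \<in> L20 M" "x \<in> space M"
  shows "T f x = K f x"
  unfolding K_def q_def by (rule T_eq[OF assms])

lemma L20_cong:
  assumes "\<And>x. x \<in> space M \<Longrightarrow> f x = g x"
  shows "f \<in> L20 M \<longleftrightarrow> g \<in> L20 M"
proof -
  have "f \<in> borel_measurable M \<longleftrightarrow> g \<in> borel_measurable M"
    by (rule measurable_cong) (rule assms)
  moreover have "integrable M (\<lambda>x. (f x)\<^sup>2) \<longleftrightarrow> integrable M (\<lambda>x. (g x)\<^sup>2)"
    by (rule Bochner_Integration.integrable_cong) (auto simp: assms)
  moreover have "(\<integral>x. f x \<partial>M) = (\<integral>x. g x \<partial>M)"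
    by (rule Bochner_Integration.integral_cong) (auto simp: assms)
  ultimately show ?thesis by (simp add: L20_iff L2_def)
qed

lemma T_L20: "f \<in> L20 M \<Longrightarrow> T f \<in> L20 M"
  using L20_cong[of "T f" "K f"] T_eq_K K_L20 by blast

lemma inner_T:
  assumes f: "f \<in> L20 M"
  shows "L2_inner M g (T f) = (\<integral>x. g x * K f x \<partial>M)"
  unfolding L2_inner_def by (rule Bochner_Integration.integral_cong) (auto simp: T_eq_K f)

lemma inner_commute: "L2_inner M f g = L2_inner M g f"
  by (simp add: L2_inner_def mult.commute)

theorem pos_selfadjoint: "pos_selfadjoint_on_L20 M T"
  unfolding pos_selfadjoint_on_L20_def
proof (intro conjI ballI)
  fix f g assume f: "f \<in> L20 M" and g: "g \<in> L20 M"
  then have L: "f \<in> L2 M" "g \<in> L2 M" by (auto simp: L20_iff)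
  show "L2_inner M (T f) g = L2_inner M f (T g)"
    using K_symmetric[OF L] by (simp add: inner_commute[of "T f"] inner_T f g mult.commute)
next
  fix f assume f: "f \<in> L20 M"
  then have L: "f \<in> L2 M" by (auto simp: L20_iff)
  show "0 \<le> L2_inner M (T f) f"
    unfolding inner_commute[of "T f"] inner_T[OF f] K_form(2)[OF L L] by simp
qed (rule T_L20)

theorem compact: "compact_on_L20 M T"
  unfolding compact_on_L20_def
proof (intro allI impI)
  fix f :: "nat \<Rightarrow> 'a \<Rightarrow> real"
  assume "(\<forall>k. f k \<in> L20 M) \<and> (\<exists>C. \<forall>k. L2_norm M (f k) \<le> C)"
  then obtain C where f: "\<And>k. f k \<in> L20 M" and C: "\<And>k. L2_norm M (f k) \<le> C" by blast
  have fL: "f k \<in> L2 M" for k using f by (simp add: L20_iff)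
  have bd: "(\<integral>x. (f k x)\<^sup>2 \<partial>M) \<le> C\<^sup>2" for k
    using sqrt_le_D[OF C[of k, unfolded L2_norm_def L2_inner_def]] by (simp add: power2_eq_square)
  obtain r :: "nat \<Rightarrow> nat" where r: "strict_mono r"
    and cv: "\<And>g. g \<in> L2 M \<Longrightarrow> convergent (\<lambda>k. \<integral>x. g x * f (r k) x \<partial>M)"
    by (rule L2_weak_subsequence[OF M.finite_measure_axioms sets_M fL bd], rule that)
  define F where "F x = lim (\<lambda>k. K (f (r k)) x)" for x
  have [measurable]: "f k \<in> borel_measurable M" for k using fL by (rule L2_measurable)
  have [measurable]: "F \<in> borel_measurable M"
    unfolding F_def by (rule borel_measurable_lim_metric) measurable
  let ?b = "\<lambda>x. C\<^sup>2 * ((\<integral>x. r2 x \<partial>M) * r2 x)"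
  have lim: "AE x in M. (\<lambda>k. K (f (r k)) x) \<longlonglongrightarrow> F x"
    using AE_q_L2
  proof eventually_elim
    case (elim x)
    then have "convergent (\<lambda>k. K (f (r k)) x)"
      using cv[of "q x"] by (simp add: K_def mult.commute)
    then show ?case unfolding F_def by (simp add: convergent_LIMSEQ_iff)
  qed
  have r2i: "0 \<le> (\<integral>x. r2 x \<partial>M)" by (simp add: r2_nonneg)
  have Kle: "AE x in M. \<forall>k. (K (f (r k)) x)\<^sup>2 \<le> ?b x"
    unfolding AE_all_countable
  proof
    fix k
    show "AE x in M. (K (f (r k)) x)\<^sup>2 \<le> ?b x"
      using AE_K_square_le[OF fL, of "r k"]
    proof eventually_elim
      case (elim x)
      also have "(\<integral>x. (f (r k) x)\<^sup>2 \<partial>M) * ((\<integral>x. r2 x \<partial>M) * r2 x) \<le> ?b x"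
        by (intro mult_right_mono bd mult_nonneg_nonneg r2i r2_nonneg)
      finally show ?case .
    qed
  qed
  have Fle: "AE x in M. (F x)\<^sup>2 \<le> ?b x"
    using lim Kle
  proof eventually_elim
    case (elim x)
    then show ?case by (intro LIMSEQ_le_const2[OF tendsto_power]) auto
  qed
  have bi: "integrable M ?b" using r2_integrable by simp
  have FL: "F \<in> L2 M"
    by (rule L2_I, measurable, rule Bochner_Integration.integrable_bound[OF bi]) (use Fle in auto)
  have "(\<lambda>k. \<integral>x. K (f (r k)) x \<partial>M) \<longlonglongrightarrow> (\<integral>x. F x \<partial>M)"
  proof (rule integral_dominated_convergence[where w="\<lambda>x. 1 + ?b x"])
    show "integrable M (\<lambda>x. 1 + ?b x)" using bi by simp
    show "AE x in M. norm (K (f (r k)) x) \<le> 1 + ?b x" for k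
      using Kle
    proof eventually_elim
      case (elim x)
      have "\<bar>K (f (r k)) x * 1\<bar> \<le> (K (f (r k)) x)\<^sup>2 + 1\<^sup>2"
        by (rule abs_mult_le_sum_squares)
      then show ?case using elim by (auto intro: order_trans)
    qed
  qed (use lim in measurable)
  moreover have "(\<integral>x. K (f (r k)) x \<partial>M) = 0" for k
    using K_mean[OF fL] f by (simp add: L20_iff)
  ultimately have "(\<integral>x. F x \<partial>M) = 0" by (simp add: LIMSEQ_const_iff)
  with FL have F20: "F \<in> L20 M" by (simp add: L20_iff)
  have "(\<lambda>k. \<integral>x. (K (f (r k)) x - F x)\<^sup>2 \<partial>M) \<longlonglongrightarrow> (\<integral>x. 0 \<partial>M)"
  proof (rule integral_dominated_convergence[where w="\<lambda>x. 4 * ?b x"])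
    show "AE x in M. (\<lambda>k. (K (f (r k)) x - F x)\<^sup>2) \<longlonglongrightarrow> 0"
      using lim
    proof eventually_elim
      case (elim x)
      have "(\<lambda>k. (K (f (r k)) x - F x)\<^sup>2) \<longlonglongrightarrow> (F x - F x)\<^sup>2"
        by (intro tendsto_intros elim)
      then show ?case by simp
    qed
    show "AE x in M. norm ((K (f (r k)) x - F x)\<^sup>2) \<le> 4 * ?b x" for k
      using Kle Fle
    proof eventually_elim
      case (elim x)
      have "(K (f (r k)) x - F x)\<^sup>2 \<le> 2 * (K (f (r k)) x)\<^sup>2 + 2 * (F x)\<^sup>2"
        using zero_le_power2[of "K (f (r k)) x + F x"] by (simp add: power2_sum power2_diff)
      then show ?case using elim(1)[rule_format, of k] elim(2) by simp
    qed
  qed (use bi in \<open>auto\<close>)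
  then have "(\<lambda>k. sqrt (\<integral>x. (K (f (r k)) x - F x)\<^sup>2 \<partial>M)) \<longlonglongrightarrow> sqrt 0"
    by (intro tendsto_real_sqrt) simp
  moreover have "L2_norm M (\<lambda>x. T (f (r k)) x - F x) = sqrt (\<integral>x. (K (f (r k)) x - F x)\<^sup>2 \<partial>M)" for k
    unfolding L2_norm_def L2_inner_def
    by (intro arg_cong[of _ _ sqrt] Bochner_Integration.integral_cong)
       (auto simp: T_eq_K f power2_eq_square)
  ultimately show "\<exists>g\<in>L20 M. \<exists>r. strict_mono r \<and> (\<lambda>k. L2_norm M (\<lambda>x. T (f (r k)) x - g x)) \<longlonglongrightarrow> 0"
    using r by (intro bexI[OF _ F20] exI[of _ r]) simp
qed

lemma analysis_Bessel:
  assumes I: "finite I" and e: "\<And>i. i \<in> I \<Longrightarrow> e i \<in> L2 M"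
    and orth: "\<And>i j. i \<in> I \<Longrightarrow> j \<in> I \<Longrightarrow> (\<integral>x. e i x * e j x \<partial>M) = of_bool (i = j)"
  shows "(\<Sum>i\<in>I. \<integral>x. e i x * K (e i) x \<partial>M) \<le> (\<integral>x. r2 x \<partial>M)"
proof -
  have "(\<Sum>i\<in>I. \<integral>x. e i x * K (e i) x \<partial>M) = (\<Sum>i\<in>I. \<integral>z. (analysis (e i) z)\<^sup>2 \<partial>N)"
    using e by (intro sum.cong) (auto simp: K_form(2) power2_eq_square)
  also have "\<dots> = (\<integral>z. (\<Sum>i\<in>I. (analysis (e i) z)\<^sup>2) \<partial>N)"
    using e K_form(1) by (subst Bochner_Integration.integral_sum) (auto simp: power2_eq_square)
  also have "\<dots> \<le> (\<integral>z. \<integral>x. (\<phi> x z)\<^sup>2 \<partial>M \<partial>N)"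
  proof (rule integral_mono_AE)
    show "integrable N (\<lambda>z. \<Sum>i\<in>I. (analysis (e i) z)\<^sup>2)"
      using e K_form(1) by (auto simp: power2_eq_square)
    show "integrable N (\<lambda>z. \<integral>x. (\<phi> x z)\<^sup>2 \<partial>M)" by (rule column_norm_integrable)
    show "AE z in N. (\<Sum>i\<in>I. (analysis (e i) z)\<^sup>2) \<le> (\<integral>x. (\<phi> x z)\<^sup>2 \<partial>M)"
      using AE_column_L2
    proof eventually_elim
      case (elim z)
      define a where "a i = analysis (e i) z" for i
      define s where "s x = (\<Sum>i\<in>I. a i * e i x)" for x
      have sL: "s \<in> L2 M" unfolding s_def by (intro L2_sum L2_cmult e)
      have us: "(\<integral>x. \<phi> x z * s x \<partial>M) = (\<Sum>i\<in>I. (a i)\<^sup>2)"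
      proof -
        have "(\<integral>x. \<phi> x z * s x \<partial>M) = (\<integral>x. (\<Sum>i\<in>I. a i * (e i x * \<phi> x z)) \<partial>M)"
          unfolding s_def by (simp add: sum_distrib_left ac_simps)
        also have "\<dots> = (\<Sum>i\<in>I. \<integral>x. a i * (e i x * \<phi> x z) \<partial>M)"
          by (rule Bochner_Integration.integral_sum)
             (intro integrable_mult_right L2_mult_integrable e elim)
        finally show ?thesis by (simp add: a_def analysis_def power2_eq_square)
      qed
      have es: "(\<integral>x. e i x * s x \<partial>M) = a i" if i: "i \<in> I" for i
      proof -
        have "(\<integral>x. e i x * s x \<partial>M) = (\<integral>x. (\<Sum>j\<in>I. a j * (e i x * e j x)) \<partial>M)"
          unfolding s_def by (simp add: sum_distrib_left ac_simps)
        also have "\<dots> = (\<Sum>j\<in>I. \<integral>x. a j * (e i x * e j x) \<partial>M)"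
          by (rule Bochner_Integration.integral_sum)
             (intro integrable_mult_right L2_mult_integrable e i)
        also have "\<dots> = (\<Sum>j\<in>I. a j * of_bool (i = j))" using orth i by simp
        also have "\<dots> = a i" using I i by (simp add: if_distrib sum.delta)
        finally show ?thesis .
      qed
      have ss: "(\<integral>x. s x * s x \<partial>M) = (\<Sum>i\<in>I. (a i)\<^sup>2)"
      proof -
        have "s x * t = (\<Sum>i\<in>I. a i * (e i x * t))" for x t
          by (simp add: s_def sum_distrib_right mult.assoc)
        then have "(\<integral>x. s x * s x \<partial>M) = (\<integral>x. (\<Sum>i\<in>I. a i * (e i x * s x)) \<partial>M)"
          by (intro Bochner_Integration.integral_cong) auto
        also have "\<dots> = (\<Sum>i\<in>I. \<integral>x. a i * (e i x * s x) \<partial>M)"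
          by (rule Bochner_Integration.integral_sum)
             (intro integrable_mult_right L2_mult_integrable e sL)
        finally show ?thesis using es by (simp add: power2_eq_square)
      qed
      have "0 \<le> (\<integral>x. (\<phi> x z - s x)\<^sup>2 \<partial>M)" by simp
      also have "\<dots> = (\<integral>x. (\<phi> x z)\<^sup>2 + s x * s x - 2 * (\<phi> x z * s x) \<partial>M)"
        by (rule Bochner_Integration.integral_cong) (auto simp: power2_eq_square algebra_simps)
      also have "\<dots> = (\<integral>x. (\<phi> x z)\<^sup>2 \<partial>M) - (\<Sum>i\<in>I. (a i)\<^sup>2)"
        using L2_mult_integrable[OF elim sL] L2_mult_integrable[OF sL sL] L2_square_integrable[OF elim]
        by (simp add: us ss)
      finally show ?case by (simp add: a_def)
    qed
  qed
  also have "\<dots> = (\<integral>x. r2 x \<partial>M)"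
    using MN.integral_snd[OF square_integrable_pair] MN.integral_fst'[OF square_integrable_pair]
    by (simp add: r2_def)
  finally show ?thesis .
qed

end

section \<open>Eigenvalue sums\<close>

lemma L2_orthonormalization:
  fixes e :: "nat \<Rightarrow> 'a \<Rightarrow> real"
  assumes e: "\<And>i. i < k \<Longrightarrow> e i \<in> L2 M"
    and ind: "\<And>c :: nat \<Rightarrow> real. (AE x in M. (\<Sum>i<k. c i * e i x) = 0) \<Longrightarrow> \<forall>i<k. c i = 0"
  shows "\<exists>b :: nat \<Rightarrow> nat \<Rightarrow> real. \<forall>i<k. \<forall>j<k.
    (\<integral>x. (\<Sum>m<k. b i m * e m x) * (\<Sum>m<k. b j m * e m x) \<partial>M) = of_bool (i = j)"
  using assms
proof (induction k)
  case (Suc k)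
  have ind': "\<forall>i<k. c i = 0" if "AE x in M. (\<Sum>i<k. c i * e i x) = 0" for c :: "nat \<Rightarrow> real"
  proof -
    have "AE x in M. (\<Sum>i<Suc k. (if i < k then c i else 0) * e i x) = 0"
      using that by simp
    from Suc.prems(2)[OF this] show ?thesis by (metis less_Suc_eq)
  qed
  obtain b :: "nat \<Rightarrow> nat \<Rightarrow> real" where b: "\<And>i j. i < k \<Longrightarrow> j < k \<Longrightarrow>
      (\<integral>x. (\<Sum>m<k. b i m * e m x) * (\<Sum>m<k. b j m * e m x) \<partial>M) = of_bool (i = j)"
    using Suc.IH[OF Suc.prems(1) ind'] by auto
  define f where "f i x = (\<Sum>m<k. b i m * e m x)" for i x
  have fL: "f i \<in> L2 M" for i unfolding f_def using Suc.prems(1) by (intro L2_sum L2_cmult) auto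
  have eL: "e k \<in> L2 M" using Suc.prems(1) by simp
  have ff: "(\<integral>x. f i x * f j x \<partial>M) = of_bool (i = j)" if "i < k" "j < k" for i j
    unfolding f_def by (rule b[OF that])
  define a where "a i = (\<integral>x. e k x * f i x \<partial>M)" for i
  define g where "g x = e k x - (\<Sum>i<k. a i * f i x)" for x
  have gL: "g \<in> L2 M" unfolding g_def by (intro L2_diff L2_sum L2_cmult fL eL)
  define d where "d m = (if m < k then - (\<Sum>i<k. a i * b i m) else 1)" for m
  have gd: "g x = (\<Sum>m<Suc k. d m * e m x)" for x
  proof -
    have "(\<Sum>i<k. a i * f i x) = (\<Sum>m<k. (\<Sum>i<k. a i * b i m) * e m x)"
      unfolding f_def sum_distrib_left sum_distrib_right by (subst sum.swap) (simp add: ac_simps)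
    then show ?thesis by (simp add: g_def d_def sum_negf)
  qed
  have gf: "(\<integral>x. g x * f j x \<partial>M) = 0" if j: "j < k" for j
  proof -
    have "(\<integral>x. g x * f j x \<partial>M) = (\<integral>x. e k x * f j x - (\<Sum>i<k. a i * (f i x * f j x)) \<partial>M)"
      by (simp add: g_def left_diff_distrib sum_distrib_right mult.assoc)
    also have "\<dots> = a j - (\<integral>x. (\<Sum>i<k. a i * (f i x * f j x)) \<partial>M)"
      unfolding a_def
      by (intro Bochner_Integration.integral_diff Bochner_Integration.integrable_sum
          integrable_mult_right L2_mult_integrable fL eL)
    also have "(\<integral>x. (\<Sum>i<k. a i * (f i x * f j x)) \<partial>M) = (\<Sum>i<k. \<integral>x. a i * (f i x * f j x) \<partial>M)"
      by (intro Bochner_Integration.integral_sum integrable_mult_right L2_mult_integrable fL)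
    also have "\<dots> = (\<Sum>i<k. a i * of_bool (i = j))" using ff j by simp
    also have "\<dots> = a j" using j by (simp add: if_distrib sum.delta)
    finally show ?thesis by simp
  qed
  define n where "n = (\<integral>x. g x * g x \<partial>M)"
  have n: "0 < n"
  proof -
    have "n \<noteq> 0"
    proof
      assume "n = 0"
      then have "AE x in M. g x * g x = 0"
        unfolding n_def using L2_mult_integrable[OF gL gL]
        by (subst (asm) integral_nonneg_eq_0_iff_AE) auto
      then have "AE x in M. (\<Sum>m<Suc k. d m * e m x) = 0" by (simp add: gd)
      from Suc.prems(2)[OF this] have "d k = 0" by blast
      then show False by (simp add: d_def)
    qed
    moreover have "0 \<le> n" unfolding n_def by simp
    ultimately show ?thesis by simp
  qed
  define b' where "b' i m = (if i < k then (if m < k then b i m else 0) else d m / sqrt n)" for i m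
  have b'f: "(\<Sum>m<Suc k. b' i m * e m x) = f i x" if "i < k" for i x
    using that by (simp add: b'_def f_def)
  have b'g: "(\<Sum>m<Suc k. b' k m * e m x) = g x / sqrt n" for x
    unfolding gd sum_divide_distrib by (rule sum.cong) (auto simp: b'_def)
  show ?case
  proof (intro exI[of _ b'] allI impI)
    fix i j assume "i < Suc k" "j < Suc k"
    then consider "i < k" "j < k" | "i < k" "j = k" | "i = k" "j < k" | "i = k" "j = k" by linarith
    then show "(\<integral>x. (\<Sum>m<Suc k. b' i m * e m x) * (\<Sum>m<Suc k. b' j m * e m x) \<partial>M) = of_bool (i = j)"
    proof cases
      case 1 then show ?thesis by (simp only: b'f ff)
    next
      case 2 then show ?thesis using gf[of i] by (simp only: b'f b'g) (simp add: mult.commute)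
    next
      case 3 then show ?thesis using gf[of j] by (simp only: b'f b'g) simp
    next
      case 4
      have "(\<integral>x. (g x / sqrt n) * (g x / sqrt n) \<partial>M) = n / (sqrt n * sqrt n)"
        unfolding n_def by simp
      then show ?thesis using 4 n by (simp only: b'g) simp
    qed
  qed
qed simp

context mixture_operator
begin

lemma AE_K_sum:
  assumes "\<And>i. i \<in> I \<Longrightarrow> e i \<in> L2 M"
  shows "AE x in M. K (\<lambda>x. \<Sum>i\<in>I. c i * e i x) x = (\<Sum>i\<in>I. c i * K (e i) x)"
  using AE_q_L2
proof eventually_elim
  case (elim x)
  have "K (\<lambda>x. \<Sum>i\<in>I. c i * e i x) x = (\<integral>x'. (\<Sum>i\<in>I. c i * (e i x' * q x x')) \<partial>M)"
    unfolding K_def by (simp add: sum_distrib_right mult.assoc)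
  also have "\<dots> = (\<Sum>i\<in>I. \<integral>x'. c i * (e i x' * q x x') \<partial>M)"
    using elim assms
    by (intro Bochner_Integration.integral_sum integrable_mult_right L2_mult_integrable) auto
  finally show ?case by (simp add: K_def)
qed

lemma eigenspace_iff:
  "f \<in> eigenspace M T l \<longleftrightarrow> f \<in> L20 M \<and> (AE x in M. K f x = l * f x)"
proof (cases "f \<in> L20 M")
  case True
  have "(AE x in M. T f x = l * f x) \<longleftrightarrow> (AE x in M. K f x = l * f x)"
    by (rule AE_cong) (simp add: T_eq_K[OF True])
  then show ?thesis by (simp add: eigenspace_def)
qed (simp add: eigenspace_def)

lemma L20_sum:
  assumes "\<And>i. i \<in> I \<Longrightarrow> e i \<in> L20 M"
  shows "(\<lambda>x. \<Sum>i\<in>I. c i * e i x) \<in> L20 M"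
proof -
  have e: "e i \<in> L2 M" "(\<integral>x. e i x \<partial>M) = 0" if "i \<in> I" for i
    using assms[OF that] by (auto simp: L20_iff)
  have "(\<integral>x. (\<Sum>i\<in>I. c i * e i x) \<partial>M) = (\<Sum>i\<in>I. \<integral>x. c i * e i x \<partial>M)"
    by (intro Bochner_Integration.integral_sum integrable_mult_right L2_integrable e)
  also have "\<dots> = 0" by (simp add: e)
  finally show ?thesis unfolding L20_iff using e by (auto intro!: L2_sum L2_cmult)
qed

lemma eigenspace_sum:
  assumes I: "finite I" and e: "\<And>i. i \<in> I \<Longrightarrow> e i \<in> eigenspace M T l"
  shows "(\<lambda>x. \<Sum>i\<in>I. c i * e i x) \<in> eigenspace M T l"
proof -
  have L: "e i \<in> L20 M" "e i \<in> L2 M" if "i \<in> I" for i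
    using e[OF that] by (auto simp: eigenspace_iff L20_iff)
  have "AE x in M. K (\<lambda>x. \<Sum>i\<in>I. c i * e i x) x = (\<Sum>i\<in>I. c i * K (e i) x)"
    by (rule AE_K_sum) (rule L(2))
  moreover have "AE x in M. \<forall>i\<in>I. K (e i) x = l * e i x"
    using I e by (intro AE_finite_allI) (auto simp: eigenspace_iff)
  ultimately
  have "AE x in M. K (\<lambda>x. \<Sum>i\<in>I. c i * e i x) x = l * (\<Sum>i\<in>I. c i * e i x)"
  proof eventually_elim
    case (elim x)
    have "K (\<lambda>x. \<Sum>i\<in>I. c i * e i x) x = (\<Sum>i\<in>I. c i * (l * e i x))"
      using elim by simp
    then show ?case by (simp add: sum_distrib_left ac_simps)
  qed
  then show ?thesis using L20_sum[of I e c] L by (simp add: eigenspace_iff)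
qed

lemma inner_eigenspace:
  assumes f: "f \<in> eigenspace M T l" and g: "g \<in> eigenspace M T m"
  shows "(\<integral>x. f x * K g x \<partial>M) = m * (\<integral>x. f x * g x \<partial>M)"
proof -
  have [measurable]: "f \<in> borel_measurable M" "g \<in> borel_measurable M"
    using f g by (auto simp: eigenspace_def L20_def)
  have "(\<integral>x. f x * K g x \<partial>M) = (\<integral>x. m * (f x * g x) \<partial>M)"
    using g by (intro integral_cong_AE) (auto simp: eigenspace_iff)
  then show ?thesis by simp
qed

lemma eigenspaces_orthogonal:
  assumes f: "f \<in> eigenspace M T l" and g: "g \<in> eigenspace M T m" and "l \<noteq> m"
  shows "(\<integral>x. f x * g x \<partial>M) = 0"
proof -
  have "f \<in> L2 M" "g \<in> L2 M" using f g by (auto simp: eigenspace_iff L20_iff)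
  then have "(\<integral>x. g x * K f x \<partial>M) = (\<integral>x. f x * K g x \<partial>M)"
    using K_symmetric[of f g] by (simp add: mult.commute)
  then have "l * (\<integral>x. f x * g x \<partial>M) = m * (\<integral>x. f x * g x \<partial>M)"
    unfolding inner_eigenspace[OF f g] inner_eigenspace[OF g f] by (simp add: mult.commute)
  then show ?thesis using \<open>l \<noteq> m\<close> by simp
qed

definition independent_number :: "real \<Rightarrow> nat \<Rightarrow> bool" where
  "independent_number l k \<longleftrightarrow> (\<exists>e :: nat \<Rightarrow> 'a \<Rightarrow> real.
        (\<forall>i<k. e i \<in> eigenspace M T l) \<and>
        (\<forall>c :: nat \<Rightarrow> real. (AE x in M. (\<Sum>i<k. c i * e i x) = 0) \<longrightarrow> (\<forall>i<k. c i = 0)))"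

lemma eigenspace_orthonormal_family:
  assumes "independent_number l k"
  shows "\<exists>e :: nat \<Rightarrow> 'a \<Rightarrow> real. (\<forall>i<k. e i \<in> eigenspace M T l) \<and>
    (\<forall>i<k. \<forall>j<k. (\<integral>x. e i x * e j x \<partial>M) = of_bool (i = j))"
proof -
  obtain e :: "nat \<Rightarrow> 'a \<Rightarrow> real" where e: "\<And>i. i < k \<Longrightarrow> e i \<in> eigenspace M T l"
    and ind: "\<And>c :: nat \<Rightarrow> real. (AE x in M. (\<Sum>i<k. c i * e i x) = 0) \<Longrightarrow> \<forall>i<k. c i = 0"
    using assms unfolding independent_number_def by blast
  have "e i \<in> L2 M" if "i < k" for i using e[OF that] by (simp add: eigenspace_iff L20_iff)
  from L2_orthonormalization[of k e M, OF this ind]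
  obtain b :: "nat \<Rightarrow> nat \<Rightarrow> real" where b: "\<And>i j. i < k \<Longrightarrow> j < k \<Longrightarrow>
    (\<integral>x. (\<Sum>m<k. b i m * e m x) * (\<Sum>m<k. b j m * e m x) \<partial>M) = of_bool (i = j)"
    by blast
  show ?thesis
    by (rule exI[of _ "\<lambda>i x. \<Sum>m<k. b i m * e m x"]) (intro conjI allI impI eigenspace_sum e b; simp)
qed

lemma independent_sum_le_trace:
  assumes F: "finite F" and k: "\<And>l. l \<in> F \<Longrightarrow> independent_number l (k l)"
  shows "(\<Sum>l\<in>F. real (k l) * l) \<le> (\<integral>x. r2 x \<partial>M)"
proof -
  have "\<forall>l\<in>F. \<exists>e :: nat \<Rightarrow> 'a \<Rightarrow> real. (\<forall>i<k l. e i \<in> eigenspace M T l) \<and>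
    (\<forall>i<k l. \<forall>j<k l. (\<integral>x. e i x * e j x \<partial>M) = of_bool (i = j))"
    using eigenspace_orthonormal_family k by blast
  then obtain e :: "real \<Rightarrow> nat \<Rightarrow> 'a \<Rightarrow> real" where
    e: "\<And>l i. l \<in> F \<Longrightarrow> i < k l \<Longrightarrow> e l i \<in> eigenspace M T l"
    and on: "\<And>l i j. l \<in> F \<Longrightarrow> i < k l \<Longrightarrow> j < k l \<Longrightarrow> (\<integral>x. e l i x * e l j x \<partial>M) = of_bool (i = j)"
    by metis
  let ?I = "SIGMA l:F. {..<k l}"
  have "(\<Sum>l\<in>F. real (k l) * l) = (\<Sum>l\<in>F. \<Sum>i<k l. \<integral>x. e l i x * K (e l i) x \<partial>M)"
    by (rule sum.cong) (auto simp: inner_eigenspace[OF e e] on)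
  also have "\<dots> = (\<Sum>p\<in>?I. \<integral>x. e (fst p) (snd p) x * K (e (fst p) (snd p)) x \<partial>M)"
    using F by (subst sum.Sigma) (auto simp: case_prod_beta)
  also have "\<dots> \<le> (\<integral>x. r2 x \<partial>M)"
  proof (rule analysis_Bessel)
    fix p p' assume p: "p \<in> ?I" "p' \<in> ?I"
    show "(\<integral>x. e (fst p) (snd p) x * e (fst p') (snd p') x \<partial>M) = of_bool (p = p')"
    proof (cases "fst p = fst p'")
      case True
      then show ?thesis using p on[of "fst p" "snd p" "snd p'"] by (auto simp: prod_eq_iff)
    next
      case False
      then show ?thesis using p by (auto simp: prod_eq_iff intro!: eigenspaces_orthogonal[OF e e])
    qed
  qed (use F e in \<open>auto simp: eigenspace_iff L20_iff\<close>)
  finally show ?thesis .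
qed

lemma multiplicity_attained:
  assumes "0 < l"
  shows "\<exists>k. independent_number l k \<and> multiplicity_on_L20 M T l = enat k"
proof -
  let ?D = "{enat k | k. independent_number l k}"
  have mult: "multiplicity_on_L20 M T l = Sup ?D"
    unfolding multiplicity_on_L20_def independent_number_def ..
  have "independent_number l 0" unfolding independent_number_def by simp
  then have ne: "?D \<noteq> {}" by blast
  have "?D \<subseteq> enat ` {.. nat \<lfloor>(\<integral>x. r2 x \<partial>M) / l\<rfloor>}"
  proof clarify
    fix k assume "independent_number l k"
    then have "real k * l \<le> (\<integral>x. r2 x \<partial>M)"
      using independent_sum_le_trace[of "{l}" "\<lambda>_. k"] by simp
    then have "real k \<le> (\<integral>x. r2 x \<partial>M) / l" using assms by (simp add: field_simps)
    then have "k \<le> nat \<lfloor>(\<integral>x. r2 x \<partial>M) / l\<rfloor>" by linarith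
    then show "enat k \<in> enat ` {.. nat \<lfloor>(\<integral>x. r2 x \<partial>M) / l\<rfloor>}" by simp
  qed
  then have fin: "finite ?D" by (rule finite_subset) simp
  have "Sup ?D = Max ?D" by (simp only: Sup_enat_def ne fin if_True if_False)
  then show ?thesis using Max_in[OF fin ne] mult by auto
qed

lemma eigenvalue_sum_finite:
  "(\<Sum>\<^sub>\<infinity>l\<in>eigenvalues M T. ennreal_of_enat (multiplicity_on_L20 M T l) * ennreal l) < \<infinity>"
proof -
  let ?m = "\<lambda>l. ennreal_of_enat (multiplicity_on_L20 M T l) * ennreal l"
  have "sum ?m F \<le> ennreal (\<integral>x. r2 x \<partial>M)" if F: "finite F" for F
  proof -
    let ?P = "{l \<in> F. 0 < l}"
    obtain k where k: "\<And>l. 0 < l \<Longrightarrow> independent_number l (k l)"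
      "\<And>l. 0 < l \<Longrightarrow> multiplicity_on_L20 M T l = enat (k l)"
      using multiplicity_attained by metis
    have "?m l = 0" if "l \<in> F - ?P" for l
      using that by (auto simp: ennreal_neg)
    then have "sum ?m F = sum ?m ?P"
      using F by (intro sum.mono_neutral_right) auto
    also have "\<dots> = (\<Sum>l\<in>?P. ennreal (real (k l) * l))"
      by (rule sum.cong) (auto simp: k ennreal_mult ennreal_of_nat_eq_real_of_nat)
    also have "\<dots> = ennreal (\<Sum>l\<in>?P. real (k l) * l)"
      by (rule sum_ennreal) auto
    also have "\<dots> \<le> ennreal (\<integral>x. r2 x \<partial>M)"
      using F k by (intro ennreal_leI independent_sum_le_trace) auto
    finally show ?thesis .
  qed
  then have "(\<Sum>\<^sub>\<infinity>l\<in>eigenvalues M T. ?m l) \<le> ennreal (\<integral>x. r2 x \<partial>M)"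
    by (subst nonneg_infsum_complete) (auto intro: SUP_least)
  then show ?thesis by (auto intro: le_less_trans)
qed

theorem trace_class: "trace_class_on_L20 M T"
  unfolding trace_class_on_L20_def
  using pos_selfadjoint compact eigenvalue_sum_finite by blast

end

lemma trace_class_on_L20_null:
  assumes null: "emeasure M (space M) = 0"
    and T: "\<And>f. f \<in> L20 M \<Longrightarrow> T f \<in> borel_measurable M"
  shows "trace_class_on_L20 M T"
proof -
  have AE: "AE x in M. P x" for P
    by (rule AE_I[where N="space M"]) (use null in auto)
  have int: "(\<integral>x. f x \<partial>M) = 0" for f :: "_ \<Rightarrow> real"
    by (rule integral_eq_zero_AE) (rule AE)
  have L: "f \<in> L20 M" if "f \<in> borel_measurable M" for f
  proof -
    have "integrable M g" if "g \<in> borel_measurable M" for g :: "_ \<Rightarrow> real"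
      by (subst integrable_cong_AE[where g="\<lambda>_. 0"]) (use that AE in auto)
    from this[OF that] this[OF borel_measurable_power[OF that, of 2]] show ?thesis
      unfolding L20_def has_bochner_integral_iff int using that by blast
  qed
  have eig: "eigenvalues M T = {}" by (auto simp: eigenvalues_def AE)
  have "compact_on_L20 M T"
    unfolding compact_on_L20_def
  proof (intro allI impI)
    show "\<exists>g\<in>L20 M. \<exists>r. strict_mono r \<and> (\<lambda>k. L2_norm M (\<lambda>x. T (f (r k)) x - g x)) \<longlonglongrightarrow> 0"
      for f :: "nat \<Rightarrow> _"
      by (rule bexI[of _ "\<lambda>_. 0"], rule exI[of _ id])
         (auto simp: L2_norm_def L2_inner_def int strict_mono_def intro: L)
  qed
  then show ?thesis
    unfolding trace_class_on_L20_def pos_selfadjoint_on_L20_def eig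
    using T L by (auto simp: L2_inner_def int)
qed

section \<open>The mixing density near the origin\<close>

definition cumulative :: "(real \<Rightarrow> real) \<Rightarrow> real \<Rightarrow> real" where
  "cumulative \<psi> t = (LBINT v:{0<..t}. \<psi> v)"

lemma cumulative_integrable:
  "set_integrable lborel {0<..} \<psi> \<Longrightarrow> set_integrable lborel {0<..t::real} (\<psi> :: real \<Rightarrow> real)"
  by (erule set_integrable_subset) auto

lemma set_integral_mono_set:
  fixes f :: "real \<Rightarrow> real"
  assumes "set_integrable lborel B f" "A \<in> sets lborel" "A \<subseteq> B" "\<And>x. x \<in> B \<Longrightarrow> 0 \<le> f x"
  shows "(LBINT x:A. f x) \<le> (LBINT x:B. f x)"
  unfolding set_lebesgue_integral_def
proof (rule integral_mono)
  show "integrable lborel (\<lambda>x. indicat_real A x *\<^sub>R f x)"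
    using set_integrable_subset[OF assms(1-3)] by (simp add: set_integrable_def)
  show "integrable lborel (\<lambda>x. indicat_real B x *\<^sub>R f x)"
    using assms(1) by (simp add: set_integrable_def)
  show "indicat_real A x *\<^sub>R f x \<le> indicat_real B x *\<^sub>R f x" for x
    using assms(3,4) by (auto simp: indicator_def)
qed

lemma cumulative_nonneg: "(\<And>u. 0 < u \<Longrightarrow> 0 \<le> \<psi> u) \<Longrightarrow> 0 \<le> cumulative \<psi> t"
  unfolding cumulative_def set_lebesgue_integral_def
  by (intro Bochner_Integration.integral_nonneg) (auto simp: indicator_def)

lemma cumulative_mono:
  assumes "\<And>u. 0 < u \<Longrightarrow> 0 \<le> \<psi> u" "set_integrable lborel {0<..} \<psi>" "s \<le> t"
  shows "cumulative \<psi> s \<le> cumulative \<psi> t"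
  unfolding cumulative_def
  by (rule set_integral_mono_set) (use assms cumulative_integrable in auto)

lemma cumulative_zero_AE:
  assumes nn: "\<And>u. 0 < u \<Longrightarrow> 0 \<le> \<psi> u" and i: "set_integrable lborel {0<..} \<psi>"
    and z: "cumulative \<psi> t = 0"
  shows "AE u in lborel. u \<in> {0<..t} \<longrightarrow> \<psi> u = 0"
proof -
  have "AE u in lborel. indicat_real {0<..t} u *\<^sub>R \<psi> u = 0"
  proof (subst integral_nonneg_eq_0_iff_AE[symmetric])
    show "integrable lborel (\<lambda>u. indicat_real {0<..t} u *\<^sub>R \<psi> u)"
      using cumulative_integrable[OF i] by (simp add: set_integrable_def)
    show "AE u in lborel. 0 \<le> indicat_real {0<..t} u *\<^sub>R \<psi> u"
      by (rule AE_I2) (use nn in \<open>auto simp: indicator_def\<close>)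
    show "(LINT u|lborel. indicat_real {0<..t} u *\<^sub>R \<psi> u) = 0"
      using z by (simp add: cumulative_def set_lebesgue_integral_def)
  qed
  then show ?thesis by eventually_elim (auto simp: indicator_def)
qed

lemma ratio_le:
  assumes "0 < k" "0 \<le> p" "0 \<le> c" "k * p \<le> C * c"
  shows "ennreal p / ennreal c \<le> ennreal (C * (1 / k))"
proof (cases "c = 0")
  case True
  then have "p = 0" using assms by (simp add: mult_le_0_iff)
  then show ?thesis by simp
next
  case False
  then have c: "0 < c" using assms by simp
  have "p / c \<le> C * (1 / k)" using assms c by (simp add: field_simps)
  then show ?thesis using assms c by (simp add: divide_ennreal ennreal_leI)
qed

lemma ratio_integral_finite:
  fixes \<psi> \<kappa> :: "real \<Rightarrow> real"
  assumes nn: "\<And>u. 0 < u \<Longrightarrow> 0 \<le> \<psi> u" and i: "set_integrable lborel {0<..} \<psi>"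
    and pos: "0 < (LBINT u:{0<..}. \<psi> u)" and \<zeta>: "1 < \<zeta>" and \<eta>: "0 < \<eta>"
    and \<kappa>: "set_integrable lborel {0<..<\<eta>} (\<lambda>u. 1 / \<kappa> u)"
    and near: "\<And>u. u \<in> {0<..<\<eta>} \<Longrightarrow> 0 < \<kappa> u \<and> \<kappa> u * \<psi> u \<le> C * cumulative \<psi> (\<zeta> * u)"
  shows "(\<integral>\<^sup>+u. indicator {0<..} u * (ennreal (\<psi> u) / ennreal (cumulative \<psi> (\<zeta> * u))) \<partial>lborel) < \<infinity>"
proof -
  let ?r = "\<lambda>u. ennreal (\<psi> u) / ennreal (cumulative \<psi> (\<zeta> * u))"
  have cnn: "0 \<le> cumulative \<psi> t" for t using nn by (rule cumulative_nonneg)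
  have cm: "s \<le> t \<Longrightarrow> cumulative \<psi> s \<le> cumulative \<psi> t" for s t
    using nn i by (rule cumulative_mono)
  have "\<exists>b>0. 0 < cumulative \<psi> (\<zeta> * b) \<and> (\<exists>w. integrable lborel w \<and>
    (AE u in lborel. u \<in> {0<..<b} \<longrightarrow> 0 \<le> w u \<and> ?r u \<le> ennreal (w u)))"
  proof (cases "\<exists>t>0. cumulative \<psi> t = 0")
    case False
    then have p: "0 < cumulative \<psi> (\<zeta> * \<eta>)"
      using cnn[of "\<zeta> * \<eta>"] \<eta> \<zeta> by (metis less_eq_real_def mult_pos_pos zero_less_one order_less_trans)
    have C: "0 \<le> C * (1 / \<kappa> u)" if u: "u \<in> {0<..<\<eta>}" for u
    proof -
      have "0 < cumulative \<psi> (\<zeta> * u)"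
        using False cnn[of "\<zeta> * u"] u \<zeta>
        by (metis greaterThanLessThan_iff less_eq_real_def mult_pos_pos zero_less_one order_less_trans)
      moreover have "0 \<le> C * cumulative \<psi> (\<zeta> * u)"
        using near[OF u] nn[of u] u by (auto intro: order_trans[rotated])
      ultimately have "0 \<le> C" by (simp add: zero_le_mult_iff)
      then show ?thesis using near[OF u] by simp
    qed
    show ?thesis
    proof (intro exI[of _ \<eta>] conjI \<eta> p exI AE_I2 impI)
      show "integrable lborel (\<lambda>u. C * (indicator {0<..<\<eta>} u * (1 / \<kappa> u)))"
        using \<kappa> by (intro integrable_mult_right) (simp add: set_integrable_def)
      fix u assume u: "u \<in> {0<..<\<eta>}"
      then show "0 \<le> C * (indicator {0<..<\<eta>} u * (1 / \<kappa> u))" using C by simp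
      have "?r u \<le> ennreal (C * (1 / \<kappa> u))"
        using near[OF u] nn[of u] cnn u by (intro ratio_le) auto
      then show "?r u \<le> ennreal (C * (indicator {0<..<\<eta>} u * (1 / \<kappa> u)))" using u by simp
    qed
  next
    case True
    let ?Z = "{t. 0 < t \<and> cumulative \<psi> t = 0}"
    have "((\<lambda>n. cumulative \<psi> (real n)) \<longlonglongrightarrow> (LBINT u:{0<..}. \<psi> u))"
      unfolding cumulative_def set_lebesgue_integral_def
    proof (rule integral_dominated_convergence[where w="\<lambda>u. indicator {0<..} u * \<psi> u"])
      show m: "(\<lambda>x. indicat_real {0<..} x *\<^sub>R \<psi> x) \<in> borel_measurable lborel"
        using i by (auto simp: set_integrable_def)
      show "(\<lambda>x. indicat_real {0<..real n} x *\<^sub>R \<psi> x) \<in> borel_measurable lborel" for n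
        using cumulative_integrable[OF i, of "real n"] by (auto simp: set_integrable_def)
      show "integrable lborel (\<lambda>u. indicator {0<..} u * \<psi> u)"
        using i by (simp add: set_integrable_def)
      show "AE x in lborel. (\<lambda>n. indicat_real {0<..real n} x *\<^sub>R \<psi> x) \<longlonglongrightarrow> indicat_real {0<..} x *\<^sub>R \<psi> x"
      proof (rule AE_I2, rule tendsto_eventually)
        fix x :: real
        show "\<forall>\<^sub>F n in sequentially. indicat_real {0<..real n} x *\<^sub>R \<psi> x = indicat_real {0<..} x *\<^sub>R \<psi> x"
          using eventually_gt_at_top[of "nat \<lceil>x\<rceil>"]
        proof eventually_elim
          case (elim n)
          then have "x < real n" by linarith
          then show ?case by (auto simp: indicator_def)
        qed
      qed
      show "AE x in lborel. norm (indicat_real {0<..real n} x *\<^sub>R \<psi> x) \<le> indicator {0<..} x * \<psi> x" for n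
        by (rule AE_I2) (use nn in \<open>auto simp: indicator_def\<close>)
    qed
    then have "\<forall>\<^sub>F n in sequentially. 0 < cumulative \<psi> (real n)"
      using pos by (rule order_tendstoD)
    then obtain n where n: "0 < cumulative \<psi> (real n)" by (auto simp: eventually_sequentially)
    have bdd: "bdd_above ?Z"
    proof (rule bdd_aboveI[of _ "real n"])
      fix t assume "t \<in> ?Z"
      then show "t \<le> real n" using n cm[of "real n" t] by (cases "t \<le> real n") auto
    qed
    define b where "b = Sup ?Z"
    obtain t0 where t0: "t0 \<in> ?Z" using True by auto
    have b: "0 < b" using cSup_upper[OF t0 bdd] t0 by (simp add: b_def)
    have "b < \<zeta> * b" using b \<zeta> by simp
    then have "\<zeta> * b \<notin> ?Z" using cSup_upper[OF _ bdd, of "\<zeta> * b"] by (auto simp: b_def)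
    then have p: "0 < cumulative \<psi> (\<zeta> * b)"
      using b \<zeta> cnn[of "\<zeta> * b"] by (auto simp: less_eq_real_def)
    have "AE u in lborel. \<forall>t\<in>\<rat>. 0 < t \<and> t < b \<longrightarrow> u \<in> {0<..t} \<longrightarrow> \<psi> u = 0"
    proof (rule AE_ball_countable')
      fix t :: real
      show "AE u in lborel. 0 < t \<and> t < b \<longrightarrow> u \<in> {0<..t} \<longrightarrow> \<psi> u = 0"
      proof (cases "0 < t \<and> t < b")
        case True
        then obtain s where "s \<in> ?Z" "t < s"
          using less_cSup_iff[OF _ bdd, of t] t0 by (auto simp: b_def)
        then have "cumulative \<psi> t = 0" using cm[of t s] cnn[of t] by auto
        from cumulative_zero_AE[OF nn i this] show ?thesis by auto
      qed auto
    qed (rule countable_rat)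
    then have "AE u in lborel. u \<in> {0<..<b} \<longrightarrow> \<psi> u = 0"
    proof eventually_elim
      case (elim u)
      show ?case
      proof
        assume u: "u \<in> {0<..<b}"
        then obtain t where "t \<in> \<rat>" "u < t" "t < b" using Rats_dense_in_real[of u b] by auto
        then show "\<psi> u = 0" using elim u by auto
      qed
    qed
    then have "AE u in lborel. u \<in> {0<..<b} \<longrightarrow> 0 \<le> (0::real) \<and> ?r u \<le> ennreal 0"
      by eventually_elim auto
    then show ?thesis using b p by (intro exI[of _ b] conjI exI[of _ "\<lambda>_. 0"]) auto
  qed
  then obtain b w where b: "0 < b" "0 < cumulative \<psi> (\<zeta> * b)" and w: "integrable lborel w"
    and le: "AE u in lborel. u \<in> {0<..<b} \<longrightarrow> 0 \<le> w u \<and> ?r u \<le> ennreal (w u)"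
    by blast
  let ?c = "1 / cumulative \<psi> (\<zeta> * b)"
  have "AE u in lborel. indicator {0<..} u * ?r u
      \<le> ennreal \<bar>w u\<bar> + ennreal (indicator {0<..} u * \<psi> u * ?c)"
    using le
  proof eventually_elim
    case (elim u)
    consider "u \<le> 0" | "0 < u" "u < b" | "b \<le> u" by linarith
    then show ?case
    proof cases
      case 2
      then have "?r u \<le> ennreal \<bar>w u\<bar>" using elim by auto
      then show ?thesis using 2 by (auto intro: add_increasing2)
    next
      case 3
      then have u: "0 < u" using b by simp
      have m: "cumulative \<psi> (\<zeta> * b) \<le> cumulative \<psi> (\<zeta> * u)" using 3 \<zeta> by (intro cm) simp
      have "?r u = ennreal (\<psi> u / cumulative \<psi> (\<zeta> * u))"
        using nn[OF u] b m by (intro divide_ennreal) auto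
      also have "\<dots> \<le> ennreal (indicator {0<..} u * \<psi> u * ?c)"
        using u nn[OF u] b m by (intro ennreal_leI) (auto intro!: divide_left_mono mult_pos_pos)
      finally show ?thesis using u by (auto intro: add_increasing)
    qed simp
  qed
  then have "(\<integral>\<^sup>+u. indicator {0<..} u * ?r u \<partial>lborel)
      \<le> (\<integral>\<^sup>+u. ennreal \<bar>w u\<bar> + ennreal (indicator {0<..} u * \<psi> u * ?c) \<partial>lborel)"
    by (rule nn_integral_mono_AE)
  also have "\<dots> = (\<integral>\<^sup>+u. ennreal \<bar>w u\<bar> \<partial>lborel) + (\<integral>\<^sup>+u. ennreal (indicator {0<..} u * \<psi> u * ?c) \<partial>lborel)"
    using w i by (intro nn_integral_add) (auto simp: set_integrable_def)
  also have "\<dots> < \<infinity>"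
  proof -
    have fin: "(\<integral>\<^sup>+u. ennreal (v u) \<partial>lborel) < \<infinity>" if "integrable lborel v" for v :: "real \<Rightarrow> real"
    proof -
      have "(\<integral>\<^sup>+u. ennreal (v u) \<partial>lborel) \<le> (\<integral>\<^sup>+u. ennreal (norm (v u)) \<partial>lborel)"
        by (intro nn_integral_mono ennreal_leI) simp
      also have "\<dots> < \<infinity>" using that by (simp add: integrable_iff_bounded)
      finally show ?thesis .
    qed
    have "integrable lborel (\<lambda>u. indicator {0<..} u * \<psi> u * ?c)"
      using i by (intro integrable_mult_left) (simp add: set_integrable_def)
    from fin[OF this] fin[OF integrable_abs[OF w]] show ?thesis by simp
  qed
  finally show ?thesis .
qed

lemma class_C_cumulative_bound:
  assumes \<kappa>: "\<kappa> \<in> class_K" and \<zeta>: "1 < \<zeta>" and g: "g \<in> class_C d \<kappa> \<zeta>"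
  shows "\<exists>\<eta>>0. \<exists>C\<ge>0. set_integrable lborel {0<..<\<eta>} (\<lambda>u. 1 / \<kappa> u) \<and>
    set_integrable lborel {0<..<\<zeta> * \<eta>} (\<lambda>u. u powr (real d / 2) * g u) \<and>
    (\<forall>u\<in>{0<..<\<zeta> * \<eta>}. 0 < g u) \<and>
    (\<forall>u\<in>{0<..<\<eta>}. 0 < \<kappa> u \<and>
      \<kappa> u * (u powr (real d / 2) * g u) \<le> C * cumulative (\<lambda>u. u powr (real d / 2) * g u) (\<zeta> * u))"
proof -
  define \<delta> where "\<delta> = real d / 2"
  define \<gamma> where "\<gamma> u = u powr \<delta> * g u" for u
  have gA: "g \<in> class_A"
    and B: "\<exists>\<eta>>0. \<exists>B. \<forall>u\<in>{0<..<\<eta>}. \<bar>u powr \<delta> * g u\<bar> \<le> B"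
    and lim0: "((\<lambda>u. \<kappa> u * u powr \<delta> * g u) \<longlongrightarrow> 0) (at_right 0)"
    using g by (auto simp: class_C_def \<delta>_def)
  obtain l1 l2 where
      l1: "((\<lambda>u. (deriv \<kappa> u + \<delta> * (\<kappa> u / u)) * (g u / g (\<zeta> * u))) \<longlongrightarrow> l1) (at_right 0)"
    and l2: "((\<lambda>u. \<kappa> u * deriv g u / g (\<zeta> * u)) \<longlongrightarrow> l2) (at_right 0)"
    using g by (auto simp: class_C_def \<delta>_def)
  obtain \<eta>1 where \<eta>1: "\<eta>1 > 0" "\<And>u. u \<in> {0<..<\<eta>1} \<Longrightarrow> 0 < g u \<and> g differentiable (at u)"
    using gA by (auto simp: class_A_def)
  obtain \<eta>2 where \<eta>2: "\<eta>2 > 0" "\<And>u. u \<in> {0<..<\<eta>2} \<Longrightarrow> 0 < \<kappa> u \<and> \<kappa> differentiable (at u)"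
    using \<kappa> by (auto simp: class_K_def class_A_def)
  obtain \<eta>3 where \<eta>3: "\<eta>3 > 0" "set_integrable lborel {0<..<\<eta>3} (\<lambda>u. 1 / \<kappa> u)"
    using \<kappa> by (auto simp: class_K_def)
  obtain \<eta>4 b where \<eta>4: "\<eta>4 > 0" "\<And>u. u \<in> {0<..<\<eta>4} \<Longrightarrow> \<bar>\<gamma> u\<bar> \<le> b"
    using B unfolding \<gamma>_def by blast
  define C0 where "C0 = \<bar>l1 + l2\<bar> + 1"
  have "\<forall>\<^sub>F u in at_right 0. (deriv \<kappa> u + \<delta> * (\<kappa> u / u)) * (g u / g (\<zeta> * u)) + \<kappa> u * deriv g u / g (\<zeta> * u) < C0"
    using tendsto_add[OF l1 l2] by (rule order_tendstoD) (simp add: C0_def abs_if)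
  then obtain \<eta>5 where \<eta>5: "\<eta>5 > 0" "\<And>u. u \<in> {0<..<\<eta>5} \<Longrightarrow>
      (deriv \<kappa> u + \<delta> * (\<kappa> u / u)) * (g u / g (\<zeta> * u)) + \<kappa> u * deriv g u / g (\<zeta> * u) < C0"
    by (auto simp: eventually_at_right_field)
  define \<eta> where "\<eta> = min (min (\<eta>1 / \<zeta>) \<eta>2) (min \<eta>3 (min (\<eta>4 / \<zeta>) \<eta>5))"
  have \<eta>: "0 < \<eta>" using \<eta>1 \<eta>2 \<eta>3 \<eta>4 \<eta>5 \<zeta> by (simp add: \<eta>_def)
  have le: "\<zeta> * \<eta> \<le> \<eta>1" "\<eta> \<le> \<eta>2" "\<eta> \<le> \<eta>3" "\<zeta> * \<eta> \<le> \<eta>4" "\<eta> \<le> \<eta>5"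
  proof -
    have "\<eta> \<le> \<eta>1 / \<zeta>" "\<eta> \<le> \<eta>4 / \<zeta>" by (auto simp: \<eta>_def)
    then show "\<zeta> * \<eta> \<le> \<eta>1" "\<zeta> * \<eta> \<le> \<eta>4" using \<zeta> by (auto simp: field_simps)
  qed (auto simp: \<eta>_def)
  have gpos: "0 < g u" "g differentiable (at u)" if "u \<in> {0<..<\<zeta> * \<eta>}" for u
    using \<eta>1(2)[of u] that le by auto
  have \<gamma>nn: "0 \<le> \<gamma> u" if "u > 0" for u
    using gA that by (auto simp: class_A_def \<gamma>_def)
  have \<gamma>cont: "isCont \<gamma> u" if u: "u \<in> {0<..<\<zeta> * \<eta>}" for u
  proof -
    have "isCont (\<lambda>u. u powr \<delta>) u" using u by (auto intro!: continuous_intros)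
    then show ?thesis
      unfolding \<gamma>_def by (rule isCont_mult) (rule differentiable_imp_continuous_within[OF gpos(2)[OF u]])
  qed
  have \<gamma>int: "set_integrable lborel {0<..<\<zeta> * \<eta>} \<gamma>"
    unfolding set_integrable_def
  proof (rule Bochner_Integration.integrable_bound[where f="\<lambda>u. indicator {0<..<\<zeta> * \<eta>} u *\<^sub>R b"])
    show "integrable lborel (\<lambda>u. indicator {0<..<\<zeta> * \<eta>} u *\<^sub>R b)"
      using \<eta> \<zeta> by simp
    show "(\<lambda>x. indicat_real {0<..<\<zeta> * \<eta>} x *\<^sub>R \<gamma> x) \<in> borel_measurable lborel"
    proof -
      have "continuous_on {0<..<\<zeta> * \<eta>} \<gamma>" by (intro continuous_at_imp_continuous_on ballI \<gamma>cont)
      then show ?thesis using borel_measurable_continuous_on_indicator[of "{0<..<\<zeta> * \<eta>}" \<gamma>] by simp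
    qed
    show "AE x in lborel. norm (indicat_real {0<..<\<zeta> * \<eta>} x *\<^sub>R \<gamma> x) \<le> norm (indicat_real {0<..<\<zeta> * \<eta>} x *\<^sub>R b)"
    proof (rule AE_I2)
      fix x
      show "norm (indicat_real {0<..<\<zeta> * \<eta>} x *\<^sub>R \<gamma> x) \<le> norm (indicat_real {0<..<\<zeta> * \<eta>} x *\<^sub>R b)"
        using \<eta>4(2)[of x] le by (cases "x \<in> {0<..<\<zeta> * \<eta>}") (auto intro: order_trans)
    qed
  qed
  define C where "C = C0 / (\<zeta> powr \<delta> * \<zeta>)"
  have C: "0 \<le> C" using \<zeta> by (simp add: C_def C0_def)
  have bound: "\<kappa> u * \<gamma> u \<le> C * cumulative \<gamma> (\<zeta> * u)" if u: "u \<in> {0<..<\<eta>}" for u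
  proof -
    have step: "\<kappa> u * \<gamma> u - \<kappa> s * \<gamma> s \<le> C * cumulative \<gamma> (\<zeta> * u)" if s: "s \<in> {0<..<u}" for s
    proof -
      define c where "c = s / 2"
      define e where "e = \<zeta> * ((u + \<eta>) / 2)"
      have ce: "0 < c" "c < \<zeta> * s" "\<zeta> * u < e" "e < \<zeta> * \<eta>"
        using s u \<zeta> by (auto simp: c_def e_def intro: less_trans[of _ s])
      have cont: "continuous_on {c..e} \<gamma>"
        using ce by (intro continuous_at_imp_continuous_on ballI \<gamma>cont) auto
      define F where "F x = integral {c..x} \<gamma>" for x
      have Fd: "(F has_real_derivative \<gamma> x) (at x)" if "x \<in> {\<zeta> * s..\<zeta> * u}" for x
      proof -
        have x: "c < x" "x < e" using that ce by auto
        have "(F has_real_derivative \<gamma> x) (at x within {c..e})"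
          unfolding F_def using x by (intro integral_has_real_derivative cont) auto
        then show ?thesis using x by (simp add: at_within_Icc_at)
      qed
      let ?\<Phi> = "\<lambda>x. C * F (\<zeta> * x) - \<kappa> x * \<gamma> x"
      have "?\<Phi> s \<le> ?\<Phi> u"
      proof (rule DERIV_nonneg_imp_nondecreasing[where f="?\<Phi>"])
        show "s \<le> u" using s by simp
        fix x assume "s \<le> x" "x \<le> u"
        moreover have xs: "x < \<eta>" "0 < x" using \<open>s \<le> x\<close> \<open>x \<le> u\<close> s u by auto
        moreover have "x < \<zeta> * \<eta>" using mult_strict_mono[of 1 \<zeta> x \<eta>] xs \<zeta> by simp
        ultimately have x: "x \<in> {0<..<\<eta>}" "\<zeta> * x \<in> {\<zeta> * s..\<zeta> * u}" "x \<in> {0<..<\<zeta> * \<eta>}" "\<zeta> * x \<in> {0<..<\<zeta> * \<eta>}"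
          using \<zeta> by auto
        have x0: "0 < x" using x by simp
        have g1: "0 < g x" "0 < g (\<zeta> * x)" using gpos x by auto
        have dg: "(g has_real_derivative deriv g x) (at x)"
          using gpos(2)[OF x(3)] by (simp add: DERIV_deriv_iff_real_differentiable)
        have d\<kappa>: "(\<kappa> has_real_derivative deriv \<kappa> x) (at x)"
          using \<eta>2(2)[of x] x le by (simp add: DERIV_deriv_iff_real_differentiable)
        have d1: "((\<lambda>x. C * F (\<zeta> * x)) has_real_derivative C * (\<gamma> (\<zeta> * x) * \<zeta>)) (at x)"
          by (intro DERIV_cmult DERIV_chain2[where f=F] Fd x) (auto intro!: derivative_eq_intros)
        have d2: "((\<lambda>x. \<kappa> x * \<gamma> x) has_real_derivative
            x powr \<delta> * ((deriv \<kappa> x + \<delta> * (\<kappa> x / x)) * g x + \<kappa> x * deriv g x)) (at x)"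
          unfolding \<gamma>_def
          by (rule DERIV_cong[OF DERIV_mult[OF d\<kappa> DERIV_mult[OF has_real_derivative_powr[OF x0] dg]]])
             (use x0 in \<open>simp add: field_simps powr_diff\<close>)
        have "x powr \<delta> * ((deriv \<kappa> x + \<delta> * (\<kappa> x / x)) * g x + \<kappa> x * deriv g x)
          = x powr \<delta> * g (\<zeta> * x) * ((deriv \<kappa> x + \<delta> * (\<kappa> x / x)) * (g x / g (\<zeta> * x)) + \<kappa> x * deriv g x / g (\<zeta> * x))"
          using g1 by (simp add: field_simps)
        also have "\<dots> \<le> x powr \<delta> * g (\<zeta> * x) * C0"
          using g1 x le by (intro mult_left_mono less_imp_le[OF \<eta>5(2)]) auto
        also have "\<dots> = C * (\<gamma> (\<zeta> * x) * \<zeta>)"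
          using \<zeta> x0 by (simp add: \<gamma>_def C_def powr_mult)
        finally show "\<exists>y. (?\<Phi> has_real_derivative y) (at x) \<and> 0 \<le> y"
          using DERIV_diff[OF d1 d2] by (intro exI conjI) auto
      qed
      then have "\<kappa> u * \<gamma> u - \<kappa> s * \<gamma> s \<le> C * F (\<zeta> * u) - C * F (\<zeta> * s)" by simp
      also have "\<dots> \<le> C * F (\<zeta> * u)"
      proof -
        have "0 \<le> F (\<zeta> * s)" unfolding F_def using ce \<gamma>nn
          by (intro Henstock_Kurzweil_Integration.integral_nonneg integrable_continuous_interval
              continuous_on_subset[OF cont]) (use s u \<zeta> in \<open>auto intro: order_trans[of _ "\<zeta> * u"]\<close>)
        then show ?thesis using C by simp
      qed
      also have "F (\<zeta> * u) \<le> cumulative \<gamma> (\<zeta> * u)"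
      proof -
        have sub: "{c..\<zeta> * u} \<subseteq> {0<..<\<zeta> * \<eta>}" using ce by auto
        have si: "set_integrable lborel {c..\<zeta> * u} \<gamma>"
          by (rule set_integrable_subset[OF \<gamma>int]) (use sub in auto)
        have "F (\<zeta> * u) = (LBINT x:{c..\<zeta> * u}. \<gamma> x)"
          unfolding F_def using set_borel_integral_eq_integral(2)[OF si] by simp
        also have "\<dots> \<le> cumulative \<gamma> (\<zeta> * u)"
          unfolding cumulative_def
        proof (rule set_integral_mono_set)
          have "{0<..\<zeta> * u} \<subseteq> {0<..<\<zeta> * \<eta>}" using ce by auto
          then show "set_integrable lborel {0<..\<zeta> * u} \<gamma>"
            by (intro set_integrable_subset[OF \<gamma>int]) auto
        qed (use ce \<gamma>nn in auto)
        finally show ?thesis .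
      qed
      finally show ?thesis using C by (simp add: mult_left_mono)
    qed
    have "((\<lambda>s. \<kappa> u * \<gamma> u - \<kappa> s * \<gamma> s) \<longlongrightarrow> \<kappa> u * \<gamma> u - 0) (at_right 0)"
      using lim0 by (intro tendsto_diff tendsto_const) (simp add: \<gamma>_def mult.assoc)
    moreover have "\<forall>\<^sub>F s in at_right 0. \<kappa> u * \<gamma> u - \<kappa> s * \<gamma> s \<le> C * cumulative \<gamma> (\<zeta> * u)"
      using eventually_at_right_less[of 0] step u
      by (auto simp: eventually_at_right_field intro!: exI[of _ u])
    ultimately show ?thesis
      using tendsto_upperbound[of "\<lambda>s. \<kappa> u * \<gamma> u - \<kappa> s * \<gamma> s" _ "at_right 0"] by simp
  qed
  show ?thesis
    unfolding \<delta>_def[symmetric] \<gamma>_def[symmetric]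
  proof (rule exI[of _ \<eta>], rule conjI[OF \<eta>], rule exI[of _ C], intro conjI ballI C \<gamma>int bound gpos)
    show "set_integrable lborel {0<..<\<eta>} (\<lambda>u. 1 / \<kappa> u)"
      by (rule set_integrable_subset[OF \<eta>3(2)]) (use le in auto)
    show "0 < \<kappa> u" if "u \<in> {0<..<\<eta>}" for u using \<eta>2(2)[of u] that le by auto
  qed auto
qed

lemma cumulative_cmult_le:
  assumes "set_integrable lborel {0<..t} f" "set_integrable lborel {0<..t} g"
    and "\<And>v. v \<in> {0<..t} \<Longrightarrow> c * f v \<le> g v"
  shows "c * cumulative f t \<le> cumulative g t"
proof -
  have "c * cumulative f t = (LBINT v:{0<..t}. c * f v)"
    unfolding cumulative_def by simp
  also have "\<dots> \<le> cumulative g t"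
    unfolding cumulative_def using assms by (intro set_integral_mono) auto
  finally show ?thesis .
qed

lemma ratio_integral_finite_asymptotic:
  assumes nn: "\<And>u. 0 < u \<Longrightarrow> 0 \<le> h u" and i: "set_integrable lborel {0<..} (\<lambda>u. u powr (real d / 2) * h u)"
    and pos: "0 < (LBINT u:{0<..}. u powr (real d / 2) * h u)"
    and \<kappa>: "\<kappa> \<in> class_K" and \<zeta>: "1 < \<zeta>" and g: "g \<in> class_C d \<kappa> \<zeta>"
    and L: "0 < L" "((\<lambda>u. h u / g u) \<longlongrightarrow> L) (at_right 0)"
  shows "(\<integral>\<^sup>+u. indicator {0<..} u * (ennreal (u powr (real d / 2) * h u)
      / ennreal (cumulative (\<lambda>u. u powr (real d / 2) * h u) (\<zeta> * u))) \<partial>lborel) < \<infinity>"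
proof -
  let ?\<psi> = "\<lambda>u. u powr (real d / 2) * h u"
  let ?\<gamma> = "\<lambda>u. u powr (real d / 2) * g u"
  obtain \<eta> C where \<eta>: "0 < \<eta>" "0 \<le> C" "set_integrable lborel {0<..<\<eta>} (\<lambda>u. 1 / \<kappa> u)"
    "set_integrable lborel {0<..<\<zeta> * \<eta>} ?\<gamma>" "\<And>u. u \<in> {0<..<\<zeta> * \<eta>} \<Longrightarrow> 0 < g u"
    and b: "\<And>u. u \<in> {0<..<\<eta>} \<Longrightarrow> 0 < \<kappa> u" "\<And>u. u \<in> {0<..<\<eta>} \<Longrightarrow> \<kappa> u * ?\<gamma> u \<le> C * cumulative ?\<gamma> (\<zeta> * u)"
    using class_C_cumulative_bound[OF \<kappa> \<zeta> g] by blast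
  have "\<forall>\<^sub>F u in at_right 0. L / 2 < h u / g u \<and> h u / g u < 2 * L"
    using L by (intro eventually_conj order_tendstoD[OF L(2)]) auto
  then obtain \<eta>' where \<eta>': "0 < \<eta>'" "\<And>u. u \<in> {0<..<\<eta>'} \<Longrightarrow> L / 2 < h u / g u \<and> h u / g u < 2 * L"
    by (auto simp: eventually_at_right_field)
  define e where "e = min \<eta> (\<eta>' / \<zeta>)"
  have e: "0 < e" "e \<le> \<eta>" using \<eta> \<eta>' \<zeta> by (auto simp: e_def)
  have "e \<le> \<eta>' / \<zeta>" by (simp add: e_def)
  then have e': "\<zeta> * e \<le> \<eta>'" using \<zeta> by (simp add: field_simps)
  have \<zeta>e: "\<zeta> * u < \<zeta> * e" "u < \<zeta> * u" if "u \<in> {0<..<e}" for u using that \<zeta> by auto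
  have \<zeta>\<eta>: "\<zeta> * e \<le> \<zeta> * \<eta>" using e \<zeta> by simp
  have hg: "L / 2 * g v \<le> h v" "h v \<le> 2 * L * g v" if "v \<in> {0<..<\<zeta> * e}" for v
  proof -
    have "0 < g v" using \<eta>(5)[of v] that \<zeta>\<eta> by auto
    moreover have "L / 2 < h v / g v" "h v / g v < 2 * L" using \<eta>'(2)[of v] that e' by auto
    ultimately show "L / 2 * g v \<le> h v" "h v \<le> 2 * L * g v"
      by (auto simp: pos_less_divide_eq pos_divide_less_eq intro: less_imp_le)
  qed
  show ?thesis
  proof (rule ratio_integral_finite[OF _ i pos \<zeta> e(1), of \<kappa> "4 * C"])
    show "0 \<le> ?\<psi> u" if "0 < u" for u using nn that by simp
    show "set_integrable lborel {0<..<e} (\<lambda>u. 1 / \<kappa> u)"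
      by (rule set_integrable_subset[OF \<eta>(3)]) (use e in auto)
    fix u assume u: "u \<in> {0<..<e}"
    have k: "0 < \<kappa> u" using b(1)[of u] u e by auto
    have sub: "{0<..\<zeta> * u} \<subseteq> {0<..<\<zeta> * \<eta>}" using \<zeta>e[OF u] \<zeta>\<eta> by auto
    have c: "L / 2 * cumulative ?\<gamma> (\<zeta> * u) \<le> cumulative ?\<psi> (\<zeta> * u)"
    proof (rule cumulative_cmult_le)
      show "set_integrable lborel {0<..\<zeta> * u} ?\<gamma>"
        by (rule set_integrable_subset[OF \<eta>(4)]) (use sub in auto)
      fix v assume "v \<in> {0<..\<zeta> * u}"
      then have "L / 2 * g v \<le> h v" using \<zeta>e[OF u] by (intro hg) auto
      then have "v powr (real d / 2) * (L / 2 * g v) \<le> ?\<psi> v" by (rule mult_left_mono) simp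
      then show "L / 2 * ?\<gamma> v \<le> ?\<psi> v" by (simp add: ac_simps)
    qed (rule cumulative_integrable[OF i])
    have "?\<psi> u \<le> u powr (real d / 2) * (2 * L * g u)"
      using less_trans[OF \<zeta>e(2)[OF u] \<zeta>e(1)[OF u]] u by (intro mult_left_mono hg) auto
    then have "\<kappa> u * ?\<psi> u \<le> 2 * L * (\<kappa> u * ?\<gamma> u)" using k by (simp add: ac_simps)
    also have "\<dots> \<le> 2 * L * (C * cumulative ?\<gamma> (\<zeta> * u))"
      using b(2)[of u] u e L by (intro mult_left_mono) auto
    also have "\<dots> = 4 * C * (L / 2 * cumulative ?\<gamma> (\<zeta> * u))" by simp
    also have "\<dots> \<le> 4 * C * cumulative ?\<psi> (\<zeta> * u)" using c \<eta> by (intro mult_left_mono) auto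
    finally show "0 < \<kappa> u \<and> \<kappa> u * ?\<psi> u \<le> 4 * C * cumulative ?\<psi> (\<zeta> * u)" using k by simp
  qed
qed

lemma ratio_integral_finite_monotone:
  assumes nn: "\<And>u. 0 < u \<Longrightarrow> 0 \<le> h u" and i: "set_integrable lborel {0<..} (\<lambda>u. u powr (real d / 2) * h u)"
    and pos: "0 < (LBINT u:{0<..}. u powr (real d / 2) * h u)"
    and \<kappa>: "\<kappa> \<in> class_K" and \<zeta>: "1 < \<zeta>" and g: "g \<in> class_C d \<kappa> \<zeta>"
    and \<eta>': "0 < \<eta>'" and m1: "mono_on {0<..<\<eta>'} (\<lambda>u. u powr (real d / 2) * g u)"
    and m2: "mono_on {0<..<\<eta>'} (\<lambda>u. h u / g u)"
  shows "(\<integral>\<^sup>+u. indicator {0<..} u * (ennreal (u powr (real d / 2) * h u)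
      / ennreal (cumulative (\<lambda>u. u powr (real d / 2) * h u) (\<zeta> * u))) \<partial>lborel) < \<infinity>"
proof -
  let ?\<psi> = "\<lambda>u. u powr (real d / 2) * h u"
  let ?\<gamma> = "\<lambda>u. u powr (real d / 2) * g u"
  obtain \<eta> C where \<eta>: "0 < \<eta>" "0 \<le> C" "set_integrable lborel {0<..<\<eta>} (\<lambda>u. 1 / \<kappa> u)"
    "set_integrable lborel {0<..<\<zeta> * \<eta>} ?\<gamma>" "\<And>u. u \<in> {0<..<\<zeta> * \<eta>} \<Longrightarrow> 0 < g u"
    and b: "\<And>u. u \<in> {0<..<\<eta>} \<Longrightarrow> 0 < \<kappa> u" "\<And>u. u \<in> {0<..<\<eta>} \<Longrightarrow> \<kappa> u * ?\<gamma> u \<le> C * cumulative ?\<gamma> (\<zeta> * u)"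
    using class_C_cumulative_bound[OF \<kappa> \<zeta> g] by blast
  define e where "e = min \<eta> (\<eta>' / \<zeta>)"
  have e: "0 < e" "e \<le> \<eta>" using \<eta> \<eta>' \<zeta> by (auto simp: e_def)
  have "e \<le> \<eta>' / \<zeta>" by (simp add: e_def)
  then have e': "\<zeta> * e \<le> \<eta>'" using \<zeta> by (simp add: field_simps)
  have \<zeta>e: "\<zeta> * u < \<zeta> * e" "u < \<zeta> * u" if "u \<in> {0<..<e}" for u using that \<zeta> by auto
  have \<zeta>\<eta>: "\<zeta> * e \<le> \<zeta> * \<eta>" using e \<zeta> by simp
  let ?c = "\<zeta> / (\<zeta> - 1)"
  show ?thesis
  proof (rule ratio_integral_finite[OF _ i pos \<zeta> e(1), of \<kappa> "C * ?c"])
    show "0 \<le> ?\<psi> u" if "0 < u" for u using nn that by simp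
    show "set_integrable lborel {0<..<e} (\<lambda>u. 1 / \<kappa> u)"
      by (rule set_integrable_subset[OF \<eta>(3)]) (use e in auto)
    fix u assume u: "u \<in> {0<..<e}"
    have k: "0 < \<kappa> u" using b(1)[of u] u e by auto
    have sub: "{0<..\<zeta> * u} \<subseteq> {0<..<\<zeta> * \<eta>}" using \<zeta>e[OF u] \<zeta>\<eta> by auto
    have \<gamma>i: "set_integrable lborel A ?\<gamma>" if "A \<subseteq> {0<..\<zeta> * u}" "A \<in> sets lborel" for A
      by (rule set_integrable_subset[OF \<eta>(4)]) (use sub that in auto)
    have gp: "0 < g v" if "v \<in> {0<..\<zeta> * u}" for v using \<eta>(5) sub that by blast
    have range: "{0<..\<zeta> * u} \<subseteq> {0<..<\<eta>'}" using \<zeta>e[OF u] e' by auto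
    have un: "{0<..\<zeta> * u} = {0<..u} \<union> {u<..\<zeta> * u}"
      using u less_imp_le[OF \<zeta>e(2)[OF u]] by (intro ivl_disj_un_two(6)[symmetric]) auto
    have range': "v \<in> {0<..<\<eta>'}" if "v \<in> {0<..u} \<union> {u<..\<zeta> * u}" for v
      using that range unfolding un[symmetric] by (rule rev_subsetD)
    let ?J = "LBINT v:{u<..\<zeta> * u}. ?\<gamma> v"
    have low: "(\<zeta> - 1) * u * ?\<gamma> u \<le> ?J"
    proof -
      have "(LBINT v:{u<..\<zeta> * u}. ?\<gamma> u) \<le> ?J"
      proof (rule set_integral_mono)
        show "set_integrable lborel {u<..\<zeta> * u} (\<lambda>v. ?\<gamma> u)"
          using \<zeta>e[OF u] by (simp add: set_integrable_def)
        show "set_integrable lborel {u<..\<zeta> * u} ?\<gamma>" using u by (intro \<gamma>i) auto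
        fix v assume "v \<in> {u<..\<zeta> * u}"
        then show "?\<gamma> u \<le> ?\<gamma> v"
          using u by (intro mono_onD[OF m1] range') auto
      qed
      moreover have "(LBINT v:{u<..\<zeta> * u}. ?\<gamma> u) = (\<zeta> - 1) * u * ?\<gamma> u"
        using \<zeta>e[OF u] by (simp add: set_lebesgue_integral_def algebra_simps)
      ultimately show ?thesis by metis
    qed
    have up: "cumulative ?\<gamma> u \<le> u * ?\<gamma> u"
    proof -
      have "cumulative ?\<gamma> u \<le> (LBINT v:{0<..u}. ?\<gamma> u)"
        unfolding cumulative_def
      proof (rule set_integral_mono)
        show "set_integrable lborel {0<..u} (\<lambda>v. ?\<gamma> u)"
          using u by (simp add: set_integrable_def)
        show "set_integrable lborel {0<..u} ?\<gamma>" using un by (intro \<gamma>i) auto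
        fix v assume "v \<in> {0<..u}"
        then show "?\<gamma> v \<le> ?\<gamma> u"
          using u by (intro mono_onD[OF m1] range') auto
      qed
      moreover have "(LBINT v:{0<..u}. ?\<gamma> u) = u * ?\<gamma> u"
        using u by (simp add: set_lebesgue_integral_def)
      ultimately show ?thesis by metis
    qed
    have split: "cumulative ?\<gamma> (\<zeta> * u) = cumulative ?\<gamma> u + ?J"
      unfolding cumulative_def un using un u
      by (intro set_integral_Un \<gamma>i) auto
    have \<Gamma>: "cumulative ?\<gamma> (\<zeta> * u) \<le> ?c * ?J"
    proof -
      define J where "J = ?J"
      have "(\<zeta> - 1) * cumulative ?\<gamma> u \<le> (\<zeta> - 1) * (u * ?\<gamma> u)"
        using up \<zeta> by (intro mult_left_mono) auto
      also have "\<dots> \<le> J" using low by (simp only: J_def mult.assoc)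
      finally have "cumulative ?\<gamma> u \<le> J / (\<zeta> - 1)"
        using \<zeta> by (simp only: pos_le_divide_eq diff_gt_0_iff_gt mult.commute)
      moreover have "?c * J = J / (\<zeta> - 1) + J" using \<zeta> by (simp add: field_simps)
      ultimately show ?thesis unfolding split J_def[symmetric] by linarith
    qed
    let ?\<rho> = "h u / g u"
    have \<rho>: "0 \<le> ?\<rho>" using nn[of u] gp[of u] u less_imp_le[OF \<zeta>e(2)[OF u]] by simp
    have J\<psi>: "?\<rho> * ?J \<le> cumulative ?\<psi> (\<zeta> * u)"
    proof -
      have "?\<rho> * ?J = (LBINT v:{u<..\<zeta> * u}. ?\<rho> * ?\<gamma> v)" by simp
      also have "\<dots> \<le> (LBINT v:{u<..\<zeta> * u}. ?\<psi> v)"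
      proof (rule set_integral_mono)
        show "set_integrable lborel {u<..\<zeta> * u} (\<lambda>v. ?\<rho> * ?\<gamma> v)"
          using u by (intro set_integrable_mult_right \<gamma>i) auto
        show "set_integrable lborel {u<..\<zeta> * u} ?\<psi>"
          by (rule set_integrable_subset[OF i]) (use u in auto)
        fix v assume v: "v \<in> {u<..\<zeta> * u}"
        have "?\<rho> \<le> h v / g v" using v u by (intro mono_onD[OF m2] range') auto
        then have "?\<rho> * g v \<le> h v" using gp[of v] v u by (simp add: pos_le_divide_eq)
        then have "v powr (real d / 2) * (?\<rho> * g v) \<le> ?\<psi> v" by (rule mult_left_mono) simp
        then show "?\<rho> * ?\<gamma> v \<le> ?\<psi> v" by (simp add: ac_simps)
      qed
      also have "\<dots> \<le> cumulative ?\<psi> (\<zeta> * u)"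
        unfolding cumulative_def
        by (rule set_integral_mono_set) (use u nn cumulative_integrable[OF i] in auto)
      finally show ?thesis .
    qed
    have "?\<psi> u = ?\<rho> * ?\<gamma> u" using gp[of u] u \<zeta>e[OF u] by simp
    then have "\<kappa> u * ?\<psi> u = ?\<rho> * (\<kappa> u * ?\<gamma> u)" by simp
    also have "\<dots> \<le> ?\<rho> * (C * (?c * ?J))"
      using b(2)[of u] u e \<Gamma> \<eta>(2) \<rho> by (intro mult_left_mono order_trans[OF b(2)]) auto
    also have "\<dots> = C * ?c * (?\<rho> * ?J)" by (simp only: ac_simps)
    also have "\<dots> \<le> C * ?c * cumulative ?\<psi> (\<zeta> * u)" using J\<psi> \<eta> \<zeta> by (intro mult_left_mono) auto
    finally show "0 < \<kappa> u \<and> \<kappa> u * ?\<psi> u \<le> C * ?c * cumulative ?\<psi> (\<zeta> * u)" using k by simp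
  qed
qed

lemma ratio_integral_finite_zero_near_origin:
  assumes nn: "\<And>u. 0 < u \<Longrightarrow> 0 \<le> h u" and i: "set_integrable lborel {0<..} (\<lambda>u. u powr (real d / 2) * h u)"
    and pos: "0 < (LBINT u:{0<..}. u powr (real d / 2) * h u)"
    and \<zeta>: "1 < \<zeta>" and h: "zero_near_origin h"
  shows "(\<integral>\<^sup>+u. indicator {0<..} u * (ennreal (u powr (real d / 2) * h u)
      / ennreal (cumulative (\<lambda>u. u powr (real d / 2) * h u) (\<zeta> * u))) \<partial>lborel) < \<infinity>"
proof -
  obtain \<eta> where "0 < \<eta>" "\<And>u. u \<in> {0<..<\<eta>} \<Longrightarrow> h u = 0" using h by (auto simp: zero_near_origin_def)
  then show ?thesis
    using nn by (intro ratio_integral_finite[OF _ i pos \<zeta>, of \<eta> "\<lambda>_. 1" 0]) (auto simp: set_integrable_def)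
qed

section \<open>Linear substitutions\<close>

lemma nn_integral_lborel_translate:
  fixes t :: "'a::euclidean_space"
  assumes [measurable]: "f \<in> borel_measurable borel"
  shows "(\<integral>\<^sup>+x. f (t + x) \<partial>lborel) = (\<integral>\<^sup>+x. f x \<partial>lborel)"
  by (subst (2) lborel_distr_plus[of t, symmetric]) (simp add: nn_integral_distr)

text \<open>Uniqueness of Lebesgue measure up to a factor: both sides compute the integral of
  \<open>g (T x + y)\<close> over \<open>x\<close> and over \<open>y\<close> in the unit ball.\<close>

lemma nn_integral_linear_bijection:
  fixes T :: "'a::euclidean_space \<Rightarrow> 'b::euclidean_space"
  assumes T: "linear T" "surj T" and g [measurable]: "g \<in> borel_measurable borel"
  shows "(\<integral>\<^sup>+x. g (T x) \<partial>lborel) * emeasure lborel (ball 0 1 :: 'b set)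
    = emeasure lborel (T -` ball 0 1) * (\<integral>\<^sup>+x. g x \<partial>lborel)"
proof -
  let ?B = "ball 0 1 :: 'b set"
  have [measurable]: "T \<in> borel_measurable borel"
    using T(1) by (intro borel_measurable_continuous_onI linear_continuous_on) (simp add: linear_conv_bounded_linear)
  have shift: "(\<integral>\<^sup>+x. f (T x + y) \<partial>lborel) = (\<integral>\<^sup>+x. f (T x) \<partial>lborel)"
    if [measurable]: "f \<in> borel_measurable borel" for f :: "'b \<Rightarrow> ennreal" and y
  proof -
    obtain t where "y = T t" using T(2) by (metis surjD)
    then have "f (T x + y) = f (T (t + x))" for x using T(1) by (simp add: linear_add add.commute)
    then show ?thesis using nn_integral_lborel_translate[of "\<lambda>x. f (T x)" t] by simp
  qed
  define I where "I = (indicator ?B :: 'b \<Rightarrow> ennreal)"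
  have [measurable]: "I \<in> borel_measurable borel" unfolding I_def by (rule borel_measurable_indicator) simp
  have "(\<integral>\<^sup>+x. g (T x) \<partial>lborel) * emeasure lborel ?B = (\<integral>\<^sup>+y. (\<integral>\<^sup>+x. g (T x) \<partial>lborel) * I y \<partial>lborel)"
    unfolding I_def by (rule nn_integral_cmult_indicator[symmetric]) simp
  also have "\<dots> = (\<integral>\<^sup>+y. (\<integral>\<^sup>+x. g (T x + y) * I y \<partial>lborel) \<partial>lborel)"
    by (intro nn_integral_cong) (simp add: nn_integral_multc shift)
  also have "\<dots> = (\<integral>\<^sup>+x. (\<integral>\<^sup>+y. g (T x + y) * I y \<partial>lborel) \<partial>lborel)"
    by (rule lborel_pair.Fubini') measurable
  also have "\<dots> = (\<integral>\<^sup>+x. (\<integral>\<^sup>+y. g y * I (- T x + y) \<partial>lborel) \<partial>lborel)"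
  proof (rule nn_integral_cong)
    fix x
    show "(\<integral>\<^sup>+y. g (T x + y) * I y \<partial>lborel) = (\<integral>\<^sup>+y. g y * I (- T x + y) \<partial>lborel)"
      using nn_integral_lborel_translate[of "\<lambda>y. g y * I (- T x + y)" "T x"] by simp
  qed
  also have "\<dots> = (\<integral>\<^sup>+y. (\<integral>\<^sup>+x. g y * I (- T x + y) \<partial>lborel) \<partial>lborel)"
    by (rule lborel_pair.Fubini'[symmetric]) measurable
  also have "\<dots> = (\<integral>\<^sup>+y. g y * emeasure lborel (T -` ?B) \<partial>lborel)"
  proof (rule nn_integral_cong)
    fix y
    have "(\<integral>\<^sup>+x. g y * I (- T x + y) \<partial>lborel) = g y * (\<integral>\<^sup>+x. I (- T x + y) \<partial>lborel)"
      by (rule nn_integral_cmult) measurable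
    also have "(\<integral>\<^sup>+x. I (- T x + y) \<partial>lborel) = (\<integral>\<^sup>+x. I (T x + (- y)) \<partial>(lborel :: 'a measure))"
      by (intro nn_integral_cong) (simp add: I_def indicator_def dist_norm norm_minus_commute)
    also have "\<dots> = (\<integral>\<^sup>+x. I (T x) \<partial>lborel)" by (rule shift) measurable
    also have "\<dots> = (\<integral>\<^sup>+x. indicator (T -` ?B) x \<partial>lborel)" by (simp add: I_def indicator_def)
    also have "\<dots> = emeasure lborel (T -` ?B)"
      using measurable_sets[of T borel borel ?B] by (subst nn_integral_indicator) simp_all
    finally show "(\<integral>\<^sup>+x. g y * I (- T x + y) \<partial>lborel) = g y * emeasure lborel (T -` ?B)" .
  qed
  also have "\<dots> = emeasure lborel (T -` ?B) * (\<integral>\<^sup>+x. g x \<partial>lborel)"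
    by (simp add: nn_integral_multc mult.commute)
  finally show ?thesis .
qed

lemma nn_integral_linear_isometry:
  fixes T :: "'a::euclidean_space \<Rightarrow> 'b::euclidean_space"
  assumes T: "linear T" "surj T" "\<And>x. norm (T x) = norm x" and g: "g \<in> borel_measurable borel"
  shows "(\<integral>\<^sup>+x. g (T x) \<partial>lborel) = (\<integral>\<^sup>+x. g x \<partial>lborel)"
proof -
  have "inj T" using T(1,3) by (metis linear_injective_0 norm_eq_zero)
  then have "DIM('a) = DIM('b)"
    using T(1,2) dim_image_eq[of T UNIV] by simp
  then have e: "emeasure lborel (ball 0 1 :: 'a set) = emeasure lborel (ball 0 1 :: 'b set)"
    by (simp add: emeasure_ball)
  have v: "T -` ball 0 1 = ball 0 1" using T(3) by (auto simp: dist_norm)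
  have fin: "emeasure lborel (ball 0 1 :: 'b set) \<noteq> \<infinity>" "emeasure lborel (ball 0 1 :: 'b set) \<noteq> 0"
    by (auto simp: emeasure_ball less_imp_neq[symmetric])
  have "(\<integral>\<^sup>+x. g (T x) \<partial>lborel) * emeasure lborel (ball 0 1 :: 'b set)
      = (\<integral>\<^sup>+x. g x \<partial>lborel) * emeasure lborel (ball 0 1 :: 'b set)"
    using nn_integral_linear_bijection[OF T(1,2) g] by (simp only: v e mult.commute)
  then show ?thesis using fin unfolding mult.commute[of _ "emeasure lborel (ball 0 1 :: 'b set)"]
    by (simp only: ennreal_mult_cancel_left) simp
qed

definition jacobian :: "('a::euclidean_space \<Rightarrow> 'a) \<Rightarrow> real \<Rightarrow> bool" where
  "jacobian T c \<longleftrightarrow> 0 < c \<and> (\<forall>g\<in>borel_measurable borel.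
     (\<integral>\<^sup>+x. g x \<partial>lborel) = ennreal c * (\<integral>\<^sup>+x. g (T x) \<partial>lborel))"

lemma jacobian_nn_integral:
  "jacobian T c \<Longrightarrow> g \<in> borel_measurable borel \<Longrightarrow>
    (\<integral>\<^sup>+x. g x \<partial>lborel) = ennreal c * (\<integral>\<^sup>+x. g (T x) \<partial>lborel)"
  by (simp add: jacobian_def)

lemma jacobian_pos: "jacobian T c \<Longrightarrow> 0 < c"
  by (simp only: jacobian_def)

lemma jacobian_unique:
  fixes T :: "'a::euclidean_space \<Rightarrow> 'a"
  assumes "jacobian T c" "jacobian T c'"
  shows "c = c'"
proof -
  let ?g = "indicator (ball 0 1 :: 'a set) :: 'a \<Rightarrow> ennreal"
  let ?K = "\<integral>\<^sup>+x. ?g (T x) \<partial>lborel"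
  have m: "?g \<in> borel_measurable borel" by (rule borel_measurable_indicator) simp
  have I: "(\<integral>\<^sup>+x. ?g x \<partial>lborel) = ennreal (unit_ball_vol (DIM('a)))" by (simp add: emeasure_ball)
  have eq: "ennreal c * ?K = ennreal (unit_ball_vol (DIM('a)))" "ennreal c' * ?K = ennreal (unit_ball_vol (DIM('a)))"
    using jacobian_nn_integral[OF assms(1) m] jacobian_nn_integral[OF assms(2) m] I by auto
  have c: "0 < c" "0 < c'" by (rule jacobian_pos[OF assms(1)], rule jacobian_pos[OF assms(2)])
  have "?K \<noteq> 0" using eq(1) by (metis ennreal_eq_0_iff mult_zero_right unit_ball_vol_pos not_le of_nat_0_le_iff)
  moreover have "?K \<noteq> \<infinity>" using eq(1) c by (auto simp: ennreal_mult_top)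
  moreover have "ennreal c * ?K = ennreal c' * ?K" using eq by simp
  ultimately have "ennreal c = ennreal c'"
    unfolding mult.commute[of _ ?K] by (simp only: ennreal_mult_cancel_left) simp
  then show ?thesis using c by simp
qed

lemma jacobian_comp:
  assumes T: "jacobian T c" and U: "jacobian U e" and m: "T \<in> borel_measurable borel"
  shows "jacobian (\<lambda>x. T (U x)) (c * e)"
  unfolding jacobian_def
proof (intro conjI ballI)
  show "0 < c * e" using T U by (simp add: jacobian_def)
  fix g :: "'a \<Rightarrow> ennreal" assume g: "g \<in> borel_measurable borel"
  have "(\<integral>\<^sup>+x. g x \<partial>lborel) = ennreal c * (\<integral>\<^sup>+x. g (T x) \<partial>lborel)"
    by (rule jacobian_nn_integral[OF T g])
  also have "(\<integral>\<^sup>+x. g (T x) \<partial>lborel) = ennreal e * (\<integral>\<^sup>+x. g (T (U x)) \<partial>lborel)"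
    by (rule jacobian_nn_integral[OF U]) (use measurable_compose[OF m g] in simp)
  finally show "(\<integral>\<^sup>+x. g x \<partial>lborel) = ennreal (c * e) * (\<integral>\<^sup>+x. g (T (U x)) \<partial>lborel)"
    using T U by (simp add: jacobian_def ennreal_mult mult.assoc)
qed

lemma jacobian_exists:
  fixes T :: "'a::euclidean_space \<Rightarrow> 'a"
  assumes T: "linear T" "surj T"
  shows "\<exists>c. jacobian T c"
proof -
  let ?B = "ball 0 1 :: 'a set"
  let ?v = "unit_ball_vol (DIM('a))"
  have v: "emeasure lborel ?B = ennreal ?v" "0 < ?v" by (auto simp: emeasure_ball)
  have inj: "inj T" using T linear_surjective_imp_injective by blast
  obtain T' where T': "linear T'" "\<And>x. T' (T x) = x" "\<And>x. T (T' x) = x"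
    using linear_injective_isomorphism[OF T(1) inj] by blast
  have "T -` ?B = T' ` ?B"
  proof safe
    fix x assume "T x \<in> ?B"
    then show "x \<in> T' ` ?B" using T'(2)[of x] by (metis image_eqI)
  qed (simp add: T'(3))
  moreover have "bounded (T' ` ?B)"
    using T'(1) by (intro bounded_linear_image) (auto simp: linear_conv_bounded_linear)
  ultimately have bd: "bounded (T -` ?B)" by simp
  have cont: "continuous_on UNIV T" using T(1) by (intro linear_continuous_on) (simp add: linear_conv_bounded_linear)
  have op: "open (T -` ?B)" using cont by (intro open_vimage) auto
  obtain r where r: "emeasure lborel (T -` ?B) = ennreal r" "0 \<le> r"
    using emeasure_bounded_finite[OF bd] by (cases "emeasure lborel (T -` ?B)") auto
  have "T 0 = 0" using T(1) by (rule linear_0)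
  then have "0 \<in> T -` ?B" by simp
  then obtain e where e: "0 < e" "ball 0 e \<subseteq> T -` ?B" using op unfolding open_contains_ball by blast
  have "0 < emeasure lborel (ball (0::'a) e)" using e(1) by (simp add: emeasure_ball)
  also have "\<dots> \<le> emeasure lborel (T -` ?B)" using e(2) op by (intro emeasure_mono) auto
  finally have "emeasure lborel (T -` ?B) \<noteq> 0" by simp
  then have r0: "0 < r" using r by (cases "r = 0") auto
  have "jacobian T (?v / r)"
    unfolding jacobian_def
  proof (intro conjI ballI)
    show "0 < ?v / r" using v r0 by simp
    fix g :: "'a \<Rightarrow> ennreal" assume "g \<in> borel_measurable borel"
    from nn_integral_linear_bijection[OF T this]
    have "ennreal (1 / r) * ((\<integral>\<^sup>+x. g (T x) \<partial>lborel) * ennreal ?v) = ennreal (1 / r) * (ennreal r * (\<integral>\<^sup>+x. g x \<partial>lborel))"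
      by (simp add: v r)
    also have "\<dots> = (\<integral>\<^sup>+x. g x \<partial>lborel)"
      using r0 by (simp add: mult.assoc[symmetric] ennreal_mult[symmetric])
    also have "ennreal (1 / r) * ((\<integral>\<^sup>+x. g (T x) \<partial>lborel) * ennreal ?v) = ennreal (?v / r) * (\<integral>\<^sup>+x. g (T x) \<partial>lborel)"
    proof -
      have "ennreal (?v / r) = ennreal (1 / r) * ennreal ?v"
        using r0 v by (simp add: ennreal_mult[symmetric])
      then show ?thesis by (simp only: ac_simps)
    qed
    finally show "(\<integral>\<^sup>+x. g x \<partial>lborel) = ennreal (?v / r) * (\<integral>\<^sup>+x. g (T x) \<partial>lborel)" by simp
  qed
  then show ?thesis ..
qed

lemma jacobian_isometry:
  fixes T :: "'a::euclidean_space \<Rightarrow> 'a"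
  assumes "linear T" "surj T" "\<And>x. norm (T x) = norm x"
  shows "jacobian T 1"
  using nn_integral_linear_isometry[OF assms] by (simp add: jacobian_def)

lemma linear_matrix_mult_left: "linear (\<lambda>x :: real^'d^'p. A ** x)" for A :: "real^'p^'q"
  by (rule linearI)
     (auto simp: vec_eq_iff matrix_matrix_mult_def sum_distrib_left distrib_left sum.distrib intro!: sum.cong)

lemma surj_matrix_mult_left:
  fixes A :: "real^'p^'p"
  assumes "invertible A"
  shows "surj (\<lambda>x :: real^'d^'p. A ** x)"
proof -
  obtain B where "A ** B = mat 1" using assms by (auto simp: invertible_def)
  then have "A ** (B ** x) = x" for x :: "real^'d^'p" by (simp add: matrix_mul_assoc)
  then show ?thesis by (rule surjI)
qed

lemma measurable_matrix_mult_left [measurable]: "(\<lambda>x :: real^'d^'p. A ** x) \<in> borel_measurable borel" for A :: "real^'p^'q"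
  by (intro borel_measurable_continuous_onI linear_continuous_on)
     (use linear_matrix_mult_left[of A] in \<open>simp add: linear_conv_bounded_linear\<close>)

lemma jacobian_diagonal:
  fixes A :: "real^'p^'p"
  assumes A: "\<And>i j. i \<noteq> j \<Longrightarrow> A$i$j = 0" and inv: "invertible A"
  shows "jacobian (\<lambda>x :: real^'d^'p. A ** x) (\<bar>det A\<bar> ^ CARD('d))"
proof -
  have det: "det A = (\<Prod>i\<in>UNIV. A$i$i)" using A by (rule det_diagonal)
  have nz: "A$i$i \<noteq> 0" for i using inv unfolding invertible_det_nz det by simp
  have comp: "(A ** x) $ i $ k = A$i$i * x$i$k" for x :: "real^'d^'p" and i k
  proof -
    have "(A ** x) $ i $ k = (\<Sum>j\<in>UNIV. A$i$j * x$j$k)" by (simp add: matrix_matrix_mult_def)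
    also have "\<dots> = (\<Sum>j\<in>UNIV. if j = i then A$i$i * x$i$k else 0)"
      by (rule sum.cong) (use A in auto)
    finally have "(A ** x) $ i $ k = (\<Sum>j\<in>UNIV. if j = i then A$i$i * x$i$k else 0)" .
    then show ?thesis by simp
  qed
  let ?c = "\<lambda>b :: real^'d^'p. (A ** b) \<bullet> b"
  have c: "?c (axis i (axis k 1)) = A$i$i" for i :: 'p and k :: 'd
    by (simp add: inner_axis comp)
  have B: "(Basis :: (real^'d^'p) set) = (\<lambda>(i, k). axis i (axis k 1)) ` UNIV"
    by (auto simp: Basis_vec_def)
  have inj: "inj (\<lambda>(i :: 'p, k :: 'd). axis i (axis k (1::real)))"
    by (auto simp: inj_on_def axis_eq_axis)
  have prod: "(\<Prod>b\<in>Basis. \<bar>?c b\<bar>) = \<bar>det A\<bar> ^ CARD('d)"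
  proof -
    have "(\<Prod>b\<in>Basis. \<bar>?c b\<bar>) = (\<Prod>(i, k)\<in>UNIV \<times> (UNIV :: 'd set). \<bar>A$i$i\<bar>)"
      unfolding B prod.reindex[OF inj] by (intro prod.cong) (auto simp: c)
    also have "\<dots> = (\<Prod>i\<in>UNIV. \<Prod>k\<in>(UNIV :: 'd set). \<bar>A$i$i\<bar>)"
      by (rule prod.cartesian_product[symmetric])
    also have "\<dots> = \<bar>det A\<bar> ^ CARD('d)" by (simp add: det abs_prod prod_power_distrib)
    finally show ?thesis .
  qed
  have T: "(\<Sum>j\<in>Basis. (?c j * (x \<bullet> j)) *\<^sub>R j) = A ** x" for x :: "real^'d^'p"
  proof (rule euclidean_eqI)
    fix b :: "real^'d^'p" assume b: "b \<in> Basis"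
    then obtain i k where b': "b = axis i (axis k 1)" unfolding B by auto
    have "(\<Sum>j\<in>Basis. (?c j * (x \<bullet> j)) *\<^sub>R j) \<bullet> b = ?c b * (x \<bullet> b)"
      by (rule inner_sum_left_Basis[OF b])
    also have "\<dots> = (A ** x) \<bullet> b" unfolding b' c by (simp add: inner_axis comp)
    finally show "(\<Sum>j\<in>Basis. (?c j * (x \<bullet> j)) *\<^sub>R j) \<bullet> b = (A ** x) \<bullet> b" .
  qed
  have nz': "?c j \<noteq> 0" if "j \<in> Basis" for j using that nz unfolding B by (auto simp: c)
  have L: "lborel = density (distr lborel borel (\<lambda>x :: real^'d^'p. A ** x)) (\<lambda>_. ennreal (\<bar>det A\<bar> ^ CARD('d)))"
    using lborel_affine_euclidean[of ?c 0] nz' by (simp add: T prod)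
  show ?thesis
    unfolding jacobian_def
  proof (intro conjI ballI)
    show "0 < \<bar>det A\<bar> ^ CARD('d)" using inv by (simp add: invertible_det_nz)
    fix g :: "real^'d^'p \<Rightarrow> ennreal" assume [measurable]: "g \<in> borel_measurable borel"
    show "(\<integral>\<^sup>+x. g x \<partial>lborel) = ennreal (\<bar>det A\<bar> ^ CARD('d)) * (\<integral>\<^sup>+x. g (A ** x) \<partial>lborel)"
      by (subst (1) L) (simp add: nn_integral_density nn_integral_distr nn_integral_cmult)
  qed
qed

lemma norm_matrix_permute_rows:
  fixes x :: "real^'d^'p"
  assumes "p permutes UNIV"
  shows "norm (\<chi> i. x $ p i) = norm x"
proof -
  have "(\<Sum>i\<in>UNIV. (norm (x $ p i))\<^sup>2) = (\<Sum>i\<in>UNIV. (norm (x $ i))\<^sup>2)"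
    using assms by (intro sum.reindex_bij_betw) (simp add: permutes_imp_bij)
  then show ?thesis by (simp add: norm_vec_def L2_set_def)
qed

lemma jacobian_matrix_mult_left:
  fixes A :: "real^'p^'p"
  assumes "invertible A"
  shows "jacobian (\<lambda>x :: real^'d^'p. A ** x) (\<bar>det A\<bar> ^ CARD('d))"
proof -
  let ?P = "\<lambda>A :: real^'p^'p. invertible A \<longrightarrow> jacobian (\<lambda>x :: real^'d^'p. A ** x) (\<bar>det A\<bar> ^ CARD('d))"
  have "?P A"
  proof (rule induct_matrix_elementary_alt[where P="?P"])
    fix A B :: "real^'p^'p" assume IH: "?P A" "?P B"
    show "?P (A ** B)"
    proof
      assume "invertible (A ** B)"
      then have "invertible A" "invertible B" by (auto simp: invertible_det_nz det_mul)
      then have "jacobian (\<lambda>x :: real^'d^'p. A ** (B ** x)) (\<bar>det A\<bar> ^ CARD('d) * \<bar>det B\<bar> ^ CARD('d))"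
        using IH by (intro jacobian_comp) auto
      then show "jacobian (\<lambda>x :: real^'d^'p. A ** B ** x) (\<bar>det (A ** B)\<bar> ^ CARD('d))"
        by (simp add: matrix_mul_assoc det_mul abs_mult power_mult_distrib)
    qed
  next
    fix A :: "real^'p^'p" and i assume "row i A = 0"
    then have "det A = 0" by (rule det_zero_row)
    then show "?P A" by (simp add: invertible_det_nz)
  next
    fix A :: "real^'p^'p" assume "\<And>i j. i \<noteq> j \<Longrightarrow> A $ i $ j = 0"
    then show "?P A" using jacobian_diagonal by blast
  next
    fix m n :: 'p assume "m \<noteq> n"
    let ?t = "Transposition.transpose m n"
    let ?S = "(\<chi> i j. mat 1 $ i $ ?t j) :: real^'p^'p"
    have p: "?t permutes UNIV" by (simp add: permutes_swap_id)
    have "det ?S = of_int (sign ?t)" using det_permute_columns[OF p, of "mat 1"] by simp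
    then have det: "\<bar>det ?S\<bar> = 1" by (simp add: sign_def)
    have S: "?S ** x = (\<chi> i. x $ ?t i)" for x :: "real^'d^'p"
    proof -
      have "(?S ** x) $ i $ k = x $ ?t i $ k" for i k
      proof -
        have "(?S ** x) $ i $ k = (\<Sum>j\<in>UNIV. if j = ?t i then x $ j $ k else 0)"
          unfolding matrix_matrix_mult_def vec_lambda_beta
          by (rule sum.cong) (auto simp: mat_def Transposition.transpose_def)
        then show ?thesis by simp
      qed
      then show ?thesis by (simp add: vec_eq_iff)
    qed
    show "?P ?S"
    proof
      assume "invertible ?S"
      then have "jacobian (\<lambda>x :: real^'d^'p. ?S ** x) 1"
        by (intro jacobian_isometry[OF linear_matrix_mult_left surj_matrix_mult_left])
           (assumption, simp only: S norm_matrix_permute_rows[OF p])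
      then show "jacobian (\<lambda>x :: real^'d^'p. ?S ** x) (\<bar>det ?S\<bar> ^ CARD('d))" by (simp only: det power_one)
    qed
  next
    fix m n :: 'p assume mn: "m \<noteq> n"
    let ?S = "(\<chi> i j. of_bool (i = m \<and> j = n \<or> i = j)) :: real^'p^'p"
    have "?S = (\<chi> k. if k = m then row m (mat 1) + 1 *s row n (mat 1) else row k (mat 1))"
      using mn by (auto simp: vec_eq_iff row_def mat_def)
    then have det: "det ?S = 1" using det_row_operation[OF mn, of "mat 1" 1] by simp
    then have inv: "invertible ?S" by (simp add: invertible_det_nz)
    \<comment> \<open>The shear \<open>S\<close> is conjugate to its own square by a diagonal matrix, so its factor is 1.\<close>
    let ?D = "(\<chi> i j. if i = j then (if i = m then 2 else 1) else 0) :: real^'p^'p"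
    have "det ?D = (\<Prod>i\<in>UNIV. if i = m then 2 else 1)" by (subst det_diagonal) auto
    then have invD: "invertible ?D" by (simp add: invertible_det_nz)
    have DS: "(?D ** ?S) $ i $ j = (if i = m then 2 else 1) * ?S $ i $ j" for i j
    proof -
      have "(?D ** ?S) $ i $ j = (\<Sum>k\<in>UNIV. if k = i then (if i = m then 2 else 1) * ?S $ i $ j else 0)"
        unfolding matrix_matrix_mult_def vec_lambda_beta by (rule sum.cong) auto
      then show ?thesis by simp
    qed
    have SM: "(?S ** B) $ i $ j = B $ i $ j + (if i = m then B $ n $ j else 0)" for B :: "real^'p^'p" and i j
    proof -
      have "(?S ** B) $ i $ j = (\<Sum>k\<in>UNIV. (if k = i then B $ i $ j else 0) + (if k = n then (if i = m then B $ n $ j else 0) else 0))"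
        unfolding matrix_matrix_mult_def vec_lambda_beta using mn by (intro sum.cong) auto
      then show ?thesis by (simp add: sum.distrib)
    qed
    have eq: "?D ** ?S = ?S ** (?S ** ?D)"
      unfolding vec_eq_iff by (intro allI, unfold DS SM) (use mn in auto)
    obtain s where s: "jacobian (\<lambda>x :: real^'d^'p. ?S ** x) s"
      using jacobian_exists[OF linear_matrix_mult_left surj_matrix_mult_left[OF inv]] by blast
    obtain d where d: "jacobian (\<lambda>x :: real^'d^'p. ?D ** x) d"
      using jacobian_exists[OF linear_matrix_mult_left surj_matrix_mult_left[OF invD]] by blast
    have j1: "jacobian (\<lambda>x :: real^'d^'p. ?D ** (?S ** x)) (d * s)"
      by (intro jacobian_comp d s measurable_matrix_mult_left)
    have j2: "jacobian (\<lambda>x :: real^'d^'p. ?S ** (?S ** (?D ** x))) (s * (s * d))"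
      by (intro jacobian_comp[where T="\<lambda>x. ?S ** x"] jacobian_comp[where T="\<lambda>x. ?S ** x" and U="\<lambda>x. ?D ** x"]
          d s measurable_matrix_mult_left)
    have eqf: "(\<lambda>x :: real^'d^'p. ?D ** (?S ** x)) = (\<lambda>x. ?S ** (?S ** (?D ** x)))"
      using eq by (simp only: matrix_mul_assoc)
    have "d * s = s * (s * d)" by (rule jacobian_unique[OF j1[unfolded eqf] j2])
    moreover have "0 < s" "0 < d" by (rule jacobian_pos[OF s], rule jacobian_pos[OF d])
    ultimately have "s = 1" by simp
    then show "?P ?S" using s by (simp only: det abs_one power_one simp_thms)
  qed
  then show ?thesis using assms by simp
qed

lemma transpose_linear: "linear (transpose :: real^'n^'m \<Rightarrow> real^'m^'n)"
  by (rule linearI) (auto simp: transpose_def vec_eq_iff)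

lemma norm_transpose: "norm (transpose x) = norm (x :: real^'n^'m)"
proof -
  have "transpose x \<bullet> transpose x = x \<bullet> x"
    unfolding inner_vec_def transpose_def by (simp, subst sum.swap, simp)
  then show ?thesis by (simp add: norm_eq_sqrt_inner)
qed

lemma transpose_measurable [measurable]: "(transpose :: real^'n^'m \<Rightarrow> real^'m^'n) \<in> borel_measurable borel"
  by (intro borel_measurable_continuous_onI linear_continuous_on)
     (use transpose_linear in \<open>simp add: linear_conv_bounded_linear\<close>)

lemma nn_integral_transpose:
  assumes "g \<in> borel_measurable borel"
  shows "(\<integral>\<^sup>+x. g (transpose x :: real^'m^'n) \<partial>lborel) = (\<integral>\<^sup>+x. g x \<partial>lborel)"
  by (rule nn_integral_linear_isometry[OF transpose_linear _ norm_transpose assms])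
     (rule surjI, rule transpose_transpose)

lemma nn_integral_matrix_mult:
  fixes g :: "real^'d^'p \<Rightarrow> ennreal"
  assumes [measurable]: "g \<in> borel_measurable borel" and V: "invertible V" and U: "invertible U"
  shows "(\<integral>\<^sup>+x. g x \<partial>lborel)
    = ennreal (\<bar>det V\<bar> ^ CARD('d) * \<bar>det U\<bar> ^ CARD('p)) * (\<integral>\<^sup>+x. g (V ** x ** U) \<partial>lborel)"
proof -
  have mV: "(\<lambda>x. g (V ** x)) \<in> borel_measurable borel" by measurable
  have "(\<integral>\<^sup>+x. g x \<partial>lborel) = ennreal (\<bar>det V\<bar> ^ CARD('d)) * (\<integral>\<^sup>+x. g (V ** x) \<partial>lborel)"
    by (rule jacobian_nn_integral[OF jacobian_matrix_mult_left[OF V]]) measurable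
  also have "(\<integral>\<^sup>+x. g (V ** x) \<partial>lborel) = (\<integral>\<^sup>+x. g (V ** transpose x) \<partial>lborel)"
    by (rule nn_integral_transpose[OF mV, symmetric])
  also have "\<dots> = ennreal (\<bar>det (transpose U)\<bar> ^ CARD('p)) * (\<integral>\<^sup>+x. g (V ** transpose (transpose U ** x)) \<partial>lborel)"
    by (rule jacobian_nn_integral[OF jacobian_matrix_mult_left])
       (use U in \<open>auto simp: invertible_det_nz\<close>)
  also have "(\<integral>\<^sup>+x. g (V ** transpose (transpose U ** x)) \<partial>lborel) = (\<integral>\<^sup>+x. g (V ** transpose x ** U) \<partial>lborel)"
    by (simp add: matrix_transpose_mul transpose_transpose matrix_mul_assoc)
  also have "\<dots> = (\<integral>\<^sup>+x. g (V ** x ** U) \<partial>lborel)"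
  proof (rule nn_integral_transpose)
    have "V ** x ** U = transpose (transpose U ** transpose (V ** x))" for x :: "real^'d^'p"
      by (simp add: matrix_transpose_mul transpose_transpose)
    then show "(\<lambda>x. g (V ** x ** U)) \<in> borel_measurable borel" by simp
  qed
  finally show ?thesis by (simp add: ennreal_mult mult.assoc)
qed

section \<open>Gaussian integrals over matrices\<close>

lemma nn_integral_gaussian_real:
  "(\<integral>\<^sup>+x. ennreal (exp (- x\<^sup>2 / 2)) \<partial>lborel) = ennreal (sqrt (2 * pi))"
proof -
  interpret prob_space "density lborel (normal_density 0 1)"
    by (rule prob_space_normal_density) simp
  have "1 = (\<integral>\<^sup>+x. ennreal (normal_density 0 1 x) \<partial>lborel)"
    using emeasure_space_1 by (simp add: emeasure_density)
  also have "\<dots> = (\<integral>\<^sup>+x. ennreal (1 / sqrt (2 * pi)) * ennreal (exp (- x\<^sup>2 / 2)) \<partial>lborel)"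
    by (simp add: normal_density_def ennreal_mult[symmetric])
  also have "\<dots> = ennreal (1 / sqrt (2 * pi)) * (\<integral>\<^sup>+x. ennreal (exp (- x\<^sup>2 / 2)) \<partial>lborel)"
    by (rule nn_integral_cmult) measurable
  finally have "ennreal (sqrt (2 * pi)) * 1 = ennreal (sqrt (2 * pi)) * (ennreal (1 / sqrt (2 * pi)) * (\<integral>\<^sup>+x. ennreal (exp (- x\<^sup>2 / 2)) \<partial>lborel))"
    by simp
  also have "\<dots> = (\<integral>\<^sup>+x. ennreal (exp (- x\<^sup>2 / 2)) \<partial>lborel)"
    unfolding mult.assoc[symmetric] by (simp add: ennreal_mult[symmetric])
  finally show ?thesis by simp
qed

lemma nn_integral_gaussian:
  "(\<integral>\<^sup>+x. ennreal (exp (- (norm x)\<^sup>2 / 2)) \<partial>(lborel :: 'a::euclidean_space measure))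
    = ennreal ((2 * pi) powr (real DIM('a) / 2))"
proof -
  have "exp (- (norm x)\<^sup>2 / 2) = (\<Prod>b\<in>Basis. exp (- (x \<bullet> b)\<^sup>2 / 2))" for x :: 'a
  proof -
    have "(norm x)\<^sup>2 = (\<Sum>b\<in>Basis. (x \<bullet> b)\<^sup>2)"
      unfolding power2_norm_eq_inner by (subst euclidean_inner) (simp add: power2_eq_square)
    then have "- (norm x)\<^sup>2 / 2 = (\<Sum>b\<in>Basis. - (x \<bullet> b)\<^sup>2 / 2)"
      by (simp add: sum_negf sum_divide_distrib)
    then show ?thesis by (simp only: exp_sum[OF finite_Basis])
  qed
  then have "(\<integral>\<^sup>+x. ennreal (exp (- (norm x)\<^sup>2 / 2)) \<partial>(lborel :: 'a measure))
    = (\<integral>\<^sup>+x. (\<Prod>b\<in>Basis. ennreal (exp (- (x \<bullet> b)\<^sup>2 / 2))) \<partial>(lborel :: 'a measure))"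
    by (simp add: prod_ennreal)
  also have "\<dots> = (\<Prod>b\<in>(Basis :: 'a set). \<integral>\<^sup>+x. ennreal (exp (- x\<^sup>2 / 2)) \<partial>lborel)"
    by (rule nn_integral_lborel_prod) auto
  also have "\<dots> = (\<Prod>b\<in>(Basis :: 'a set). ennreal (sqrt (2 * pi)))"
    by (simp only: nn_integral_gaussian_real)
  also have "\<dots> = ennreal (sqrt (2 * pi) ^ DIM('a))" by (simp add: ennreal_power)
  also have "sqrt (2 * pi) ^ DIM('a) = (2 * pi) powr (real DIM('a) / 2)"
    by (simp add: powr_half_sqrt[symmetric] powr_realpow[symmetric] powr_powr)
  finally show ?thesis .
qed

lemma invertible_matrix_inv:
  fixes A :: "real^'n^'n"
  assumes "invertible A"
  shows "A ** matrix_inv A = mat 1" "matrix_inv A ** A = mat 1"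
  using someI_ex[OF assms[unfolded invertible_def]] by (auto simp: matrix_inv_def)

lemma matrix_inv_unique:
  fixes A :: "real^'n^'n"
  assumes "A ** B = mat 1"
  shows "matrix_inv A = B"
proof -
  have "invertible A" using assms matrix_left_right_inverse[of A B] by (auto simp: invertible_def)
  then have "matrix_inv A ** (A ** B) = B" by (simp add: matrix_mul_assoc invertible_matrix_inv)
  then show ?thesis by (simp add: assms)
qed

lemma matrix_inv_matrix_inv:
  fixes A :: "real^'n^'n"
  shows "invertible A \<Longrightarrow> matrix_inv (matrix_inv A) = A"
  by (rule matrix_inv_unique) (rule invertible_matrix_inv)

lemma det_matrix_inv:
  fixes A :: "real^'n^'n"
  assumes "invertible A"
  shows "det (matrix_inv A) = 1 / det A"
proof -
  have "det A * det (matrix_inv A) = 1"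
    using invertible_matrix_inv[OF assms] by (metis det_I det_mul)
  then show ?thesis using assms by (simp add: invertible_det_nz field_simps)
qed

lemma spd_symmetric: "P \<in> spd \<Longrightarrow> transpose P = P"
  by (simp add: spd_def)

lemma spd_pos: "P \<in> spd \<Longrightarrow> v \<noteq> 0 \<Longrightarrow> 0 < v \<bullet> (P *v v)"
  by (simp add: spd_def)

lemma symmetric_form: "transpose P = P \<Longrightarrow> v \<bullet> (P *v w) = (P *v v) \<bullet> (w :: real^'n)"
  by (metis dot_lmul_matrix transpose_matrix_vector)

lemma spd_orthonormal_vectors:
  fixes P :: "real^'p^'p" and I :: "'p set"
  assumes P: "P \<in> spd"
  shows "\<exists>w :: 'p \<Rightarrow> real^'p. \<forall>i\<in>I. \<forall>j\<in>I. w i \<bullet> (P *v w j) = of_bool (i = j)"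
  using finite[of I]
proof (induction I rule: finite_induct)
  case (insert m I)
  then obtain w :: "'p \<Rightarrow> real^'p" where w: "\<And>i j. i \<in> I \<Longrightarrow> j \<in> I \<Longrightarrow> w i \<bullet> (P *v w j) = of_bool (i = j)"
    by blast
  let ?S = "(\<lambda>i. P *v w i) ` I"
  have "I \<noteq> UNIV" using insert by auto
  then have "card I < CARD('p)" by (metis card_seteq finite not_le subset_UNIV)
  moreover have "dim ?S \<le> card I"
    using dim_le_card'[of ?S] card_image_le[of I "\<lambda>i. P *v w i"] by (simp add: insert)
  ultimately have "dim ?S < DIM(real^'p)" by simp
  then obtain v where v: "v \<noteq> 0" "\<And>y. y \<in> span ?S \<Longrightarrow> orthogonal v y"
    using orthogonal_to_subspace_exists by blast
  have vw: "v \<bullet> (P *v w i) = 0" "w i \<bullet> (P *v v) = 0" if "i \<in> I" for i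
  proof -
    show "v \<bullet> (P *v w i) = 0" using v(2)[of "P *v w i"] that by (simp add: orthogonal_def span_base)
    then show "w i \<bullet> (P *v v) = 0"
      using symmetric_form[OF spd_symmetric[OF P], of "w i" v] by (simp add: inner_commute)
  qed
  let ?n = "v \<bullet> (P *v v)"
  have n: "0 < ?n" using spd_pos[OF P v(1)] .
  let ?u = "(1 / sqrt ?n) *\<^sub>R v"
  have u: "P *v ?u = (1 / sqrt ?n) *\<^sub>R (P *v v)" by (simp add: matrix_vector_mult_scaleR)
  have uu: "?u \<bullet> (P *v ?u) = 1"
    unfolding u using n by (simp add: power2_eq_square[symmetric] real_sqrt_pow2)
  show ?case
  proof (rule exI[of _ "w(m := ?u)"], intro ballI)
    fix i j assume "i \<in> insert m I" "j \<in> insert m I"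
    then consider "i = m" "j = m" | "i = m" "j \<in> I" "j \<noteq> m" | "i \<in> I" "i \<noteq> m" "j = m" | "i \<in> I" "j \<in> I" "i \<noteq> m" "j \<noteq> m"
      using insert by auto
    then show "(w(m := ?u)) i \<bullet> (P *v (w(m := ?u)) j) = of_bool (i = j)"
    proof cases
      case 1
      then show ?thesis by (simp only: fun_upd_same uu refl of_bool_eq)
    next
      case 2
      then show ?thesis by (simp add: vw)
    next
      case 3
      then show ?thesis by (simp add: u vw)
    next
      case 4
      then show ?thesis by (simp add: w)
    qed
  qed
qed simp

lemma spd_factorization:
  fixes P :: "real^'p^'p"
  assumes P: "P \<in> spd"
  obtains V :: "real^'p^'p" where "invertible V" "P = transpose V ** V"
proof -
  obtain w :: "'p \<Rightarrow> real^'p" where w: "\<And>i j. w i \<bullet> (P *v w j) = of_bool (i = j)"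
    using spd_orthonormal_vectors[OF P, of UNIV] by auto
  define R :: "real^'p^'p" where "R = (\<chi> i. w i)"
  have RPR: "R ** (P ** transpose R) = mat 1"
  proof -
    have "(R ** (P ** transpose R)) $ i $ j = w i \<bullet> (P *v w j)" for i j
      by (simp add: R_def matrix_matrix_mult_def matrix_vector_mult_def transpose_def inner_vec_def)
    then show ?thesis by (simp add: vec_eq_iff mat_def w)
  qed
  then have "(P ** transpose R) ** R = mat 1" using matrix_left_right_inverse by blast
  have R: "invertible R" using RPR matrix_left_right_inverse[of R] unfolding invertible_def by blast
  let ?Q = "matrix_inv R"
  have "P = (?Q ** R) ** P ** (transpose R ** transpose ?Q)"
    using invertible_matrix_inv[OF R] by (simp add: matrix_transpose_mul[symmetric])
  also have "\<dots> = ?Q ** (R ** (P ** transpose R)) ** transpose ?Q" by (simp add: matrix_mul_assoc)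
  also have "\<dots> = transpose (transpose ?Q) ** transpose ?Q" by (simp add: RPR)
  finally have "P = transpose (transpose ?Q) ** transpose ?Q" .
  moreover have "det R \<noteq> 0" using R by (simp add: invertible_det_nz)
  then have "invertible (transpose ?Q)" by (simp add: invertible_det_nz det_matrix_inv[OF R])
  ultimately show ?thesis using that by blast
qed

lemma spd_det_pos:
  fixes P :: "real^'p^'p"
  assumes "P \<in> spd"
  shows "0 < det P"
proof -
  obtain V :: "real^'p^'p" where V: "invertible V" "P = transpose V ** V" using spd_factorization[OF assms] by blast
  have "det P = (det V)\<^sup>2" unfolding V(2) by (simp only: det_mul det_transpose power2_eq_square)
  moreover have "det V \<noteq> 0" using V(1) by (simp only: invertible_det_nz not_False_eq_True)
  ultimately show ?thesis by simp
qed

lemma spd_invertible: "P \<in> spd \<Longrightarrow> invertible P"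
  using spd_det_pos[of P] by (simp add: invertible_det_nz)

lemma spd_matrix_inv:
  fixes P :: "real^'p^'p"
  assumes P: "P \<in> spd"
  shows "matrix_inv P \<in> spd"
proof -
  note inv = invertible_matrix_inv[OF spd_invertible[OF P]]
  have "transpose P ** transpose (matrix_inv P) = mat 1"
    by (simp add: matrix_transpose_mul[symmetric] inv transpose_mat)
  then have sym: "transpose (matrix_inv P) = matrix_inv P"
    using matrix_inv_unique[of P "transpose (matrix_inv P)"] by (simp add: spd_symmetric[OF P])
  have "0 < v \<bullet> (matrix_inv P *v v)" if "v \<noteq> 0" for v
  proof -
    let ?w = "matrix_inv P *v v"
    have Pw: "P *v ?w = v" by (simp add: matrix_vector_mul_assoc inv)
    then have "?w \<noteq> 0" using that by auto
    from spd_pos[OF P this] show ?thesis by (simp add: Pw inner_commute)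
  qed
  then show ?thesis using sym by (simp add: spd_def)
qed

lemma trace_cyclic: "trace (A ** B) = trace (B ** (A :: real^'n^'m))"
  unfolding trace_def matrix_matrix_mult_def by (simp, subst sum.swap, simp add: mult.commute)

lemma trace_transpose_mult: "trace (A ** transpose A) = (norm (A :: real^'n^'m))\<^sup>2"
  by (simp add: trace_def matrix_matrix_mult_def transpose_def power2_norm_eq_inner inner_vec_def)

lemma ennreal_mult_eq_imp_eq_divide:
  assumes "ennreal c = ennreal J * I" "0 < J" "0 \<le> c"
  shows "I = ennreal (c * (1 / J))"
proof -
  have "I = (ennreal (1 / J) * ennreal J) * I" using assms(2) by (simp add: ennreal_mult[symmetric])
  also have "\<dots> = ennreal (1 / J) * ennreal c" unfolding assms(1) by (simp only: mult.assoc)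
  also have "\<dots> = ennreal (1 / J * c)" using assms(2,3) by (intro ennreal_mult[symmetric]) auto
  finally show ?thesis by (simp only: mult.commute)
qed

lemma nn_integral_matrix_gaussian:
  fixes P :: "real^'p^'p" and G :: "real^'d^'d" and \<mu> :: "real^'d^'p"
  assumes P: "P \<in> spd" and G: "G \<in> spd"
  shows "(\<integral>\<^sup>+\<beta>. ennreal (exp (- (1/2) * trace (P ** (\<beta> - \<mu>) ** G ** transpose (\<beta> - \<mu>)))) \<partial>lborel)
    = ennreal ((2 * pi) powr (real CARD('p) * real CARD('d) / 2)
        * det P powr (- (real CARD('d) / 2)) * det G powr (- (real CARD('p) / 2)))"
proof -
  obtain V :: "real^'p^'p" where V: "invertible V" "P = transpose V ** V" using spd_factorization[OF P] by blast
  obtain W :: "real^'d^'d" where W: "invertible W" "G = transpose W ** W" using spd_factorization[OF G] by blast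
  let ?U = "transpose W"
  have U: "invertible ?U" using W(1) by (simp add: invertible_det_nz)
  let ?g = "\<lambda>x :: real^'d^'p. ennreal (exp (- (norm x)\<^sup>2 / 2))"
  have tr: "trace (P ** x ** G ** transpose x) = (norm (V ** x ** ?U))\<^sup>2" for x :: "real^'d^'p"
  proof -
    have "trace (P ** x ** G ** transpose x) = trace (transpose V ** (V ** x ** ?U ** W ** transpose x))"
      by (simp add: V(2) W(2) matrix_mul_assoc)
    also have "\<dots> = trace ((V ** x ** ?U ** W ** transpose x) ** transpose V)" by (rule trace_cyclic)
    also have "\<dots> = trace ((V ** x ** ?U) ** transpose (V ** x ** ?U))"
      by (simp add: matrix_transpose_mul transpose_transpose matrix_mul_assoc)
    finally show ?thesis by (simp add: trace_transpose_mult)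
  qed
  let ?f = "\<lambda>x. ennreal (exp (- (1/2) * trace (P ** x ** G ** transpose x)))"
  have f: "?f x = ?g (V ** x ** ?U)" for x by (simp add: tr)
  have fm: "?f \<in> borel_measurable borel"
  proof -
    have "V ** x ** ?U = transpose (W ** transpose (V ** x))" for x :: "real^'d^'p"
      by (simp add: matrix_transpose_mul transpose_transpose)
    then show ?thesis unfolding f by simp
  qed
  have "(\<integral>\<^sup>+\<beta>. ?f (\<beta> - \<mu>) \<partial>lborel) = (\<integral>\<^sup>+\<beta>. ?f (\<mu> + \<beta> - \<mu>) \<partial>lborel)"
    by (rule nn_integral_lborel_translate[symmetric], rule measurable_compose[OF _ fm]) simp
  also have "\<dots> = (\<integral>\<^sup>+x. ?g (V ** x ** ?U) \<partial>lborel)" unfolding f by simp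
  finally have I: "(\<integral>\<^sup>+\<beta>. ?f (\<beta> - \<mu>) \<partial>lborel) = (\<integral>\<^sup>+x. ?g (V ** x ** ?U) \<partial>lborel)" .
  let ?J = "\<bar>det V\<bar> ^ CARD('d) * \<bar>det ?U\<bar> ^ CARD('p)"
  have J: "0 < ?J" using V(1) U by (simp add: invertible_det_nz)
  have "ennreal ((2 * pi) powr (real CARD('p) * real CARD('d) / 2)) = ennreal ?J * (\<integral>\<^sup>+x. ?g (V ** x ** ?U) \<partial>lborel)"
    using nn_integral_gaussian[where ?'a="real^'d^'p"] nn_integral_matrix_mult[OF _ V(1) U, of ?g] by simp
  then have "(\<integral>\<^sup>+x. ?g (V ** x ** ?U) \<partial>lborel) = ennreal ((2 * pi) powr (real CARD('p) * real CARD('d) / 2) * (1 / ?J))"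
    by (rule ennreal_mult_eq_imp_eq_divide) (use J in auto)
  moreover have "1 / ?J = det P powr (- (real CARD('d) / 2)) * det G powr (- (real CARD('p) / 2))"
  proof -
    have pw: "\<bar>x\<bar> ^ k = (x\<^sup>2) powr (real k / 2)" if "x \<noteq> 0" for x :: real and k
    proof -
      have "x\<^sup>2 = \<bar>x\<bar> powr 2" using that by simp
      then have "(x\<^sup>2) powr (real k / 2) = \<bar>x\<bar> powr real k" by (simp only: powr_powr) simp
      also have "\<dots> = \<bar>x\<bar> ^ k" using that by (intro powr_realpow) simp
      finally show ?thesis ..
    qed
    have "det P = (det V)\<^sup>2" "det G = (det W)\<^sup>2"
      unfolding V(2) W(2) by (simp_all only: det_mul det_transpose power2_eq_square)
    moreover have "det V \<noteq> 0" "det W \<noteq> 0" using V(1) W(1) by (auto simp: invertible_det_nz)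
    ultimately show ?thesis by (simp add: pw powr_minus_divide)
  qed
  ultimately show ?thesis
    unfolding I by (simp only: mult.assoc)
qed

section \<open>Lebesgue measure on symmetric matrices\<close>

lemma entry_measurable [measurable (raw)]:
  "f \<in> borel_measurable M \<Longrightarrow> (\<lambda>x. (f x :: 'b::topological_space^'n) $ i) \<in> borel_measurable M"
  by (rule measurable_compose[of f M borel "\<lambda>x. x $ i"])
     (auto intro!: borel_measurable_continuous_onI continuous_intros)

lemma matrix_measurable_iff:
  fixes f :: "'a \<Rightarrow> real^'m^'n"
  shows "f \<in> borel_measurable M \<longleftrightarrow> (\<forall>i j. (\<lambda>x. f x $ i $ j) \<in> borel_measurable M)"
proof
  assume r: "\<forall>i j. (\<lambda>x. f x $ i $ j) \<in> borel_measurable M"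
  show "f \<in> borel_measurable M"
  proof (rule borel_measurable_euclidean_space[THEN iffD2], rule ballI)
    fix b :: "real^'m^'n" assume "b \<in> Basis"
    then obtain i j where "b = axis i (axis j 1)" by (auto simp: Basis_vec_def)
    then show "(\<lambda>x. f x \<bullet> b) \<in> borel_measurable M" using r by (simp add: inner_axis)
  qed
next
  assume [measurable]: "f \<in> borel_measurable M"
  show "\<forall>i j. (\<lambda>x. f x $ i $ j) \<in> borel_measurable M" by measurable
qed

lemma det_measurable [measurable (raw)]:
  fixes f :: "'a \<Rightarrow> real^'n^'n"
  assumes [measurable]: "f \<in> borel_measurable M"
  shows "(\<lambda>x. det (f x)) \<in> borel_measurable M"
  unfolding det_def by measurable

lemma matrix_inv_Cramer:
  fixes A :: "real^'n^'n"
  assumes "invertible A"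
  shows "matrix_inv A $ i $ j = det (\<chi> r c. if c = i then axis j 1 $ r else A $ r $ c) / det A"
proof -
  have d: "det A \<noteq> 0" using assms by (simp add: invertible_det_nz)
  have "A *v (matrix_inv A *v axis j 1) = axis j 1"
    by (simp add: matrix_vector_mul_assoc invertible_matrix_inv[OF assms])
  then have "matrix_inv A *v axis j 1 = (\<chi> k. det (\<chi> r c. if c = k then axis j 1 $ r else A $ r $ c) / det A)"
    using cramer[OF d] by blast
  then have "(matrix_inv A *v axis j 1) $ i = det (\<chi> r c. if c = i then axis j 1 $ r else A $ r $ c) / det A"
    by simp
  moreover have "(matrix_inv A *v axis j 1) $ i = matrix_inv A $ i $ j"
    by (simp add: matrix_vector_mult_basis column_def)
  ultimately show ?thesis by simp
qed

lemma matrix_inv_measurable: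
  fixes f :: "'a \<Rightarrow> real^'n^'n"
  assumes f [measurable]: "f \<in> borel_measurable M" and inv: "\<And>x. x \<in> space M \<Longrightarrow> invertible (f x)"
  shows "(\<lambda>x. matrix_inv (f x)) \<in> borel_measurable M"
  unfolding matrix_measurable_iff
proof (intro allI)
  fix i j
  have [measurable]: "(\<lambda>x. (\<chi> r c. if c = i then axis j 1 $ r else f x $ r $ c) :: real^'n^'n) \<in> borel_measurable M"
    unfolding matrix_measurable_iff by simp
  have "(\<lambda>x. det (\<chi> r c. if c = i then axis j 1 $ r else f x $ r $ c) / det (f x)) \<in> borel_measurable M"
    by measurable
  then show "(\<lambda>x. matrix_inv (f x) $ i $ j) \<in> borel_measurable M"
    by (subst measurable_cong[OF matrix_inv_Cramer[OF inv]])
qed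

lemma spd_eq_Union:
  "(spd :: (real^'d^'d) set) = {S. transpose S = S} \<inter>
    (\<Union>n. {S. \<forall>v. norm v = 1 \<longrightarrow> 1 / real (Suc n) \<le> v \<bullet> (S *v v)})"
proof (intro equalityI subsetI)
  fix S :: "real^'d^'d" assume S: "S \<in> spd"
  let ?B = "sphere 0 1 :: (real^'d) set"
  have "continuous_on ?B (\<lambda>v. v \<bullet> (S *v v))"
    by (rule continuous_on_inner[OF continuous_on_id linear_continuous_on[OF matrix_vector_mul_bounded_linear]])
  moreover have "?B \<noteq> {}"
    using vector_choose_size[of 1] by (auto simp: sphere_def dist_norm)
  ultimately obtain v where v: "v \<in> ?B" "\<And>w. w \<in> ?B \<Longrightarrow> v \<bullet> (S *v v) \<le> w \<bullet> (S *v w)"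
    using continuous_attains_inf[OF compact_sphere] by blast
  have "v \<noteq> 0" using v(1) by auto
  from spd_pos[OF S this] obtain n where "1 / real (Suc n) < v \<bullet> (S *v v)"
    using nat_approx_posE by blast
  then have "\<forall>w. norm w = 1 \<longrightarrow> 1 / real (Suc n) \<le> w \<bullet> (S *v w)"
    using v(2) by (auto simp: dist_norm intro: order_trans less_imp_le)
  then show "S \<in> {S. transpose S = S} \<inter> (\<Union>n. {S. \<forall>v. norm v = 1 \<longrightarrow> 1 / real (Suc n) \<le> v \<bullet> (S *v v)})"
    using spd_symmetric[OF S] by auto
next
  fix S :: "real^'d^'d"
  assume "S \<in> {S. transpose S = S} \<inter> (\<Union>n. {S. \<forall>v. norm v = 1 \<longrightarrow> 1 / real (Suc n) \<le> v \<bullet> (S *v v)})"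
  then obtain n where s: "transpose S = S" and n: "\<And>v. norm v = 1 \<Longrightarrow> 1 / real (Suc n) \<le> v \<bullet> (S *v v)" by auto
  have "0 < v \<bullet> (S *v v)" if "v \<noteq> 0" for v
  proof -
    let ?u = "(1 / norm v) *\<^sub>R v"
    have "norm ?u = 1" using that by simp
    from n[OF this] have "0 < ?u \<bullet> (S *v ?u)"
      by (rule less_le_trans[rotated]) simp
    also have "\<dots> = (1 / norm v)\<^sup>2 * (v \<bullet> (S *v v))"
      by (simp add: matrix_vector_mult_scaleR power2_eq_square)
    finally show ?thesis using that by (simp add: zero_less_mult_iff)
  qed
  then show "S \<in> spd" using s by (simp add: spd_def)
qed

lemma spd_borel [measurable]: "(spd :: (real^'d^'d) set) \<in> sets borel"
proof -
  have c1: "closed {S :: real^'d^'d. transpose S = S}"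
    using transpose_linear by (intro closed_Collect_eq linear_continuous_on continuous_on_id)
      (simp add: linear_conv_bounded_linear)
  have c2: "closed {S :: real^'d^'d. \<forall>v. norm v = 1 \<longrightarrow> 1 / real (Suc n) \<le> v \<bullet> (S *v v)}" for n
  proof -
    have "closed {S :: real^'d^'d. 1 / real (Suc n) \<le> v \<bullet> (S *v v)}" for v
      unfolding matrix_vector_mult_def inner_vec_def
      by (intro closed_Collect_le continuous_intros)
    then have "closed (\<Inter>v\<in>{v. norm v = 1}. {S :: real^'d^'d. 1 / real (Suc n) \<le> v \<bullet> (S *v v)})"
      by (intro closed_INT) auto
    moreover have "(\<Inter>v\<in>{v. norm v = 1}. {S :: real^'d^'d. 1 / real (Suc n) \<le> v \<bullet> (S *v v)})
      = {S. \<forall>v. norm v = 1 \<longrightarrow> 1 / real (Suc n) \<le> v \<bullet> (S *v v)}" by auto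
    ultimately show ?thesis by simp
  qed
  show ?thesis unfolding spd_eq_Union
    using c1 c2 by (intro sets.Int sets.countable_UN) (auto intro: borel_closed)
qed

abbreviation index_pairs :: "'d::finite set set" where
  "index_pairs \<equiv> {{i, j} | i j :: 'd. True}"

lemma finite_index_pairs: "finite (index_pairs :: 'd::finite set set)"
  by (rule finite_subset[of _ "Pow UNIV"]) auto

interpretation lborel_product: product_sigma_finite "\<lambda>_ :: 'd set. lborel :: real measure" ..

lemma sym_matrix_measurable [measurable]:
  "(\<lambda>w. (\<chi> i j. w {i, j}) :: real^'d^'d) \<in> borel_measurable (Pi\<^sub>M (index_pairs :: 'd set set) (\<lambda>_. lborel))"
  unfolding matrix_measurable_iff
proof (intro allI)
  fix i j :: 'd
  have "(\<lambda>w. w {i, j}) \<in> measurable (Pi\<^sub>M (index_pairs :: 'd set set) (\<lambda>_. lborel)) (lborel :: real measure)"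
    by (rule measurable_component_singleton) blast
  then show "(\<lambda>w. ((\<chi> i j. w {i, j}) :: real^'d^'d) $ i $ j) \<in> borel_measurable (Pi\<^sub>M (index_pairs :: 'd set set) (\<lambda>_. lborel))"
    by simp
qed

lemma sets_lborel_sym [simp, measurable_cong]: "sets lborel_sym = sets borel"
  by (simp add: lborel_sym_def)

lemma space_lborel_sym [simp]: "space lborel_sym = UNIV"
  by (simp add: lborel_sym_def)

lemma sigma_finite_lborel_sym: "sigma_finite_measure (lborel_sym :: (real^'d^'d) measure)"
proof
  let ?M = "Pi\<^sub>M (index_pairs :: 'd set set) (\<lambda>_. lborel :: real measure)"
  let ?\<phi> = "\<lambda>w. (\<chi> i j. w {i, j}) :: real^'d^'d"
  define A where "A n = {S :: real^'d^'d. \<forall>i j. S $ i $ j \<in> {- real n..real n}}" for n :: nat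
  have Am: "A n \<in> sets borel" for n
  proof -
    have "A n = (\<Inter>i. \<Inter>j. (\<lambda>S. S $ i $ j) -` {- real n..real n} \<inter> space borel)" by (auto simp: A_def)
    also have "\<dots> \<in> sets borel"
      by (intro sets.finite_INT measurable_sets[where A=borel]) (auto intro!: entry_measurable)
    finally show ?thesis .
  qed
  have fin: "emeasure lborel_sym (A n) \<noteq> \<infinity>" for n
  proof -
    have "?\<phi> -` A n \<inter> space ?M \<subseteq> Pi\<^sub>E index_pairs (\<lambda>_. {- real n..real n})"
      by (auto simp: A_def space_PiM PiE_def Pi_def)
    then have "emeasure lborel_sym (A n) \<le> emeasure ?M (Pi\<^sub>E index_pairs (\<lambda>_. {- real n..real n}))"
      unfolding lborel_sym_def
      by (subst emeasure_distr[OF sym_matrix_measurable]) (auto intro!: emeasure_mono sets_PiM_I_finite finite_index_pairs Am)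
    also have "\<dots> = (\<Prod>k\<in>(index_pairs :: 'd set set). emeasure lborel {- real n..real n})"
      by (rule lborel_product.emeasure_PiM) (auto intro: finite_index_pairs)
    also have "\<dots> < \<infinity>" by (simp add: ennreal_power)
    finally show ?thesis by simp
  qed
  have cover: "(\<Union>n. A n) = UNIV"
  proof (intro equalityI subsetI UNIV_I)
    fix S :: "real^'d^'d"
    obtain n where n: "norm S \<le> real n" using real_arch_simple by blast
    have "- real n \<le> S $ i $ j \<and> S $ i $ j \<le> real n" for i j
    proof -
      have "\<bar>S $ i $ j\<bar> \<le> norm (S $ i)" by (rule component_le_norm_cart)
      also have "\<dots> \<le> norm S" by (rule Finite_Cartesian_Product.norm_nth_le)
      finally show ?thesis using n by linarith
    qed
    then have "S \<in> A n" unfolding A_def by simp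
    then show "S \<in> (\<Union>n. A n)" by blast
  qed
  show "\<exists>A. countable A \<and> A \<subseteq> sets lborel_sym \<and> \<Union>A = space (lborel_sym :: (real^'d^'d) measure)
    \<and> (\<forall>a\<in>A. emeasure lborel_sym a \<noteq> \<infinity>)"
    by (rule exI[of _ "range A"]) (use Am fin cover in auto)
qed

lemma sets_lborel_spd: "sets (lborel_spd :: (real^'d^'d) measure) = sets (restrict_space borel spd)"
  unfolding lborel_spd_def by (rule sets_restrict_space_cong) simp

lemma space_lborel_spd: "space (lborel_spd :: (real^'d^'d) measure) = spd"
  by (simp add: lborel_spd_def space_restrict_space)

lemma sigma_finite_lborel_spd: "sigma_finite_measure (lborel_spd :: (real^'d^'d) measure)"
  unfolding lborel_spd_def
  by (rule sigma_finite_measure_restrict_space[OF sigma_finite_lborel_sym]) simp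

lemma lborel_spd_id_measurable: "(\<lambda>S. S) \<in> borel_measurable (lborel_spd :: (real^'d^'d) measure)"
proof -
  have "(\<lambda>S. S) \<in> measurable (restrict_space borel spd) (borel :: (real^'d^'d) measure)"
    by (rule measurable_restrict_space1) simp
  then show ?thesis by (simp cong: measurable_cong_sets add: sets_lborel_spd)
qed

lemma nn_integral_PiM_scale:
  fixes G :: "('i \<Rightarrow> real) \<Rightarrow> ennreal"
  assumes t: "0 < (t::real)" and I: "finite I"
    and G: "G \<in> borel_measurable (Pi\<^sub>M I (\<lambda>_. lborel))"
  shows "(\<integral>\<^sup>+w. G w \<partial>Pi\<^sub>M I (\<lambda>_. lborel)) = ennreal (t ^ card I) * (\<integral>\<^sup>+w. G (\<lambda>i\<in>I. t * w i) \<partial>Pi\<^sub>M I (\<lambda>_. lborel))"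
  using I G
proof (induction I arbitrary: G rule: finite_induct)
  interpret P: product_sigma_finite "\<lambda>_ :: 'i. lborel :: real measure" ..
  case empty
  show ?case using P.nn_integral_empty[OF zero_le, of G] P.nn_integral_empty[OF zero_le, of "\<lambda>w. G (\<lambda>i\<in>{}. t * w i)"]
    by (simp only: card.empty power_0 restrict_def) simp
next
  interpret P: product_sigma_finite "\<lambda>_ :: 'i. lborel :: real measure" ..
  case (insert i I)
  note [measurable] = insert.prems
  have upd [measurable]: "(\<lambda>(x, y). x(i := y)) \<in> measurable (Pi\<^sub>M I (\<lambda>_. lborel) \<Otimes>\<^sub>M lborel) (Pi\<^sub>M (insert i I) (\<lambda>_. lborel :: real measure))"
    by (rule measurable_add_dim)
  have Gm [measurable]: "(\<lambda>(x, y). G (x(i := y))) \<in> borel_measurable (Pi\<^sub>M I (\<lambda>_. lborel) \<Otimes>\<^sub>M lborel)"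
    using measurable_compose[OF upd insert.prems] by (simp add: case_prod_beta')
  define F where "F x = (\<integral>\<^sup>+y. G (x(i := t * y)) \<partial>lborel)" for x
  have m2: "(\<lambda>(x, y). G (x(i := t * y))) \<in> borel_measurable (Pi\<^sub>M I (\<lambda>_. lborel) \<Otimes>\<^sub>M lborel)"
  proof -
    have "(\<lambda>(x, y). (x, t * y)) \<in> measurable (Pi\<^sub>M I (\<lambda>_. lborel) \<Otimes>\<^sub>M lborel) (Pi\<^sub>M I (\<lambda>_. lborel) \<Otimes>\<^sub>M (lborel :: real measure))"
      by measurable
    from measurable_compose[OF this Gm] show ?thesis by (simp add: case_prod_beta')
  qed
  have Fm: "F \<in> borel_measurable (Pi\<^sub>M I (\<lambda>_. lborel))"
    unfolding F_def using lborel.borel_measurable_nn_integral[OF m2] by simp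
  have inner: "(\<integral>\<^sup>+y. G (x(i := y)) \<partial>lborel) = ennreal t * F x" if x: "x \<in> space (Pi\<^sub>M I (\<lambda>_. lborel))" for x
  proof -
    have "(\<lambda>y. G (x(i := y))) \<in> borel_measurable lborel"
      using measurable_Pair2[OF Gm x] by simp
    then show ?thesis
      using nn_integral_real_affine[of "\<lambda>y. G (x(i := y))" t 0] t by (simp add: F_def)
  qed
  have "(\<integral>\<^sup>+w. G w \<partial>Pi\<^sub>M (insert i I) (\<lambda>_. lborel)) = (\<integral>\<^sup>+x. \<integral>\<^sup>+y. G (x(i := y)) \<partial>lborel \<partial>Pi\<^sub>M I (\<lambda>_. lborel))"
    by (rule P.product_nn_integral_insert[OF insert.hyps insert.prems])
  also have "\<dots> = (\<integral>\<^sup>+x. ennreal t * F x \<partial>Pi\<^sub>M I (\<lambda>_. lborel))"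
    by (rule nn_integral_cong) (rule inner)
  also have "\<dots> = ennreal t * (\<integral>\<^sup>+x. F x \<partial>Pi\<^sub>M I (\<lambda>_. lborel))"
    by (rule nn_integral_cmult[OF Fm])
  also have "\<dots> = ennreal (t ^ card (insert i I)) * (\<integral>\<^sup>+x. F (\<lambda>k\<in>I. t * x k) \<partial>Pi\<^sub>M I (\<lambda>_. lborel))"
    unfolding insert.IH[OF Fm] using t insert.hyps by (simp add: ennreal_mult mult.assoc)
  also have "(\<integral>\<^sup>+x. F (\<lambda>k\<in>I. t * x k) \<partial>Pi\<^sub>M I (\<lambda>_. lborel))
    = (\<integral>\<^sup>+x. \<integral>\<^sup>+y. G (\<lambda>k\<in>insert i I. t * (x(i := y)) k) \<partial>lborel \<partial>Pi\<^sub>M I (\<lambda>_. lborel))"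
  proof -
    have "(\<lambda>k\<in>I. t * x k)(i := t * y) = (\<lambda>k\<in>insert i I. t * (x(i := y)) k)" for x y
      using insert.hyps by (auto simp: fun_eq_iff restrict_def)
    then show ?thesis unfolding F_def by simp
  qed
  also have "\<dots> = (\<integral>\<^sup>+w. G (\<lambda>k\<in>insert i I. t * w k) \<partial>Pi\<^sub>M (insert i I) (\<lambda>_. lborel))"
  proof (rule P.product_nn_integral_insert[OF insert.hyps, symmetric])
    have "(\<lambda>w. \<lambda>k\<in>insert i I. t * w k) \<in> measurable (Pi\<^sub>M (insert i I) (\<lambda>_. lborel)) (Pi\<^sub>M (insert i I) (\<lambda>_. lborel :: real measure))"
      by measurable
    from measurable_compose[OF this insert.prems]
    show "(\<lambda>w. G (\<lambda>k\<in>insert i I. t * w k)) \<in> borel_measurable (Pi\<^sub>M (insert i I) (\<lambda>_. lborel))" .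
  qed
  finally show ?case .
qed

lemma spd_scaleR:
  fixes S :: "real^'d^'d"
  assumes "S \<in> spd" "0 < t"
  shows "t *\<^sub>R S \<in> spd"
proof -
  have "transpose (t *\<^sub>R S) = t *\<^sub>R transpose S" by (simp add: transpose_def vec_eq_iff)
  moreover have "v \<bullet> ((t *\<^sub>R S) *v v) = t * (v \<bullet> (S *v v))" for v
    by (simp add: scaleR_matrix_vector_assoc[symmetric])
  ultimately show ?thesis using assms by (simp add: spd_def)
qed

lemma spd_scaleR_iff:
  fixes S :: "real^'d^'d"
  assumes "0 < t"
  shows "t *\<^sub>R S \<in> spd \<longleftrightarrow> S \<in> spd"
  using spd_scaleR[of S t] spd_scaleR[of "t *\<^sub>R S" "1 / t"] assms by auto

lemma nn_integral_spd_scale: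
  fixes g :: "real^'d^'d \<Rightarrow> ennreal"
  assumes t: "0 < t" and g: "g \<in> borel_measurable lborel_spd"
  shows "(\<integral>\<^sup>+S. g S \<partial>lborel_spd)
    = ennreal (t ^ card (index_pairs :: 'd set set)) * (\<integral>\<^sup>+S. g (t *\<^sub>R S) \<partial>lborel_spd)"
proof -
  let ?M = "Pi\<^sub>M (index_pairs :: 'd set set) (\<lambda>_. lborel :: real measure)"
  let ?\<phi> = "\<lambda>w. (\<chi> i j. w {i, j}) :: real^'d^'d"
  define G where "G S = g S * indicator spd S" for S
  have spd': "spd \<inter> space lborel_sym \<in> sets (lborel_sym :: (real^'d^'d) measure)" by simp
  have Gm [measurable]: "G \<in> borel_measurable borel"
    using g borel_measurable_restrict_space_iff_ennreal[OF spd', of g]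
    by (simp add: lborel_spd_def G_def[abs_def] cong: measurable_cong_sets)
  have "(\<integral>\<^sup>+S. g S \<partial>lborel_spd) = (\<integral>\<^sup>+S. G S \<partial>lborel_sym)"
    unfolding lborel_spd_def G_def by (rule nn_integral_restrict_space[OF spd'])
  also have "\<dots> = (\<integral>\<^sup>+w. G (?\<phi> w) \<partial>?M)"
    unfolding lborel_sym_def by (rule nn_integral_distr) measurable
  also have "\<dots> = ennreal (t ^ card (index_pairs :: 'd set set)) * (\<integral>\<^sup>+w. G (?\<phi> (\<lambda>k\<in>index_pairs. t * w k)) \<partial>?M)"
    by (rule nn_integral_PiM_scale[OF t finite_index_pairs]) measurable
  also have "(\<integral>\<^sup>+w. G (?\<phi> (\<lambda>k\<in>index_pairs. t * w k)) \<partial>?M) = (\<integral>\<^sup>+w. G (t *\<^sub>R ?\<phi> w) \<partial>?M)"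
  proof (rule nn_integral_cong)
    fix w
    have "?\<phi> (\<lambda>k\<in>index_pairs. t * w k) = t *\<^sub>R ?\<phi> w"
      by (auto simp: vec_eq_iff restrict_def)
    then show "G (?\<phi> (\<lambda>k\<in>index_pairs. t * w k)) = G (t *\<^sub>R ?\<phi> w)" by simp
  qed
  also have "\<dots> = (\<integral>\<^sup>+S. G (t *\<^sub>R S) \<partial>lborel_sym)"
    unfolding lborel_sym_def by (rule nn_integral_distr[symmetric]) measurable
  also have "\<dots> = (\<integral>\<^sup>+S. g (t *\<^sub>R S) * indicator spd S \<partial>lborel_sym)"
    by (rule nn_integral_cong) (simp add: G_def indicator_def spd_scaleR_iff[OF t])
  also have "\<dots> = (\<integral>\<^sup>+S. g (t *\<^sub>R S) \<partial>lborel_spd)"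
    unfolding lborel_spd_def by (rule nn_integral_restrict_space[OF spd', symmetric])
  finally show ?thesis .
qed

lemma sets_state_measure:
  "sets (state_measure :: ((real^'d^'p) \<times> (real^'d^'d)) measure) = sets (restrict_space borel (UNIV \<times> spd))"
proof (intro equalityI subsetI)
  let ?S = "state_measure :: ((real^'d^'p) \<times> (real^'d^'d)) measure"
  let ?R = "restrict_space borel (UNIV \<times> spd) :: ((real^'d^'p) \<times> (real^'d^'d)) measure"
  have spS: "space ?S = UNIV \<times> spd"
    by (simp add: state_measure_def space_pair_measure space_lborel_spd)
  have spR: "space ?R = UNIV \<times> spd" by (simp add: space_restrict_space)
  have setsS: "sets ?S = sets (borel \<Otimes>\<^sub>M restrict_space borel spd)"
    unfolding state_measure_def by (intro sets_pair_measure_cong) (simp_all add: sets_lborel_spd)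
  have "(\<lambda>x. (fst x, snd x)) \<in> measurable ?R (borel \<Otimes>\<^sub>M restrict_space borel spd)"
  proof (rule measurable_Pair)
    have "fst \<in> measurable (borel :: ((real^'d^'p) \<times> (real^'d^'d)) measure) borel"
      and s: "snd \<in> measurable (borel :: ((real^'d^'p) \<times> (real^'d^'d)) measure) borel"
      by (simp_all add: borel_prod[symmetric])
    then show "fst \<in> measurable ?R borel" by (intro measurable_restrict_space1)
    show "snd \<in> measurable ?R (restrict_space borel spd)"
      by (rule measurable_restrict_space2) (use s in \<open>auto simp: spR intro: measurable_restrict_space1\<close>)
  qed
  then have idR: "(\<lambda>x. x) \<in> measurable ?R ?S" by (simp cong: measurable_cong_sets add: setsS)
  have "(\<lambda>x. (fst x, snd x)) \<in> measurable ?S (borel \<Otimes>\<^sub>M borel)"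
  proof (rule measurable_Pair)
    show "fst \<in> measurable ?S borel" by (simp add: state_measure_def cong: measurable_cong_sets)
    have "snd \<in> measurable ?S lborel_spd" by (simp add: state_measure_def)
    from measurable_compose[OF this lborel_spd_id_measurable] show "snd \<in> measurable ?S borel" by simp
  qed
  then have idS: "(\<lambda>x. x) \<in> measurable ?S borel" by (simp add: borel_prod)
  fix A
  show "A \<in> sets ?R" if "A \<in> sets ?S"
  proof -
    have "A \<subseteq> UNIV \<times> spd" using sets.sets_into_space[OF that] spS by simp
    then have "(\<lambda>x. x) -` A \<inter> space ?R = A" by (auto simp: spR)
    then show ?thesis using measurable_sets[OF idR that] by simp
  qed
  show "A \<in> sets ?S" if "A \<in> sets ?R"
  proof -
    have "A \<in> (\<inter>) (UNIV \<times> spd) ` sets borel" using that by (simp only: sets_restrict_space)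
    then obtain B where B: "A = (UNIV \<times> spd) \<inter> B" "B \<in> sets borel" by (rule imageE)
    have "(\<lambda>x. x) -` B \<inter> space ?S = A" unfolding B(1) spS by blast
    then show ?thesis using measurable_sets[OF idS B(2)] by simp
  qed
qed

section \<open>The least squares decomposition\<close>

definition diag :: "real^'n \<Rightarrow> real^'n^'n" where
  "diag z = (\<chi> i j. if i = j then z $ i else 0)"

lemma diag_mult: "(diag z ** A) $ i $ j = z $ i * A $ i $ j" for A :: "real^'m^'n"
proof -
  have "(diag z ** A) $ i $ j = (\<Sum>k\<in>UNIV. if k = i then z $ i * A $ i $ j else 0)"
    unfolding diag_def matrix_matrix_mult_def vec_lambda_beta by (rule sum.cong) auto
  then show ?thesis by simp
qed

lemma diag_mult_vector: "(diag z *v v) $ i = z $ i * v $ i"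
proof -
  have "(diag z *v v) $ i = (\<Sum>k\<in>UNIV. if k = i then z $ i * v $ i else 0)"
    unfolding diag_def matrix_vector_mult_def vec_lambda_beta by (rule sum.cong) auto
  then show ?thesis by simp
qed

lemma transpose_diag: "transpose (diag z) = diag z"
  by (simp add: diag_def transpose_def vec_eq_iff)

lemma matrix_inv_Q_mat:
  assumes "\<And>i. 0 < z $ i"
  shows "matrix_inv (Q_mat z) = diag z"
proof (rule matrix_inv_unique)
  have Q: "Q_mat z = diag (\<chi> i. inverse (z $ i))" by (simp add: Q_mat_def diag_def vec_eq_iff)
  have "(Q_mat z ** diag z) $ i $ j = mat 1 $ i $ j" for i j
    unfolding Q diag_mult using assms[of i] by (auto simp: diag_def mat_def)
  then show "Q_mat z ** diag z = mat 1" by (simp add: vec_eq_iff)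
qed

lemma gram_spd:
  fixes A :: "real^'m^'n"
  assumes A: "\<And>v. A *v v = 0 \<Longrightarrow> v = 0" and z: "\<And>i. 0 < z $ i"
  shows "transpose A ** diag z ** A \<in> spd"
proof -
  have "transpose (transpose A ** diag z ** A) = transpose A ** diag z ** A"
    by (simp add: matrix_transpose_mul transpose_transpose transpose_diag matrix_mul_assoc)
  moreover have "0 < v \<bullet> ((transpose A ** diag z ** A) *v v)" if "v \<noteq> 0" for v
  proof -
    have "v \<bullet> ((transpose A ** diag z ** A) *v v) = (A *v v) \<bullet> (diag z *v (A *v v))"
      by (metis dot_lmul_matrix matrix_vector_mul_assoc transpose_matrix_vector inner_commute)
    also have "\<dots> = (\<Sum>i\<in>UNIV. z $ i * ((A *v v) $ i)\<^sup>2)"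
      by (simp add: inner_vec_def diag_mult_vector power2_eq_square ac_simps)
    also have "\<dots> > 0"
    proof -
      have "A *v v \<noteq> 0" using A that by blast
      then obtain i where i: "(A *v v) $ i \<noteq> 0" by (auto simp: vec_eq_iff)
      have "0 < z $ i * ((A *v v) $ i)\<^sup>2" using i z by simp
      moreover have "0 \<le> z $ j * ((A *v v) $ j)\<^sup>2" for j using z[of j] by simp
      ultimately show ?thesis by (intro sum_pos2[of UNIV i]) auto
    qed
    finally show ?thesis .
  qed
  ultimately show ?thesis by (simp add: spd_def)
qed

lemma concat_cols_injective:
  fixes X :: "real^'p^'n" and y :: "real^'d^'n"
  assumes r: "rank (concat_cols X y) = CARD('p) + CARD('d)" and 0: "X *v a + y *v b = 0"
  shows "a = 0 \<and> b = 0"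
proof -
  have inj: "inj ((*v) (concat_cols X y))"
    using r full_rank_injective[of "concat_cols X y"] by simp
  define w :: "real^('p + 'd)" where "w = (\<chi> j. case j of Inl k \<Rightarrow> a $ k | Inr k \<Rightarrow> b $ k)"
  have "(concat_cols X y *v w) $ i = 0" for i
  proof -
    have "(concat_cols X y *v w) $ i = (\<Sum>j\<in>UNIV <+> UNIV. concat_cols X y $ i $ j * w $ j)"
      by (simp add: matrix_vector_mult_def UNIV_Plus_UNIV)
    also have "\<dots> = (\<Sum>k\<in>UNIV. X $ i $ k * a $ k) + (\<Sum>k\<in>UNIV. y $ i $ k * b $ k)"
      by (subst sum.Plus) (auto simp: concat_cols_def w_def)
    also have "\<dots> = (X *v a + y *v b) $ i" by (simp add: matrix_vector_mult_def)
    finally show ?thesis using 0 by simp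
  qed
  then have "concat_cols X y *v w = concat_cols X y *v 0" by (simp add: vec_eq_iff)
  then have w: "w = 0" by (rule injD[OF inj])
  have "a $ k = 0" for k using arg_cong[OF w, of "\<lambda>w. w $ Inl k"] by (simp add: w_def)
  moreover have "b $ k = 0" for k using arg_cong[OF w, of "\<lambda>w. w $ Inr k"] by (simp add: w_def)
  ultimately show ?thesis by (simp add: vec_eq_iff)
qed

lemma matrix_diff_ldistrib: "A ** (B - C) = A ** B - A ** C" for A :: "real^'m^'n" and B C :: "real^'k^'m"
  by (simp add: vec_eq_iff matrix_matrix_mult_def right_diff_distrib sum_subtractf)

lemma matrix_diff_rdistrib: "(B - C) ** A = B ** A - C ** A" for A :: "real^'m^'n" and B C :: "real^'n^'k"
  by (simp add: vec_eq_iff matrix_matrix_mult_def left_diff_distrib sum_subtractf)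

lemma transpose_diff: "transpose (A - B) = transpose A - transpose (B :: real^'m^'n)"
  by (simp add: transpose_def vec_eq_iff)

lemma trace_diff: "trace (A - B) = trace A - trace (B :: real^'n^'n)"
  by (simp add: trace_def sum_subtractf)

lemma residual_row: "y $ i - transpose \<beta> *v X $ i = (y - X ** \<beta>) $ i"
  for X :: "real^'p^'n" and y :: "real^'d^'n"
  by (simp add: vec_eq_iff matrix_matrix_mult_def matrix_vector_mult_def transpose_def mult.commute)

lemma weighted_resid_form:
  fixes X :: "real^'p^'n" and y :: "real^'d^'n"
  shows "(\<Sum>i\<in>UNIV. z $ i * resid_form X y \<beta> \<Sigma> i)
    = trace (diag z ** (y - X ** \<beta>) ** matrix_inv \<Sigma> ** transpose (y - X ** \<beta>))"
proof -
  let ?E = "y - X ** \<beta>"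
  have "(diag z ** (?E ** matrix_inv \<Sigma> ** transpose ?E)) $ i $ i = z $ i * resid_form X y \<beta> \<Sigma> i" for i
    unfolding diag_mult resid_form_def residual_row
    by (simp add: matrix_matrix_mult_def matrix_vector_mult_def transpose_def inner_vec_def
        sum_distrib_left sum_distrib_right, subst sum.swap, simp add: ac_simps)
  then show ?thesis by (simp add: trace_def matrix_mul_assoc)
qed

locale regression =
  fixes X :: "real^'p^'n" and y :: "real^'d^'n" and z :: "real^'n"
  assumes rank: "rank (concat_cols X y) = CARD('p) + CARD('d)" and z_pos: "\<And>i. 0 < z $ i"
begin

definition "P = transpose X ** diag z ** X"
definition "\<mu> = mu_mat X y z"
definition "S = transpose y ** diag z ** y - transpose \<mu> ** P ** \<mu>"

lemma P_spd: "P \<in> spd"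
  unfolding P_def
proof (rule gram_spd)
  show "X *v v = 0 \<Longrightarrow> v = 0" for v
    using concat_cols_injective[OF rank, of v 0] by simp
qed (rule z_pos)

lemma Omega_eq: "Omega_mat X z = matrix_inv P"
  by (simp add: Omega_mat_def P_def matrix_inv_Q_mat z_pos)

lemma matrix_inv_Omega: "matrix_inv (Omega_mat X z) = P"
  unfolding Omega_eq by (rule matrix_inv_matrix_inv[OF spd_invertible[OF P_spd]])

lemma normal_equations: "P ** \<mu> = transpose X ** diag z ** y"
proof -
  have "\<mu> = matrix_inv P ** (transpose X ** diag z ** y)"
    by (simp add: \<mu>_def mu_mat_def P_def matrix_inv_Q_mat z_pos matrix_mul_assoc)
  then show ?thesis
    by (simp add: matrix_mul_assoc invertible_matrix_inv[OF spd_invertible[OF P_spd]])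
qed

lemma residual_orthogonal: "transpose X ** (diag z ** (y - X ** \<mu>)) = 0"
  using normal_equations by (simp add: matrix_diff_ldistrib matrix_mul_assoc P_def)

lemma residual_orthogonal': "transpose (y - X ** \<mu>) ** (diag z ** X) = 0"
proof -
  have "transpose (y - X ** \<mu>) ** (diag z ** X) = transpose (transpose X ** (diag z ** (y - X ** \<mu>)))"
    by (simp add: matrix_transpose_mul transpose_transpose transpose_diag matrix_mul_assoc)
  also have "\<dots> = 0" unfolding residual_orthogonal by (simp add: transpose_def vec_eq_iff)
  finally show ?thesis .
qed

lemma S_eq: "S = transpose (y - X ** \<mu>) ** diag z ** (y - X ** \<mu>)"
proof -
  have z0: "transpose (y - X ** \<mu>) ** diag z ** (X ** \<mu>) = 0"
  proof -
    have "transpose (y - X ** \<mu>) ** diag z ** (X ** \<mu>) = (transpose (y - X ** \<mu>) ** (diag z ** X)) ** \<mu>"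
      by (simp only: matrix_mul_assoc)
    then show ?thesis unfolding residual_orthogonal' by (simp add: matrix_matrix_mult_def vec_eq_iff)
  qed
  have "transpose (y - X ** \<mu>) ** diag z ** (y - X ** \<mu>) = transpose (y - X ** \<mu>) ** diag z ** y"
    unfolding matrix_diff_ldistrib z0 by simp
  also have "\<dots> = transpose y ** diag z ** y - transpose \<mu> ** (transpose X ** diag z ** y)"
    by (simp add: transpose_diff matrix_diff_rdistrib matrix_transpose_mul matrix_mul_assoc)
  also have "\<dots> = S" by (simp add: S_def normal_equations[symmetric] matrix_mul_assoc)
  finally show ?thesis ..
qed

lemma S_spd: "S \<in> spd"
  unfolding S_eq
proof (rule gram_spd)
  fix v assume "(y - X ** \<mu>) *v v = 0"
  then have "X *v (- (\<mu> *v v)) + y *v v = 0"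
    by (simp add: matrix_vector_mult_diff_rdistrib matrix_vector_mul_assoc[symmetric]
        linear_neg[OF matrix_vector_mul_linear])
  then show "v = 0" using concat_cols_injective[OF rank] by blast
qed (rule z_pos)

lemma quadratic_decomposition:
  "(\<Sum>i\<in>UNIV. z $ i * resid_form X y \<beta> \<Sigma> i)
    = trace (P ** (\<beta> - \<mu>) ** matrix_inv \<Sigma> ** transpose (\<beta> - \<mu>)) + trace (S ** matrix_inv \<Sigma>)"
proof -
  let ?Z = "diag z" and ?G = "matrix_inv \<Sigma>" and ?R = "y - X ** \<mu>" and ?D = "\<beta> - \<mu>"
  have E: "y - X ** \<beta> = ?R - X ** ?D" by (simp add: matrix_diff_ldistrib)
  have c1: "trace (?Z ** ?R ** ?G ** (transpose ?D ** transpose X)) = 0"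
  proof -
    have "trace (?Z ** ?R ** ?G ** (transpose ?D ** transpose X))
      = trace ((?Z ** ?R ** ?G ** transpose ?D) ** transpose X)" by (simp add: matrix_mul_assoc)
    also have "\<dots> = trace (transpose X ** (?Z ** ?R ** ?G ** transpose ?D))" by (rule trace_cyclic)
    also have "\<dots> = trace ((transpose X ** (?Z ** ?R)) ** ?G ** transpose ?D)" by (simp add: matrix_mul_assoc)
    finally show ?thesis unfolding residual_orthogonal by (simp add: trace_def matrix_matrix_mult_def)
  qed
  have c2: "trace (?Z ** (X ** ?D) ** ?G ** transpose ?R) = 0"
  proof -
    have "trace (?Z ** (X ** ?D) ** ?G ** transpose ?R) = trace (transpose ?R ** (?Z ** (X ** ?D) ** ?G))"
      by (rule trace_cyclic)
    also have "\<dots> = trace ((transpose ?R ** (?Z ** X)) ** ?D ** ?G)" by (simp add: matrix_mul_assoc)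
    finally show ?thesis unfolding residual_orthogonal' by (simp add: trace_def matrix_matrix_mult_def)
  qed
  have c3: "trace (?Z ** ?R ** ?G ** transpose ?R) = trace (S ** ?G)"
  proof -
    have "trace (?Z ** ?R ** ?G ** transpose ?R) = trace (transpose ?R ** (?Z ** ?R ** ?G))"
      by (rule trace_cyclic)
    then show ?thesis by (simp add: S_eq matrix_mul_assoc)
  qed
  have c4: "trace (?Z ** (X ** ?D) ** ?G ** (transpose ?D ** transpose X)) = trace (P ** ?D ** ?G ** transpose ?D)"
  proof -
    have "trace (?Z ** (X ** ?D) ** ?G ** (transpose ?D ** transpose X))
      = trace ((?Z ** X ** ?D ** ?G ** transpose ?D) ** transpose X)" by (simp add: matrix_mul_assoc)
    also have "\<dots> = trace (transpose X ** (?Z ** X ** ?D ** ?G ** transpose ?D))" by (rule trace_cyclic)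
    finally show ?thesis by (simp add: P_def matrix_mul_assoc)
  qed
  have "(\<Sum>i\<in>UNIV. z $ i * resid_form X y \<beta> \<Sigma> i)
    = trace (?Z ** (?R - X ** ?D) ** ?G ** (transpose ?R - transpose ?D ** transpose X))"
    unfolding weighted_resid_form E by (simp add: transpose_diff matrix_transpose_mul)
  also have "\<dots> = trace (?Z ** ?R ** ?G ** transpose ?R) - trace (?Z ** (X ** ?D) ** ?G ** transpose ?R)
    - (trace (?Z ** ?R ** ?G ** (transpose ?D ** transpose X)) - trace (?Z ** (X ** ?D) ** ?G ** (transpose ?D ** transpose X)))"
    by (simp only: matrix_diff_ldistrib[of ?Z] matrix_diff_rdistrib matrix_diff_ldistrib trace_diff)
  finally show ?thesis unfolding c1 c2 c3 c4 by simp
qed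

end

section \<open>The data augmentation chain\<close>

lemma nn_integral_prod_vec:
  fixes f :: "'n::finite \<Rightarrow> real \<Rightarrow> ennreal"
  assumes "\<And>i. f i \<in> borel_measurable borel"
  shows "(\<integral>\<^sup>+z. (\<Prod>i\<in>UNIV. f i (z $ i)) \<partial>(lborel :: (real^'n) measure)) = (\<Prod>i\<in>UNIV. \<integral>\<^sup>+x. f i x \<partial>lborel)"
proof -
  define k where "k b = (THE i. b = axis i (1::real))" for b :: "real^'n"
  have k: "k (axis i 1) = i" for i
    unfolding k_def by (rule the_equality) (auto simp: axis_eq_axis)
  have B: "(Basis :: (real^'n) set) = (\<lambda>i. axis i 1) ` UNIV" by (auto simp: Basis_vec_def)
  have inj: "inj (\<lambda>i :: 'n. axis i (1::real))" by (auto simp: inj_on_def axis_eq_axis)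
  have "(\<integral>\<^sup>+z. (\<Prod>b\<in>Basis. f (k b) (z \<bullet> b)) \<partial>(lborel :: (real^'n) measure)) = (\<Prod>b\<in>(Basis :: (real^'n) set). \<integral>\<^sup>+x. f (k b) x \<partial>lborel)"
    by (rule nn_integral_lborel_prod) (use assms in auto)
  then show ?thesis
    unfolding B prod.reindex[OF inj] by (simp add: k inner_axis)
qed

lemma resid_form_nonneg:
  assumes "\<Sigma> \<in> spd"
  shows "0 \<le> resid_form X y \<beta> \<Sigma> i"
proof (cases "y $ i - transpose \<beta> *v X $ i = 0")
  case False
  then show ?thesis unfolding resid_form_def
    using spd_pos[OF spd_matrix_inv[OF assms] False] by simp
qed (simp add: resid_form_def)

lemma resid_form_scaleR:
  fixes \<Sigma> :: "real^'d^'d"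
  assumes S: "\<Sigma> \<in> spd" and t: "0 < t"
  shows "resid_form X y \<beta> (t *\<^sub>R \<Sigma>) i = resid_form X y \<beta> \<Sigma> i / t"
proof -
  have "matrix_inv (t *\<^sub>R \<Sigma>) = (1 / t) *\<^sub>R matrix_inv \<Sigma>"
  proof (rule matrix_inv_unique)
    have "t *\<^sub>R \<Sigma> ** ((1 / t) *\<^sub>R matrix_inv \<Sigma>) = \<Sigma> ** matrix_inv \<Sigma>"
      using t by (simp add: vec_eq_iff matrix_matrix_mult_def)
    then show "t *\<^sub>R \<Sigma> ** ((1 / t) *\<^sub>R matrix_inv \<Sigma>) = mat 1"
      by (simp add: invertible_matrix_inv[OF spd_invertible[OF S]])
  qed
  then show ?thesis by (simp add: resid_form_def scaleR_matrix_vector_assoc[symmetric])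
qed

lemma det_scaleR:
  fixes A :: "real^'n^'n"
  shows "det (t *\<^sub>R A) = t ^ CARD('n) * det A"
proof -
  have "t *\<^sub>R A = (\<chi> i. t *s A $ i)" by (simp add: vec_eq_iff)
  then show ?thesis using det_rows_mul[of "\<lambda>_. t" "\<lambda>i. A $ i"] by simp
qed

lemma sigma_finite_state: "sigma_finite_measure (state_measure :: ((real^'d^'p) \<times> (real^'d^'d)) measure)"
  unfolding state_measure_def
  by (intro sigma_finite_pair_measure lborel.sigma_finite_measure_axioms sigma_finite_lborel_spd)

lemma space_state: "space (state_measure :: ((real^'d^'p) \<times> (real^'d^'d)) measure) = UNIV \<times> spd"
  by (simp add: state_measure_def space_pair_measure space_lborel_spd)

lemma fst_state_measurable [measurable]: "fst \<in> borel_measurable (state_measure :: ((real^'d^'p) \<times> (real^'d^'d)) measure)"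
  by (simp add: state_measure_def cong: measurable_cong_sets)

lemma snd_state_measurable [measurable]: "snd \<in> borel_measurable (state_measure :: ((real^'d^'p) \<times> (real^'d^'d)) measure)"
proof -
  have "snd \<in> measurable (state_measure :: ((real^'d^'p) \<times> (real^'d^'d)) measure) lborel_spd"
    by (simp add: state_measure_def)
  from measurable_compose[OF this lborel_spd_id_measurable] show ?thesis by simp
qed

lemma resid_form_measurable_state:
  "(\<lambda>x :: (real^'d^'p) \<times> (real^'d^'d). resid_form X y (fst x) (snd x) i) \<in> borel_measurable state_measure"
proof -
  let ?M = "state_measure :: ((real^'d^'p) \<times> (real^'d^'d)) measure"
  have [measurable]: "(\<lambda>x. matrix_inv (snd x)) \<in> borel_measurable ?M"
    by (rule matrix_inv_measurable) (auto simp: space_state spd_invertible)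
  show ?thesis
    unfolding resid_form_def inner_vec_def matrix_vector_mult_def transpose_def by simp
qed

lemma resid_form_measurable [measurable (raw)]:
  fixes u :: "'a \<Rightarrow> (real^'d^'p) \<times> (real^'d^'d)"
  assumes "u \<in> measurable N state_measure"
  shows "(\<lambda>w. resid_form X y (fst (u w)) (snd (u w)) i) \<in> borel_measurable N"
  using measurable_compose[OF assms resid_form_measurable_state] .

lemma det_state_measurable [measurable (raw)]:
  fixes u :: "'a \<Rightarrow> (real^'d^'p) \<times> (real^'d^'d)"
  assumes "u \<in> measurable N state_measure"
  shows "(\<lambda>w. det (snd (u w))) \<in> borel_measurable N"
  by (rule measurable_compose[OF assms]) measurable

lemma invertible_row_selection:
  fixes X :: "real^'p^'n"
  assumes X: "\<And>v. X *v v = 0 \<Longrightarrow> v = 0"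
  shows "\<exists>\<rho> :: 'p \<Rightarrow> 'n. inj \<rho> \<and> invertible ((\<chi> k. X $ \<rho> k) :: real^'p^'p)"
proof -
  have "inj ((*v) X)" using X linear_injective_0[OF matrix_vector_mul_linear, of X] by blast
  then have sp: "span (rows X) = UNIV"
    using matrix_left_invertible_injective[of X] matrix_left_invertible_span_rows[of X] by blast
  obtain B where B: "B \<subseteq> rows X" "independent B" "rows X \<subseteq> span B" "card B = dim (rows X)"
    using basis_exists[of "rows X"] by blast
  have spB: "span B = UNIV" using B(3) sp by (metis span_mono span_span top.extremum_uniqueI)
  have "card B = CARD('p)"
    using B(4) sp by (metis dim_span dim_UNIV DIM_cart DIM_real mult.right_neutral)
  moreover have "finite B" using B(2) by (rule independent_imp_finite)
  ultimately obtain f :: "'p \<Rightarrow> real^'p" where f: "bij_betw f UNIV B"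
    using finite_same_card_bij[of "UNIV :: 'p set" B] by auto
  have "\<exists>i. f k = X $ i" for k
    using f B(1) unfolding bij_betw_def rows_def row_def by (auto simp: vec_lambda_eta)
  then obtain \<rho> where \<rho>: "\<And>k. f k = X $ \<rho> k" by metis
  have "inj \<rho>" using f \<rho> unfolding bij_betw_def inj_on_def by metis
  moreover have "invertible ((\<chi> k. X $ \<rho> k) :: real^'p^'p)"
  proof -
    let ?A = "(\<chi> k. X $ \<rho> k) :: real^'p^'p"
    have "row k ?A = f k" for k by (simp add: row_def \<rho> vec_lambda_eta)
    then have "rows ?A = B" using f unfolding bij_betw_def rows_def by auto
    then show ?thesis
      using matrix_left_invertible_span_rows[of ?A] spB by (simp add: invertible_left_inverse)
  qed
  ultimately show ?thesis by blast
qed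

lemma trace_quadratic_minus:
  fixes D :: "real^'d^'p" and Z :: "real^'p^'p"
  shows "trace (Z ** (A - B) ** G ** transpose (A - B)) = trace (Z ** (B - A) ** G ** transpose (B - A :: real^'d^'p))"
proof -
  have "Z ** (A - B) ** G ** transpose (A - B) = Z ** (B - A) ** G ** transpose (B - A)"
    by (simp add: matrix_diff_ldistrib matrix_diff_rdistrib transpose_diff)
  then show ?thesis by simp
qed

lemma resid_form_measurable_beta [measurable]:
  "(\<lambda>\<beta>. resid_form X y \<beta> \<Sigma> i) \<in> borel_measurable borel"
  unfolding resid_form_def inner_vec_def matrix_vector_mult_def transpose_def by simp

locale da_setting =
  fixes X :: "real^'p^'n" and y :: "real^'d^'n" and a :: real and h :: "real \<Rightarrow> real"
  assumes h: "mixing_density h"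
    and S1: "rank (concat_cols X y) = CARD('p) + CARD('d)"
    and S3: "set_integrable lborel {0<..} (\<lambda>u. u powr (real CARD('d) / 2) * h u)"
begin

abbreviation r :: "(real^'d^'p) \<times> (real^'d^'d) \<Rightarrow> 'n \<Rightarrow> real" where
  "r x i \<equiv> resid_form X y (fst x) (snd x) i"

definition \<psi> :: "real \<Rightarrow> real" where
  "\<psi> u = indicator {0<..} u * (u powr (real CARD('d) / 2) * h u)"

definition H :: "real \<Rightarrow> real" where
  "H s = (\<integral>v. \<psi> v * exp (- (s * v / 2)) \<partial>lborel)"

definition e :: real where "e = (real CARD('n) + 2 * a) / 2"

definition E :: "(real^'d^'p) \<times> (real^'d^'d) \<Rightarrow> real^'n \<Rightarrow> real" where
  "E x z = det (snd x) powr (- e) * exp (- (1/2) * (\<Sum>i\<in>UNIV. z $ i * r x i))"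

definition W :: "real^'n \<Rightarrow> real" where
  "W z = (\<Prod>i\<in>UNIV. \<psi> (z $ i))"

definition L :: "(real^'d^'p) \<times> (real^'d^'d) \<Rightarrow> real" where
  "L x = det (snd x) powr (- e) * (\<Prod>i\<in>UNIV. H (r x i))"

definition CC :: "real^'n \<Rightarrow> ennreal" where
  "CC z = (\<integral>\<^sup>+x. ennreal (E x z) \<partial>state_measure)"

definition c :: "real^'n \<Rightarrow> real" where
  "c z = enn2real (CC z)"

lemma h_nonneg: "0 < u \<Longrightarrow> 0 \<le> h u"
  using h by (simp add: mixing_density_def)

lemma \<psi>_nonneg: "0 \<le> \<psi> u"
  using h_nonneg[of u] by (simp add: \<psi>_def indicator_def)

lemma \<psi>_integrable: "integrable lborel \<psi>"
  using S3 by (simp add: set_integrable_def \<psi>_def[abs_def])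

lemma \<psi>_measurable [measurable]: "\<psi> \<in> borel_measurable borel"
  using borel_measurable_integrable[OF \<psi>_integrable] by simp

lemma \<psi>_exp_integrable:
  assumes "0 \<le> s"
  shows "integrable lborel (\<lambda>v. \<psi> v * exp (- (s * v / 2)))"
proof (rule Bochner_Integration.integrable_bound[OF \<psi>_integrable])
  show "AE v in lborel. norm (\<psi> v * exp (- (s * v / 2))) \<le> norm (\<psi> v)"
  proof (rule AE_I2)
    fix v
    show "norm (\<psi> v * exp (- (s * v / 2))) \<le> norm (\<psi> v)"
    proof (cases "0 < v")
      case True
      then have "exp (- (s * v / 2)) \<le> 1" using assms by simp
      then show ?thesis using \<psi>_nonneg[of v] by (simp add: abs_mult mult_left_le)
    qed (simp add: \<psi>_def)
  qed
qed measurable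

lemma H_nonneg: "0 \<le> H s"
  unfolding H_def by (simp add: \<psi>_nonneg)

lemma nn_integral_\<psi>_exp:
  "0 \<le> s \<Longrightarrow> (\<integral>\<^sup>+v. ennreal (\<psi> v * exp (- (s * v / 2))) \<partial>lborel) = ennreal (H s)"
  unfolding H_def by (rule nn_integral_eq_integral[OF \<psi>_exp_integrable]) (simp_all add: \<psi>_nonneg)

lemma not_AE_\<psi>_zero: "\<not> (AE u in lborel. \<psi> u = 0)"
proof
  assume "AE u in lborel. \<psi> u = 0"
  then have "AE u in lborel. indicator {0<..} u *\<^sub>R h u = 0"
    by eventually_elim (auto simp: \<psi>_def indicator_def)
  then have "(\<integral>u. indicator {0<..} u *\<^sub>R h u \<partial>lborel) = 0" by (rule integral_eq_zero_AE)
  then show False using h by (simp add: mixing_density_def set_lebesgue_integral_def)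
qed

lemma H_pos: assumes "0 \<le> s" shows "0 < H s"
proof -
  have "H s \<noteq> 0"
  proof
    assume "H s = 0"
    then have "AE v in lborel. \<psi> v * exp (- (s * v / 2)) = 0"
      unfolding H_def using \<psi>_exp_integrable[OF assms]
      by (subst (asm) integral_nonneg_eq_0_iff_AE) (auto simp: \<psi>_nonneg)
    then show False using not_AE_\<psi>_zero by simp
  qed
  then show ?thesis using H_nonneg[of s] by simp
qed

lemma H_antimono: assumes "0 \<le> s" shows "H s \<le> H 0"
  unfolding H_def
proof (rule integral_mono)
  fix v
  show "\<psi> v * exp (- (s * v / 2)) \<le> \<psi> v * exp (- (0 * v / 2))"
  proof (cases "0 < v")
    case True
    then show ?thesis using assms \<psi>_nonneg[of v] by (simp add: mult_left_le)
  qed (simp add: \<psi>_def)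
qed (use \<psi>_exp_integrable[OF assms] \<psi>_integrable in auto)

lemma H_measurable [measurable]: "H \<in> borel_measurable borel"
  unfolding H_def[abs_def] by measurable

lemma E_measurable [measurable]:
  assumes [measurable]: "u \<in> measurable N state_measure" "v \<in> borel_measurable N"
  shows "(\<lambda>w. E (u w) (v w)) \<in> borel_measurable N"
  unfolding E_def by measurable

lemma L_measurable [measurable]:
  assumes [measurable]: "u \<in> measurable N state_measure"
  shows "(\<lambda>w. L (u w)) \<in> borel_measurable N"
  unfolding L_def by measurable

lemma W_measurable [measurable]: "W \<in> borel_measurable borel"
  unfolding W_def[abs_def] by measurable

lemma CC_measurable [measurable]: "CC \<in> borel_measurable borel"
proof -
  interpret S: sigma_finite_measure "state_measure :: ((real^'d^'p) \<times> (real^'d^'d)) measure"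
    by (rule sigma_finite_state)
  show ?thesis unfolding CC_def[abs_def] by measurable
qed

lemma c_measurable [measurable]: "c \<in> borel_measurable borel"
  unfolding c_def[abs_def] by measurable

lemma E_nonneg: "0 \<le> E x z" by (simp add: E_def)
lemma W_nonneg: "0 \<le> W z" by (simp add: W_def prod_nonneg \<psi>_nonneg)
lemma c_nonneg: "0 \<le> c z" by (simp add: c_def)
lemma L_nonneg: "0 \<le> L x" by (simp add: L_def prod_nonneg H_nonneg)

lemma W_zero: "\<not> (\<forall>i. 0 < z $ i) \<Longrightarrow> W z = 0"
  unfolding W_def by (auto simp: \<psi>_def indicator_def)

lemma r_nonneg: "x \<in> space state_measure \<Longrightarrow> 0 \<le> r x i"
  by (auto simp: space_state intro: resid_form_nonneg)

lemma L_pos: assumes "x \<in> space state_measure" shows "0 < L x"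
proof -
  have "0 < det (snd x)" using assms by (auto simp: space_state spd_det_pos)
  then show ?thesis unfolding L_def using H_pos[OF r_nonneg[OF assms]] by (simp add: prod_pos)
qed

lemma E_pos: assumes "x \<in> space state_measure" shows "0 < E x z"
proof -
  have "0 < det (snd x)" using assms by (auto simp: space_state spd_det_pos)
  then show ?thesis unfolding E_def by simp
qed

lemma EW_eq: "E x z * W z = det (snd x) powr (- e) * (\<Prod>i\<in>UNIV. \<psi> (z $ i) * exp (- (r x i * z $ i / 2)))"
proof -
  have "- (1/2) * (\<Sum>i\<in>UNIV. z $ i * r x i) = (\<Sum>i\<in>UNIV. - (r x i * z $ i / 2))"
    by (simp add: sum_negf sum_divide_distrib mult.commute)
  then have "exp (- (1/2) * (\<Sum>i\<in>UNIV. z $ i * r x i)) = (\<Prod>i\<in>UNIV. exp (- (r x i * z $ i / 2)))"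
    by (simp only: exp_sum[OF finite])
  then show ?thesis by (simp add: E_def W_def prod.distrib)
qed

lemma nn_integral_EW:
  assumes x: "x \<in> space state_measure"
  shows "(\<integral>\<^sup>+z. ennreal (E x z * W z) \<partial>lborel) = ennreal (L x)"
proof -
  let ?f = "\<lambda>i v. ennreal (\<psi> v * exp (- (r x i * v / 2)))"
  have "(\<integral>\<^sup>+z. ennreal (E x z * W z) \<partial>lborel)
    = (\<integral>\<^sup>+z. ennreal (det (snd x) powr (- e)) * (\<Prod>i\<in>UNIV. ?f i (z $ i)) \<partial>lborel)"
  proof -
    have "(\<Prod>i\<in>UNIV. ?f i (z $ i)) = ennreal (\<Prod>i\<in>UNIV. \<psi> (z $ i) * exp (- (r x i * z $ i / 2)))" for z :: "real^'n"
      by (rule prod_ennreal) (simp add: \<psi>_nonneg)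
    then show ?thesis
      unfolding EW_eq by (simp add: ennreal_mult prod_nonneg \<psi>_nonneg)
  qed
  also have "\<dots> = ennreal (det (snd x) powr (- e)) * (\<integral>\<^sup>+z. (\<Prod>i\<in>UNIV. ?f i (z $ i)) \<partial>lborel)"
    by (rule nn_integral_cmult) measurable
  also have "(\<integral>\<^sup>+z. (\<Prod>i\<in>UNIV. ?f i (z $ i)) \<partial>lborel) = (\<Prod>i\<in>UNIV. ennreal (H (r x i)))"
    by (subst nn_integral_prod_vec) (auto simp: nn_integral_\<psi>_exp r_nonneg[OF x])
  also have "ennreal (det (snd x) powr (- e)) * \<dots> = ennreal (L x)"
    by (simp add: L_def ennreal_mult prod_nonneg H_nonneg prod_ennreal)
  finally show ?thesis .
qed

lemma cond_z_eq:
  assumes x: "x \<in> space state_measure" and z: "\<And>i. 0 < z $ i"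
  shows "cond_z X y h (fst x) (snd x) z = E x z * W z / L x"
proof -
  have psi: "psi CARD('d) h s u = \<psi> u * exp (- (s * u / 2)) / H s" if "0 < u" for s u
  proof -
    have "(LBINT v:{0<..}. v powr (real CARD('d) / 2) * exp (- (s * v / 2)) * h v) = H s"
      unfolding H_def set_lebesgue_integral_def
      by (rule Bochner_Integration.integral_cong) (auto simp: \<psi>_def)
    then show ?thesis using that by (simp add: psi_def \<psi>_def)
  qed
  have "0 < det (snd x)" using x by (auto simp: space_state spd_det_pos)
  then have "det (snd x) powr (- e) \<noteq> 0" by simp
  then show ?thesis
    unfolding cond_z_def EW_eq L_def by (simp add: psi z prod_dividef)
qed

lemma likelihood_prior_eq:
  assumes x: "x \<in> space state_measure"
  shows "likelihood X y h (fst x) (snd x) * prior a (snd x)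
    = (2 * pi) powr (- (real CARD('n) * real CARD('d) / 2)) * L x"
proof -
  have S: "snd x \<in> spd" using x by (auto simp: space_state)
  define D where "D = det (snd x)"
  have D: "0 < D" using spd_det_pos[OF S] by (simp add: D_def)
  let ?k = "(2 * pi) powr (real CARD('d) / 2) * D powr (1/2)"
  have k: "0 < ?k" using D by simp
  have "(LBINT u:{0<..}. u powr (real CARD('d) / 2) / ?k * exp (- (u / 2) * r x i) * h u) = H (r x i) / ?k" for i
  proof -
    have "(LBINT u:{0<..}. u powr (real CARD('d) / 2) / ?k * exp (- (u / 2) * r x i) * h u)
      = (\<integral>u. \<psi> u * exp (- (r x i * u / 2)) / ?k \<partial>lborel)"
      unfolding set_lebesgue_integral_def
      by (rule Bochner_Integration.integral_cong) (auto simp: \<psi>_def mult.commute)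
    then show ?thesis by (simp add: H_def)
  qed
  then have lik: "likelihood X y h (fst x) (snd x) = (\<Prod>i\<in>UNIV. H (r x i) / ?k)"
    unfolding likelihood_def D_def[symmetric] by (simp only:)
  have "?k ^ CARD('n) = (2 * pi) powr (real CARD('n) * real CARD('d) / 2) * D powr (real CARD('n) / 2)"
    using D by (simp add: power_mult_distrib powr_realpow[symmetric] powr_powr mult.commute)
  moreover have "- e = - a - real CARD('n) / 2" by (simp add: e_def add_divide_distrib)
  then have "D powr (- e) = D powr (- a) / D powr (real CARD('n) / 2)" by (simp only: powr_diff)
  ultimately show ?thesis
    unfolding lik using S by (simp add: prod_dividef prior_def L_def D_def[symmetric] powr_minus_divide)
qed

lemma cond_eq:
  assumes x: "x \<in> space state_measure" and z: "\<And>i. 0 < z $ i"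
  shows "cond_beta X y (snd x) z (fst x) * cond_Sigma X y a z (snd x) = E x z / c z"
proof -
  interpret R: regression X y z by unfold_locales (use S1 z in auto)
  let ?P = "R.P" and ?S = "R.S" and ?\<mu> = "R.\<mu>"
  let ?m = "real CARD('n) - real CARD('p) + 2 * a - real CARD('d) - 1"
  define \<Theta> where "\<Theta> = matrix_inv ?S"
  define K where "K = inv_wishart_kernel ?m \<Theta>"
  define q where "q = (real CARD('n) - real CARD('p) + 2 * a) / 2"
  have iP: "invertible ?P" and iS: "invertible ?S" by (intro spd_invertible R.P_spd R.S_spd)+
  have dP: "0 < det ?P" by (rule spd_det_pos[OF R.P_spd])
  have K: "K \<Sigma> = det \<Sigma> powr (- q) * exp (- (1/2) * trace (?S ** matrix_inv \<Sigma>))" for \<Sigma>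
  proof -
    have "- ((?m + real CARD('d) + 1) / 2) = - q" by (simp add: q_def)
    then show ?thesis
      unfolding K_def inv_wishart_kernel_def \<Theta>_def matrix_inv_matrix_inv[OF iS] by (simp only:)
  qed
  have K0: "0 \<le> K \<Sigma>" for \<Sigma> by (simp add: K)
  define B where "B = (2 * pi) powr (real CARD('p) * real CARD('d) / 2) * det ?P powr (- (real CARD('d) / 2))"
  have B: "0 < B" using dP by (simp add: B_def)
  let ?g = "\<lambda>\<beta> \<Sigma>. exp (- (1/2) * trace (?P ** (\<beta> - ?\<mu>) ** matrix_inv \<Sigma> ** transpose (\<beta> - ?\<mu>)))"
  have eq: "- e = - q + - (real CARD('p) / 2)" by (simp add: e_def q_def field_simps)
  have E: "E (\<beta>, \<Sigma>) z = K \<Sigma> * det \<Sigma> powr (- (real CARD('p) / 2)) * ?g \<beta> \<Sigma>" for \<beta> \<Sigma>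
    unfolding E_def fst_conv snd_conv R.quadratic_decomposition K eq powr_add
    by (simp add: exp_add[symmetric] algebra_simps)
  have inner: "(\<integral>\<^sup>+\<beta>. ennreal (E (\<beta>, \<Sigma>) z) \<partial>lborel) = ennreal B * ennreal (K \<Sigma>)" if S: "\<Sigma> \<in> spd" for \<Sigma>
  proof -
    have d: "0 < det \<Sigma>" by (rule spd_det_pos[OF S])
    have m: "(\<lambda>\<beta>. ennreal (?g \<beta> \<Sigma>)) \<in> borel_measurable lborel"
      unfolding trace_def matrix_matrix_mult_def transpose_def by simp
    have "(\<integral>\<^sup>+\<beta>. ennreal (E (\<beta>, \<Sigma>) z) \<partial>lborel)
      = (\<integral>\<^sup>+\<beta>. ennreal (K \<Sigma> * det \<Sigma> powr (- (real CARD('p) / 2))) * ennreal (?g \<beta> \<Sigma>) \<partial>lborel)"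
      unfolding E by (simp add: ennreal_mult K0)
    also have "\<dots> = ennreal (K \<Sigma> * det \<Sigma> powr (- (real CARD('p) / 2))) * (\<integral>\<^sup>+\<beta>. ennreal (?g \<beta> \<Sigma>) \<partial>lborel)"
      by (rule nn_integral_cmult[OF m])
    also have "\<dots> = ennreal (K \<Sigma> * det \<Sigma> powr (- (real CARD('p) / 2)) * (B * (1 / det \<Sigma>) powr (- (real CARD('p) / 2))))"
      unfolding nn_integral_matrix_gaussian[OF R.P_spd spd_matrix_inv[OF S]] det_matrix_inv[OF spd_invertible[OF S]] B_def
      by (rule ennreal_mult[symmetric]) (use K0 in simp_all)
    also have "K \<Sigma> * det \<Sigma> powr (- (real CARD('p) / 2)) * (B * (1 / det \<Sigma>) powr (- (real CARD('p) / 2))) = B * K \<Sigma>"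
    proof -
      have "det \<Sigma> powr (- (real CARD('p) / 2)) * (1 / det \<Sigma>) powr (- (real CARD('p) / 2)) = 1"
        using d by (simp add: powr_mult[symmetric])
      then show ?thesis by (simp add: ac_simps)
    qed
    finally show ?thesis using B K0 by (simp add: ennreal_mult)
  qed
  have Km: "K \<in> borel_measurable lborel_spd"
  proof -
    have m1: "(\<lambda>\<Sigma>. matrix_inv \<Sigma>) \<in> borel_measurable (lborel_spd :: (real^'d^'d) measure)"
      by (rule matrix_inv_measurable[OF lborel_spd_id_measurable]) (auto simp: space_lborel_spd spd_invertible)
    have "(\<lambda>\<Sigma>. trace (?S ** matrix_inv \<Sigma>)) \<in> borel_measurable lborel_spd"
      unfolding trace_def matrix_matrix_mult_def using m1 by simp
    moreover have "(\<lambda>\<Sigma>. det \<Sigma>) \<in> borel_measurable (lborel_spd :: (real^'d^'d) measure)"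
      by (rule det_measurable[OF lborel_spd_id_measurable])
    ultimately show ?thesis unfolding K[abs_def] by simp
  qed
  have "CC z = (\<integral>\<^sup>+\<Sigma>. \<integral>\<^sup>+\<beta>. ennreal (E (\<beta>, \<Sigma>) z) \<partial>lborel \<partial>lborel_spd)"
  proof -
    interpret LS: sigma_finite_measure "lborel_spd :: (real^'d^'d) measure" by (rule sigma_finite_lborel_spd)
    interpret pair_sigma_finite "lborel :: (real^'d^'p) measure" "lborel_spd :: (real^'d^'d) measure" ..
    have "(\<lambda>x. ennreal (E x z)) \<in> borel_measurable ((lborel :: (real^'d^'p) measure) \<Otimes>\<^sub>M (lborel_spd :: (real^'d^'d) measure))"
      unfolding state_measure_def[symmetric] by measurable
    from nn_integral_snd[OF this] show ?thesis
      by (simp add: CC_def state_measure_def)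
  qed
  also have "\<dots> = (\<integral>\<^sup>+\<Sigma>. ennreal B * ennreal (K \<Sigma>) \<partial>lborel_spd)"
    by (rule nn_integral_cong) (simp add: inner space_lborel_spd)
  also have "\<dots> = ennreal B * (\<integral>\<^sup>+\<Sigma>. ennreal (K \<Sigma>) \<partial>lborel_spd)"
    by (rule nn_integral_cmult) (use Km in simp)
  finally have "c z = B * enn2real (\<integral>\<^sup>+\<Sigma>. ennreal (K \<Sigma>) \<partial>lborel_spd)"
    using B by (simp add: c_def enn2real_mult)
  also have "enn2real (\<integral>\<^sup>+\<Sigma>. ennreal (K \<Sigma>) \<partial>lborel_spd) = (\<integral>\<Sigma>. K \<Sigma> \<partial>lborel_spd)"
    by (rule integral_eq_nn_integral[symmetric, OF Km]) (simp add: K0)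
  finally have c: "c z = B * (\<integral>\<Sigma>. K \<Sigma> \<partial>lborel_spd)" .
  have S\<Theta>: "cond_Sigma X y a z (snd x) = K (snd x) / (\<integral>\<Sigma>. K \<Sigma> \<partial>lborel_spd)"
  proof -
    have "transpose y ** matrix_inv (Q_mat z) ** y - transpose (mu_mat X y z) ** matrix_inv (Omega_mat X z) ** mu_mat X y z = ?S"
      unfolding R.S_def R.matrix_inv_Omega matrix_inv_Q_mat[OF z] R.\<mu>_def ..
    then show ?thesis by (simp add: cond_Sigma_def inv_wishart_density_def K_def \<Theta>_def)
  qed
  have dS: "0 < det (snd x)" using x by (auto simp: space_state spd_det_pos)
  have "cond_beta X y (snd x) z (fst x) = (1 / B) * det (snd x) powr (- (real CARD('p) / 2)) * ?g (fst x) (snd x)"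
  proof -
    have "det (Omega_mat X z) powr (- (real CARD('d) / 2)) = 1 / det ?P powr (- (real CARD('d) / 2))"
      unfolding R.Omega_eq det_matrix_inv[OF iP] using dP by (simp add: powr_divide)
    moreover have "(2 * pi) powr (- (real CARD('p) * real CARD('d) / 2)) = 1 / (2 * pi) powr (real CARD('p) * real CARD('d) / 2)"
      by (rule powr_minus_divide)
    ultimately show ?thesis
      unfolding cond_beta_def matrix_normal_density_def R.matrix_inv_Omega R.\<mu>_def[symmetric] B_def
      by simp
  qed
  then show ?thesis
    using E[of "fst x" "snd x"] B unfolding S\<Theta> c by simp
qed

lemma DA_density_eq:
  assumes x': "x' \<in> space state_measure" and x: "x \<in> space state_measure"
  shows "DA_density X y a h x' x = (\<integral>z. E x' z / c z * (E x z * W z / L x) \<partial>lborel)"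
proof -
  have "DA_density X y a h x' x = (\<integral>z. indicator {z. \<forall>i. 0 < z $ i} z *\<^sub>R
      (cond_beta X y (snd x') z (fst x') * cond_Sigma X y a z (snd x') * cond_z X y h (fst x) (snd x) z) \<partial>lborel)"
    by (simp add: DA_density_def case_prod_beta set_lebesgue_integral_def)
  also have "\<dots> = (\<integral>z. E x' z / c z * (E x z * W z / L x) \<partial>lborel)"
  proof (rule Bochner_Integration.integral_cong[OF refl])
    fix z :: "real^'n"
    show "indicator {z. \<forall>i. 0 < z $ i} z *\<^sub>R
      (cond_beta X y (snd x') z (fst x') * cond_Sigma X y a z (snd x') * cond_z X y h (fst x) (snd x) z)
      = E x' z / c z * (E x z * W z / L x)"
    proof (cases "\<forall>i. 0 < z $ i")
      case True
      then show ?thesis using cond_eq[OF x', of z] cond_z_eq[OF x, of z] by simp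
    next
      case False
      then show ?thesis using W_zero[OF False] by simp
    qed
  qed
  finally show ?thesis .
qed

lemma nn_integral_L_beta_finite:
  assumes S: "\<Sigma> \<in> spd"
  shows "(\<integral>\<^sup>+\<beta>. ennreal (L (\<beta>, \<Sigma>)) \<partial>lborel) < \<infinity>"
proof -
  have X: "X *v v = 0 \<Longrightarrow> v = 0" for v
    using concat_cols_injective[OF S1, of v 0] by simp
  obtain \<rho> :: "'p \<Rightarrow> 'n" where \<rho>: "inj \<rho>" and inv: "invertible ((\<chi> k. X $ \<rho> k) :: real^'p^'p)"
    using invertible_row_selection[OF X] by blast
  define A where "A = ((\<chi> k. X $ \<rho> k) :: real^'p^'p)"
  define w where "w = ((\<chi> k. y $ \<rho> k) :: real^'d^'p)"
  define s where "s \<beta> k = resid_form A w \<beta> \<Sigma> k" for \<beta> k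
  have s: "resid_form X y \<beta> \<Sigma> (\<rho> k) = s \<beta> k" for \<beta> k
    by (simp add: s_def resid_form_def A_def w_def)
  have s0: "0 \<le> s \<beta> k" for \<beta> k unfolding s_def by (rule resid_form_nonneg[OF S])
  have [measurable]: "(\<lambda>\<beta>. s \<beta> k) \<in> borel_measurable borel" for k unfolding s_def by measurable
  let ?G = "matrix_inv \<Sigma>"
  have G: "?G \<in> spd" by (rule spd_matrix_inv[OF S])
  let ?J = "\<bar>det A\<bar> ^ CARD('d)"
  have J: "0 < ?J" using inv by (simp add: A_def invertible_det_nz)
  define q where "q = (2 * pi) powr (real CARD('p) * real CARD('d) / 2) * det ?G powr (- (real CARD('p) / 2)) * (1 / ?J)"
  have q: "0 \<le> q" by (simp add: q_def)
  have gauss: "(\<integral>\<^sup>+\<beta>. ennreal (exp (- (1/2) * (\<Sum>k\<in>UNIV. z $ k * s \<beta> k))) \<partial>lborel)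
      = ennreal (q * (\<Prod>k\<in>UNIV. z $ k powr (- (real CARD('d) / 2))))" if z: "\<And>k. 0 < z $ k" for z :: "real^'p"
  proof -
    have "diag z \<in> spd"
      using gram_spd[of "mat 1" z] z by (simp add: transpose_mat)
    note I = nn_integral_matrix_gaussian[OF this G, of w]
    let ?g = "\<lambda>B :: real^'d^'p. ennreal (exp (- (1/2) * trace (diag z ** (B - w) ** ?G ** transpose (B - w))))"
    have gm: "?g \<in> borel_measurable borel"
      unfolding trace_def matrix_matrix_mult_def transpose_def by simp
    have "ennreal ((2 * pi) powr (real CARD('p) * real CARD('d) / 2) * det (diag z) powr (- (real CARD('d) / 2)) * det ?G powr (- (real CARD('p) / 2)))
      = ennreal ?J * (\<integral>\<^sup>+\<beta>. ?g (A ** \<beta>) \<partial>lborel)"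
      unfolding I[symmetric] by (rule jacobian_nn_integral[OF jacobian_matrix_mult_left gm]) (use inv in \<open>simp add: A_def\<close>)
    from ennreal_mult_eq_imp_eq_divide[OF this J]
    have "(\<integral>\<^sup>+\<beta>. ?g (A ** \<beta>) \<partial>lborel) = ennreal ((2 * pi) powr (real CARD('p) * real CARD('d) / 2) * det (diag z) powr (- (real CARD('d) / 2)) * det ?G powr (- (real CARD('p) / 2)) * (1 / ?J))"
      by simp
    moreover have "det (diag z) = (\<Prod>k\<in>UNIV. z $ k)"
      by (subst det_diagonal) (auto simp: diag_def)
    moreover have "(\<Prod>k\<in>UNIV. z $ k) powr (- (real CARD('d) / 2)) = (\<Prod>k\<in>UNIV. z $ k powr (- (real CARD('d) / 2)))"
      by (rule prod_powr_distrib)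
    moreover have "(\<Sum>k\<in>UNIV. z $ k * s \<beta> k) = trace (diag z ** (A ** \<beta> - w) ** ?G ** transpose (A ** \<beta> - w))" for \<beta>
      unfolding s_def weighted_resid_form by (rule trace_quadratic_minus)
    ultimately show ?thesis by (simp add: q_def ac_simps)
  qed
  have sel: "(\<integral>\<^sup>+\<beta>. (\<Prod>k\<in>UNIV. ennreal (H (s \<beta> k))) \<partial>lborel) < \<infinity>"
  proof -
    let ?f = "\<lambda>\<beta> z. ennreal ((\<Prod>k\<in>UNIV. \<psi> (z $ k)) * exp (- (1/2) * (\<Sum>k\<in>UNIV. z $ k * s \<beta> k)))"
    have f: "?f \<beta> z = (\<Prod>k\<in>UNIV. ennreal (\<psi> (z $ k) * exp (- (s \<beta> k * z $ k / 2))))" for \<beta> and z :: "real^'p"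
    proof -
      have "- (1/2) * (\<Sum>k\<in>UNIV. z $ k * s \<beta> k) = (\<Sum>k\<in>UNIV. - (s \<beta> k * z $ k / 2))"
        by (simp add: sum_negf sum_divide_distrib mult.commute)
      then have "exp (- (1/2) * (\<Sum>k\<in>UNIV. z $ k * s \<beta> k)) = (\<Prod>k\<in>UNIV. exp (- (s \<beta> k * z $ k / 2)))"
        by (simp only: exp_sum[OF finite])
      moreover have "(\<Prod>k\<in>UNIV. ennreal (\<psi> (z $ k) * exp (- (s \<beta> k * z $ k / 2))))
        = ennreal (\<Prod>k\<in>UNIV. \<psi> (z $ k) * exp (- (s \<beta> k * z $ k / 2)))"
        by (rule prod_ennreal) (simp add: \<psi>_nonneg)
      ultimately show ?thesis by (simp add: prod.distrib)
    qed
    have "(\<Prod>k\<in>UNIV. ennreal (H (s \<beta> k))) = (\<integral>\<^sup>+z. ?f \<beta> z \<partial>lborel)" for \<beta>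
      unfolding f by (subst nn_integral_prod_vec) (auto simp: nn_integral_\<psi>_exp s0)
    then have "(\<integral>\<^sup>+\<beta>. (\<Prod>k\<in>UNIV. ennreal (H (s \<beta> k))) \<partial>lborel) = (\<integral>\<^sup>+\<beta>. \<integral>\<^sup>+z. ?f \<beta> z \<partial>lborel \<partial>lborel)"
      by simp
    also have "\<dots> = (\<integral>\<^sup>+z. \<integral>\<^sup>+\<beta>. ?f \<beta> z \<partial>lborel \<partial>lborel)"
      by (rule lborel_pair.Fubini'[symmetric]) measurable
    also have "\<dots> = (\<integral>\<^sup>+z. ennreal q * (\<Prod>k\<in>UNIV. ennreal (indicator {0<..} (z $ k) * h (z $ k))) \<partial>(lborel :: (real^'p) measure))"
    proof (rule nn_integral_cong)
      fix z :: "real^'p"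
      show "(\<integral>\<^sup>+\<beta>. ?f \<beta> z \<partial>lborel) = ennreal q * (\<Prod>k\<in>UNIV. ennreal (indicator {0<..} (z $ k) * h (z $ k)))"
      proof (cases "\<forall>k. 0 < z $ k")
        case True
        have "(\<integral>\<^sup>+\<beta>. ?f \<beta> z \<partial>lborel) = (\<integral>\<^sup>+\<beta>. ennreal (\<Prod>k\<in>UNIV. \<psi> (z $ k)) * ennreal (exp (- (1/2) * (\<Sum>k\<in>UNIV. z $ k * s \<beta> k))) \<partial>lborel)"
          by (simp add: ennreal_mult prod_nonneg \<psi>_nonneg)
        also have "\<dots> = ennreal (\<Prod>k\<in>UNIV. \<psi> (z $ k)) * ennreal (q * (\<Prod>k\<in>UNIV. z $ k powr (- (real CARD('d) / 2))))"
          using True by (subst nn_integral_cmult) (auto simp: gauss[simplified])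
        also have "\<dots> = ennreal (q * (\<Prod>k\<in>UNIV. \<psi> (z $ k) * z $ k powr (- (real CARD('d) / 2))))"
          using q by (simp add: ennreal_mult[symmetric] prod_nonneg \<psi>_nonneg prod.distrib ac_simps)
        also have "(\<Prod>k\<in>UNIV. \<psi> (z $ k) * z $ k powr (- (real CARD('d) / 2))) = (\<Prod>k\<in>UNIV. indicator {0<..} (z $ k) * h (z $ k))"
          by (rule prod.cong) (use True in \<open>auto simp: \<psi>_def powr_minus_divide less_imp_neq[symmetric]\<close>)
        also have "ennreal (q * \<dots>) = ennreal q * ennreal (\<Prod>k\<in>UNIV. indicator {0<..} (z $ k) * h (z $ k))"
          using q True by (intro ennreal_mult prod_nonneg) (auto simp: h_nonneg)
        also have "ennreal (\<Prod>k\<in>UNIV. indicator {0<..} (z $ k) * h (z $ k)) = (\<Prod>k\<in>UNIV. ennreal (indicator {0<..} (z $ k) * h (z $ k)))"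
          using True by (intro prod_ennreal[symmetric]) (auto simp: h_nonneg)
        finally show ?thesis .
      next
        case False
        then obtain k where k: "\<not> 0 < z $ k" by blast
        have p0: "(\<Prod>k\<in>UNIV. \<psi> (z $ k)) = 0" using k by (auto simp: \<psi>_def intro!: exI[of _ k])
        have p1: "(\<Prod>k\<in>UNIV. ennreal (indicator {0<..} (z $ k) * h (z $ k))) = 0"
          using k by (auto intro!: exI[of _ k])
        show ?thesis unfolding p0 p1 by simp
      qed
    qed
    also have "\<dots> = ennreal q * (\<Prod>k\<in>(UNIV :: 'p set). \<integral>\<^sup>+u. ennreal (indicator {0<..} u * h u) \<partial>lborel)"
    proof -
      define h0 where "h0 u = ennreal (indicator {0<..} u * h u)" for u
      have m [measurable]: "h0 \<in> borel_measurable borel"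
        using h by (auto simp: mixing_density_def set_integrable_def h0_def[abs_def])
      have "(\<integral>\<^sup>+z. ennreal q * (\<Prod>k\<in>UNIV. h0 (z $ k)) \<partial>(lborel :: (real^'p) measure))
        = ennreal q * (\<integral>\<^sup>+z. (\<Prod>k\<in>UNIV. h0 (z $ k)) \<partial>(lborel :: (real^'p) measure))"
        by (rule nn_integral_cmult) measurable
      then show ?thesis unfolding nn_integral_prod_vec[OF m] by (simp only: h0_def[abs_def])
    qed
    also have "(\<integral>\<^sup>+u. ennreal (indicator {0<..} u * h u) \<partial>lborel) = ennreal 1"
    proof -
      have "integrable lborel (\<lambda>u. indicator {0<..} u * h u)" "(\<integral>u. indicator {0<..} u * h u \<partial>lborel) = 1"
        using h by (auto simp: mixing_density_def set_integrable_def set_lebesgue_integral_def)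
      then show ?thesis using nn_integral_eq_integral[of lborel "\<lambda>u. indicator {0<..} u * h u"] h_nonneg
        by (auto simp: indicator_def)
    qed
    finally show ?thesis by simp
  qed
  let ?k = "det \<Sigma> powr (- e) * H 0 ^ card (- range \<rho>)"
  have le: "ennreal (L (\<beta>, \<Sigma>)) \<le> ennreal ?k * (\<Prod>k\<in>UNIV. ennreal (H (s \<beta> k)))" for \<beta>
  proof -
    have "(\<Prod>i\<in>UNIV. H (resid_form X y \<beta> \<Sigma> i)) = (\<Prod>i\<in>- range \<rho>. H (resid_form X y \<beta> \<Sigma> i)) * (\<Prod>i\<in>range \<rho>. H (resid_form X y \<beta> \<Sigma> i))"
      unfolding Compl_eq_Diff_UNIV by (rule prod.subset_diff) auto
    also have "(\<Prod>i\<in>range \<rho>. H (resid_form X y \<beta> \<Sigma> i)) = (\<Prod>k\<in>UNIV. H (s \<beta> k))"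
      by (subst prod.reindex[OF \<rho>]) (simp add: s)
    also have "(\<Prod>i\<in>- range \<rho>. H (resid_form X y \<beta> \<Sigma> i)) \<le> (\<Prod>i\<in>- range \<rho>. H 0)"
      by (rule prod_mono) (auto simp: H_nonneg intro: H_antimono resid_form_nonneg[OF S])
    finally have "(\<Prod>i\<in>UNIV. H (resid_form X y \<beta> \<Sigma> i)) \<le> H 0 ^ card (- range \<rho>) * (\<Prod>k\<in>UNIV. H (s \<beta> k))"
      by (simp add: mult_right_mono prod_nonneg H_nonneg)
    then have "L (\<beta>, \<Sigma>) \<le> ?k * (\<Prod>k\<in>UNIV. H (s \<beta> k))"
      unfolding L_def by (simp add: mult.assoc mult_left_mono)
    then have "ennreal (L (\<beta>, \<Sigma>)) \<le> ennreal (?k * (\<Prod>k\<in>UNIV. H (s \<beta> k)))" by (rule ennreal_leI)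
    also have "\<dots> = ennreal ?k * ennreal (\<Prod>k\<in>UNIV. H (s \<beta> k))"
      by (rule ennreal_mult) (auto simp: H_nonneg prod_nonneg)
    also have "ennreal (\<Prod>k\<in>UNIV. H (s \<beta> k)) = (\<Prod>k\<in>UNIV. ennreal (H (s \<beta> k)))"
      by (rule prod_ennreal[symmetric]) (simp add: H_nonneg)
    finally show ?thesis .
  qed
  have "(\<integral>\<^sup>+\<beta>. ennreal (L (\<beta>, \<Sigma>)) \<partial>lborel) \<le> (\<integral>\<^sup>+\<beta>. ennreal ?k * (\<Prod>k\<in>UNIV. ennreal (H (s \<beta> k))) \<partial>lborel)"
    by (rule nn_integral_mono) (rule le)
  also have "\<dots> = ennreal ?k * (\<integral>\<^sup>+\<beta>. (\<Prod>k\<in>UNIV. ennreal (H (s \<beta> k))) \<partial>lborel)"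
    by (rule nn_integral_cmult) measurable
  also have "\<dots> < \<infinity>" using sel by (simp add: ennreal_mult_less_top)
  finally show ?thesis .
qed

end

context da_setting
begin

interpretation SM: sigma_finite_measure "state_measure :: ((real^'d^'p) \<times> (real^'d^'d)) measure"
  by (rule sigma_finite_state)

definition \<kappa> :: real where
  "\<kappa> = (2 * pi) powr (- (real CARD('n) * real CARD('d) / 2))"

lemma \<kappa>_pos: "0 < \<kappa>" by (simp add: \<kappa>_def)

lemma nn_integral_L:
  assumes m: "marginal X y a h \<noteq> 0"
  shows "(\<integral>\<^sup>+x. ennreal (\<kappa> * L x) \<partial>state_measure) = ennreal (marginal X y a h)" "0 < marginal X y a h"
proof -
  define f where "f \<Sigma> = (\<integral>\<beta>. likelihood X y h \<beta> \<Sigma> * prior a \<Sigma> \<partial>lborel)" for \<Sigma>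
  have marg: "marginal X y a h = (\<integral>\<Sigma>. f \<Sigma> \<partial>lborel_spd)" by (simp add: marginal_def f_def)
  have fi: "integrable lborel_spd f" using m unfolding marg by (metis not_integrable_integral_eq)
  have f: "ennreal (f \<Sigma>) = (\<integral>\<^sup>+\<beta>. ennreal (\<kappa> * L (\<beta>, \<Sigma>)) \<partial>lborel)" "0 \<le> f \<Sigma>" if S: "\<Sigma> \<in> spd" for \<Sigma>
  proof -
    have eq: "likelihood X y h \<beta> \<Sigma> * prior a \<Sigma> = \<kappa> * L (\<beta>, \<Sigma>)" for \<beta>
      using likelihood_prior_eq[of "(\<beta>, \<Sigma>)"] S by (simp add: space_state \<kappa>_def)
    have Lm [measurable]: "(\<lambda>\<beta>. L (\<beta>, \<Sigma>)) \<in> borel_measurable lborel"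
    proof -
      have "(\<lambda>\<beta>. (\<beta>, \<Sigma>)) \<in> measurable lborel state_measure"
        unfolding state_measure_def using S by (intro measurable_Pair) (auto simp: space_lborel_spd)
      then show ?thesis by (rule L_measurable)
    qed
    have "integrable lborel (\<lambda>\<beta>. L (\<beta>, \<Sigma>))"
      by (rule integrableI_bounded[OF Lm]) (use nn_integral_L_beta_finite[OF S] in \<open>simp add: L_nonneg\<close>)
    then have "integrable lborel (\<lambda>\<beta>. \<kappa> * L (\<beta>, \<Sigma>))" by simp
    then show "ennreal (f \<Sigma>) = (\<integral>\<^sup>+\<beta>. ennreal (\<kappa> * L (\<beta>, \<Sigma>)) \<partial>lborel)"
      unfolding f_def eq using \<kappa>_pos L_nonneg by (intro nn_integral_eq_integral[symmetric]) auto
    show "0 \<le> f \<Sigma>" unfolding f_def eq using \<kappa>_pos L_nonneg by simp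
  qed
  have f0: "AE \<Sigma> in lborel_spd. 0 \<le> f \<Sigma>" by (rule AE_I2) (simp add: space_lborel_spd f)
  have "(\<integral>\<^sup>+x. ennreal (\<kappa> * L x) \<partial>state_measure) = (\<integral>\<^sup>+\<Sigma>. \<integral>\<^sup>+\<beta>. ennreal (\<kappa> * L (\<beta>, \<Sigma>)) \<partial>lborel \<partial>lborel_spd)"
  proof -
    interpret LS: sigma_finite_measure "lborel_spd :: (real^'d^'d) measure" by (rule sigma_finite_lborel_spd)
    interpret pair_sigma_finite "lborel :: (real^'d^'p) measure" "lborel_spd :: (real^'d^'d) measure" ..
    have "(\<lambda>x. ennreal (\<kappa> * L x)) \<in> borel_measurable ((lborel :: (real^'d^'p) measure) \<Otimes>\<^sub>M (lborel_spd :: (real^'d^'d) measure))"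
      unfolding state_measure_def[symmetric] by measurable
    from nn_integral_snd[OF this] show ?thesis by (simp add: state_measure_def)
  qed
  also have "\<dots> = (\<integral>\<^sup>+\<Sigma>. ennreal (f \<Sigma>) \<partial>lborel_spd)"
    by (rule nn_integral_cong) (simp add: f space_lborel_spd)
  also have "\<dots> = ennreal (marginal X y a h)"
    unfolding marg by (rule nn_integral_eq_integral[OF fi f0])
  finally show "(\<integral>\<^sup>+x. ennreal (\<kappa> * L x) \<partial>state_measure) = ennreal (marginal X y a h)" .
  have "0 \<le> marginal X y a h" unfolding marg by (rule integral_nonneg_AE[OF f0])
  then show "0 < marginal X y a h" using m by simp
qed

lemma CC_scale:
  assumes t: "0 < t"
  shows "CC (t *\<^sub>R z) = ennreal (t ^ card (index_pairs :: 'd set set) * (t ^ CARD('d)) powr (- e)) * CC z"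
proof -
  interpret LS: sigma_finite_measure "lborel_spd :: (real^'d^'d) measure" by (rule sigma_finite_lborel_spd)
  have CC: "CC z = (\<integral>\<^sup>+\<beta>. \<integral>\<^sup>+\<Sigma>. ennreal (E (\<beta>, \<Sigma>) z) \<partial>lborel_spd \<partial>lborel)" for z
  proof -
    have "(\<lambda>x. ennreal (E x z)) \<in> borel_measurable ((lborel :: (real^'d^'p) measure) \<Otimes>\<^sub>M (lborel_spd :: (real^'d^'d) measure))"
      unfolding state_measure_def[symmetric] by measurable
    from LS.nn_integral_fst[OF this] show ?thesis by (simp add: CC_def state_measure_def)
  qed
  have m: "(\<lambda>\<Sigma>. ennreal (E (\<beta>, \<Sigma>) z)) \<in> borel_measurable lborel_spd" for \<beta> z
  proof -
    have "(\<lambda>\<Sigma>. (\<beta>, \<Sigma>)) \<in> measurable lborel_spd state_measure"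
      unfolding state_measure_def by measurable
    then show ?thesis by measurable
  qed
  have sc: "E (\<beta>, t *\<^sub>R \<Sigma>) (t *\<^sub>R z) = (t ^ CARD('d)) powr (- e) * E (\<beta>, \<Sigma>) z" if "\<Sigma> \<in> spd" for \<beta> \<Sigma>
  proof -
    have "(\<Sum>i\<in>UNIV. (t *\<^sub>R z) $ i * resid_form X y \<beta> (t *\<^sub>R \<Sigma>) i) = (\<Sum>i\<in>UNIV. z $ i * resid_form X y \<beta> \<Sigma> i)"
      using t by (intro sum.cong) (simp_all add: resid_form_scaleR[OF that t])
    then show ?thesis
      using t spd_det_pos[OF that] by (simp add: E_def det_scaleR powr_mult)
  qed
  let ?k = "t ^ card (index_pairs :: 'd set set)"
  have inner: "(\<integral>\<^sup>+\<Sigma>. ennreal (E (\<beta>, \<Sigma>) (t *\<^sub>R z)) \<partial>lborel_spd)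
    = ennreal (?k * (t ^ CARD('d)) powr (- e)) * (\<integral>\<^sup>+\<Sigma>. ennreal (E (\<beta>, \<Sigma>) z) \<partial>lborel_spd)" for \<beta>
  proof -
    have "(\<integral>\<^sup>+\<Sigma>. ennreal (E (\<beta>, \<Sigma>) (t *\<^sub>R z)) \<partial>lborel_spd)
      = ennreal ?k * (\<integral>\<^sup>+\<Sigma>. ennreal (E (\<beta>, t *\<^sub>R \<Sigma>) (t *\<^sub>R z)) \<partial>lborel_spd)"
      by (rule nn_integral_spd_scale[OF t m])
    also have "(\<integral>\<^sup>+\<Sigma>. ennreal (E (\<beta>, t *\<^sub>R \<Sigma>) (t *\<^sub>R z)) \<partial>lborel_spd)
      = (\<integral>\<^sup>+\<Sigma>. ennreal ((t ^ CARD('d)) powr (- e)) * ennreal (E (\<beta>, \<Sigma>) z) \<partial>lborel_spd)"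
      by (rule nn_integral_cong) (simp add: sc space_lborel_spd ennreal_mult E_nonneg)
    also have "\<dots> = ennreal ((t ^ CARD('d)) powr (- e)) * (\<integral>\<^sup>+\<Sigma>. ennreal (E (\<beta>, \<Sigma>) z) \<partial>lborel_spd)"
      by (rule nn_integral_cmult[OF m])
    finally show ?thesis using t by (simp add: ennreal_mult mult.assoc)
  qed
  have "(\<lambda>\<beta>. \<integral>\<^sup>+\<Sigma>. ennreal (E (\<beta>, \<Sigma>) z) \<partial>lborel_spd) \<in> borel_measurable (lborel :: (real^'d^'p) measure)"
  proof -
    have "(\<lambda>x. ennreal (E x z)) \<in> borel_measurable ((lborel :: (real^'d^'p) measure) \<Otimes>\<^sub>M (lborel_spd :: (real^'d^'d) measure))"
      unfolding state_measure_def[symmetric] by measurable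
    from LS.borel_measurable_nn_integral_fst[OF this] show ?thesis .
  qed
  then show ?thesis unfolding CC inner by (rule nn_integral_cmult)
qed

definition \<Psi> :: "real \<Rightarrow> real" where "\<Psi> = cumulative \<psi>"

lemma \<Psi>_nonneg: "0 \<le> \<Psi> t"
  unfolding \<Psi>_def by (rule cumulative_nonneg) (rule \<psi>_nonneg)

lemma H_ge:
  assumes "0 \<le> s" "0 < t"
  shows "exp (- (s * t / 2)) * \<Psi> t \<le> H s"
proof -
  have i: "integrable lborel (\<lambda>v. indicator {0<..t} v *\<^sub>R \<psi> v)"
    using integrable_mult_indicator[OF _ \<psi>_integrable, of "{0<..t}"] by simp
  have "exp (- (s * t / 2)) * \<Psi> t = (\<integral>v. exp (- (s * t / 2)) * (indicator {0<..t} v *\<^sub>R \<psi> v) \<partial>lborel)"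
    by (simp add: \<Psi>_def cumulative_def set_lebesgue_integral_def)
  also have "\<dots> \<le> H s"
    unfolding H_def
  proof (rule integral_mono)
    show "integrable lborel (\<lambda>v. exp (- (s * t / 2)) * (indicator {0<..t} v *\<^sub>R \<psi> v))"
      using i by simp
    show "integrable lborel (\<lambda>v. \<psi> v * exp (- (s * v / 2)))" by (rule \<psi>_exp_integrable[OF assms(1)])
    fix v
    show "exp (- (s * t / 2)) * (indicator {0<..t} v *\<^sub>R \<psi> v) \<le> \<psi> v * exp (- (s * v / 2))"
    proof (cases "v \<in> {0<..t}")
      case True
      then have "exp (- (s * t / 2)) \<le> exp (- (s * v / 2))" using assms by (simp add: mult_left_mono)
      then show ?thesis using True \<psi>_nonneg[of v] by (simp add: mult.commute mult_left_mono)
    next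
      case False
      then show ?thesis using \<psi>_nonneg[of v] by simp
    qed
  qed
  finally show ?thesis .
qed

definition D :: "real \<Rightarrow> real \<Rightarrow> ennreal" where
  "D \<zeta> u = ennreal (\<psi> u) / ennreal (\<Psi> (\<zeta> * u))"

lemma factor_le:
  assumes s: "0 \<le> s" and u: "0 < u" and \<zeta>: "0 < \<zeta>"
  shows "ennreal (\<psi> u * exp (- (s * u)) / H s) \<le> D \<zeta> u * ennreal (exp (- ((2 - \<zeta>) * u * s / 2)))"
proof (cases "\<psi> u = 0 \<or> \<Psi> (\<zeta> * u) = 0")
  case True
  then show ?thesis
    using \<psi>_nonneg[of u] by (auto simp: D_def ennreal_divide_zero ennreal_top_mult less_le)
next
  case False
  then have p: "0 < \<Psi> (\<zeta> * u)" using \<Psi>_nonneg[of "\<zeta> * u"] by simp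
  have H: "exp (- (s * (\<zeta> * u) / 2)) * \<Psi> (\<zeta> * u) \<le> H s" using s u \<zeta> by (intro H_ge) auto
  have "\<psi> u * exp (- (s * u)) / H s \<le> \<psi> u * exp (- (s * u)) / (exp (- (s * (\<zeta> * u) / 2)) * \<Psi> (\<zeta> * u))"
    using H p \<psi>_nonneg[of u] H_pos[OF s] by (intro divide_left_mono) auto
  also have "\<dots> = \<psi> u / \<Psi> (\<zeta> * u) * (exp (- (s * u)) / exp (- (s * (\<zeta> * u) / 2)))" by simp
  also have "exp (- (s * u)) / exp (- (s * (\<zeta> * u) / 2)) = exp (- ((2 - \<zeta>) * u * s / 2))"
    unfolding exp_diff[symmetric] by (rule arg_cong[of _ _ exp]) (simp add: field_simps)
  finally have "ennreal (\<psi> u * exp (- (s * u)) / H s) \<le> ennreal (\<psi> u / \<Psi> (\<zeta> * u) * exp (- ((2 - \<zeta>) * u * s / 2)))"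
    by (rule ennreal_leI)
  also have "\<dots> = D \<zeta> u * ennreal (exp (- ((2 - \<zeta>) * u * s / 2)))"
  proof -
    have "D \<zeta> u = ennreal (\<psi> u / \<Psi> (\<zeta> * u))"
      using p \<psi>_nonneg[of u] by (simp add: D_def divide_ennreal)
    then show ?thesis using p \<psi>_nonneg[of u] by (simp only: ennreal_mult divide_nonneg_pos exp_ge_zero)
  qed
  finally show ?thesis .
qed

lemma \<Psi>_measurable [measurable]: "\<Psi> \<in> borel_measurable borel"
proof -
  have "mono \<Psi>"
  proof (rule monoI)
    fix s t :: real assume "s \<le> t"
    have "set_integrable lborel {0<..} \<psi>"
      using integrable_mult_indicator[OF _ \<psi>_integrable, of "{0<..}"] by (simp add: set_integrable_def)
    then show "\<Psi> s \<le> \<Psi> t" unfolding \<Psi>_def using \<psi>_nonneg \<open>s \<le> t\<close> by (intro cumulative_mono)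
  qed
  then show ?thesis by (rule borel_measurable_mono)
qed

lemma D_measurable [measurable]: "D \<zeta> \<in> borel_measurable borel"
  unfolding D_def[abs_def] by measurable

lemma trace_bound:
  assumes \<zeta>: "1 < \<zeta>" "\<zeta> < 2" and D: "(\<integral>\<^sup>+u. D \<zeta> u \<partial>lborel) < \<infinity>"
  shows "(\<integral>\<^sup>+z. \<integral>\<^sup>+x. ennreal ((E x z)\<^sup>2 * W z / (c z * L x)) \<partial>state_measure \<partial>lborel) < \<infinity>"
proof -
  let ?t = "2 - \<zeta>"
  let ?C = "ennreal (?t ^ card (index_pairs :: 'd set set) * (?t ^ CARD('d)) powr (- e))"
  have t: "0 < ?t" using \<zeta> by simp
  have pw: "ennreal ((E x z)\<^sup>2 * W z / (c z * L x)) \<le> ennreal (1 / c z) * (\<Prod>i\<in>UNIV. D \<zeta> (z $ i)) * ennreal (E x (?t *\<^sub>R z))"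
    if x: "x \<in> space state_measure" for x z
  proof (cases "\<forall>i. 0 < z $ i")
    case False
    then show ?thesis by (simp add: W_zero)
  next
    case True
    define d where "d = det (snd x) powr (- e)"
    have d: "0 < d" using x by (auto simp: d_def space_state dest!: spd_det_pos)
    have r0: "0 \<le> r x i" for i by (rule r_nonneg[OF x])
    have Ed: "E x w = d * (\<Prod>i\<in>UNIV. exp (- (w $ i * r x i / 2)))" for w
    proof -
      have "- (1/2) * (\<Sum>i\<in>UNIV. w $ i * r x i) = (\<Sum>i\<in>UNIV. - (w $ i * r x i / 2))"
        by (simp add: sum_negf sum_divide_distrib)
      then show ?thesis unfolding E_def d_def by (simp only: exp_sum[OF finite])
    qed
    have eq: "(E x z)\<^sup>2 * W z / (c z * L x) = 1 / c z * (d * (\<Prod>i\<in>UNIV. \<psi> (z $ i) * exp (- (r x i * z $ i)) / H (r x i)))"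
    proof -
      have "(\<Prod>i\<in>UNIV. exp (- (z $ i * r x i / 2)))\<^sup>2 = (\<Prod>i\<in>UNIV. exp (- (r x i * z $ i)))"
        unfolding prod_power_distrib by (simp add: exp_double[symmetric] mult.commute)
      then have "(E x z)\<^sup>2 = d\<^sup>2 * (\<Prod>i\<in>UNIV. exp (- (r x i * z $ i)))" by (simp add: Ed power_mult_distrib)
      moreover have "L x = d * (\<Prod>i\<in>UNIV. H (r x i))" by (simp add: L_def d_def)
      ultimately show ?thesis
        using d by (simp add: W_def prod.distrib prod_dividef power2_eq_square)
    qed
    have "ennreal ((E x z)\<^sup>2 * W z / (c z * L x)) = ennreal (1 / c z) * (ennreal d * (\<Prod>i\<in>UNIV. ennreal (\<psi> (z $ i) * exp (- (r x i * z $ i)) / H (r x i))))"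
    proof -
      let ?p = "\<lambda>i. \<psi> (z $ i) * exp (- (r x i * z $ i)) / H (r x i)"
      have p: "0 \<le> ?p i" for i by (simp add: \<psi>_nonneg H_nonneg)
      have "ennreal (1 / c z * (d * prod ?p UNIV)) = ennreal (1 / c z) * (ennreal d * ennreal (prod ?p UNIV))"
        using d p c_nonneg[of z] by (simp only: ennreal_mult prod_nonneg mult_nonneg_nonneg less_imp_le divide_nonneg_nonneg zero_le_one)
      also have "ennreal (prod ?p UNIV) = (\<Prod>i\<in>UNIV. ennreal (?p i))"
        by (rule prod_ennreal[symmetric]) (rule p)
      finally show ?thesis unfolding eq .
    qed
    also have "\<dots> \<le> ennreal (1 / c z) * (ennreal d * (\<Prod>i\<in>UNIV. D \<zeta> (z $ i) * ennreal (exp (- (?t * z $ i * r x i / 2)))))"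
    proof -
      have "(\<Prod>i\<in>UNIV. ennreal (\<psi> (z $ i) * exp (- (r x i * z $ i)) / H (r x i)))
        \<le> (\<Prod>i\<in>UNIV. D \<zeta> (z $ i) * ennreal (exp (- (?t * z $ i * r x i / 2))))"
      proof (rule prod_mono_ennreal)
        fix i :: 'n
        show "ennreal (\<psi> (z $ i) * exp (- (r x i * z $ i)) / H (r x i)) \<le> D \<zeta> (z $ i) * ennreal (exp (- (?t * z $ i * r x i / 2)))"
          by (rule factor_le[OF r0]) (use True \<zeta> in auto)
      qed
      then show ?thesis by (intro mult_left_mono zero_le)
    qed
    also have "\<dots> = ennreal (1 / c z) * (\<Prod>i\<in>UNIV. D \<zeta> (z $ i)) * ennreal (E x (?t *\<^sub>R z))"
    proof -
      have "ennreal (E x (?t *\<^sub>R z)) = ennreal d * ennreal (\<Prod>i\<in>UNIV. exp (- (?t * z $ i * r x i / 2)))"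
        unfolding Ed vector_scaleR_component real_scaleR_def
        using d by (intro ennreal_mult) (auto intro: prod_nonneg)
      also have "ennreal (\<Prod>i\<in>UNIV. exp (- (?t * z $ i * r x i / 2))) = (\<Prod>i\<in>UNIV. ennreal (exp (- (?t * z $ i * r x i / 2))))"
        by (rule prod_ennreal[symmetric]) simp
      finally show ?thesis by (simp only: prod.distrib ac_simps)
    qed
    finally show ?thesis .
  qed
  have le1: "ennreal (1 / c z) * CC z \<le> 1" for z
  proof (cases "c z = 0")
    case False
    then have "CC z = ennreal (c z)" by (auto simp: c_def) (metis enn2real_eq_0_iff ennreal_enn2real top.not_eq_extremum)
    then show ?thesis using c_nonneg[of z] False by (simp add: ennreal_mult[symmetric])
  qed simp
  have "(\<integral>\<^sup>+z. \<integral>\<^sup>+x. ennreal ((E x z)\<^sup>2 * W z / (c z * L x)) \<partial>state_measure \<partial>lborel)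
    \<le> (\<integral>\<^sup>+z. \<integral>\<^sup>+x. ennreal (1 / c z) * (\<Prod>i\<in>UNIV. D \<zeta> (z $ i)) * ennreal (E x (?t *\<^sub>R z)) \<partial>state_measure \<partial>lborel)"
    by (intro nn_integral_mono pw) auto
  also have "\<dots> = (\<integral>\<^sup>+z. ennreal (1 / c z) * (\<Prod>i\<in>UNIV. D \<zeta> (z $ i)) * CC (?t *\<^sub>R z) \<partial>lborel)"
    unfolding CC_def by (intro nn_integral_cong nn_integral_cmult) measurable
  also have "\<dots> \<le> (\<integral>\<^sup>+z. ?C * (\<Prod>i\<in>UNIV. D \<zeta> (z $ i)) \<partial>(lborel :: (real^'n) measure))"
  proof (rule nn_integral_mono)
    fix z :: "real^'n"
    have "ennreal (1 / c z) * (\<Prod>i\<in>UNIV. D \<zeta> (z $ i)) * CC (?t *\<^sub>R z)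
      = ?C * (\<Prod>i\<in>UNIV. D \<zeta> (z $ i)) * (ennreal (1 / c z) * CC z)"
      unfolding CC_scale[OF t] by (simp only: ac_simps)
    also have "\<dots> \<le> ?C * (\<Prod>i\<in>UNIV. D \<zeta> (z $ i)) * 1" by (intro mult_left_mono le1) simp
    finally show "ennreal (1 / c z) * (\<Prod>i\<in>UNIV. D \<zeta> (z $ i)) * CC (?t *\<^sub>R z) \<le> ?C * (\<Prod>i\<in>UNIV. D \<zeta> (z $ i))"
      by simp
  qed
  also have "\<dots> = ?C * (\<integral>\<^sup>+z. (\<Prod>i\<in>UNIV. D \<zeta> (z $ i)) \<partial>(lborel :: (real^'n) measure))"
    by (rule nn_integral_cmult) measurable
  also have "(\<integral>\<^sup>+z. (\<Prod>i\<in>UNIV. D \<zeta> (z $ i)) \<partial>(lborel :: (real^'n) measure)) = (\<integral>\<^sup>+u. D \<zeta> u \<partial>lborel) ^ CARD('n)"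
    by (subst nn_integral_prod_vec) auto
  also have "?C * \<dots> < \<infinity>" using D by (simp add: ennreal_mult_less_top power_less_top_ennreal)
  finally show ?thesis .
qed

end

context da_setting
begin

interpretation SM: sigma_finite_measure "state_measure :: ((real^'d^'p) \<times> (real^'d^'d)) measure"
  by (rule sigma_finite_state)

interpretation SL: pair_sigma_finite "state_measure :: ((real^'d^'p) \<times> (real^'d^'d)) measure" "lborel :: (real^'n) measure" ..

lemma posterior_eq:
  "posterior X y a h = density state_measure (\<lambda>x. ennreal (\<kappa> / marginal X y a h * L x))"
proof -
  have eq: "posterior_density X y a h x = \<kappa> / marginal X y a h * L x" if "x \<in> space state_measure" for x
    using likelihood_prior_eq[OF that] by (simp add: posterior_density_def case_prod_beta \<kappa>_def)
  have m: "(\<lambda>x. ennreal (\<kappa> / marginal X y a h * L x)) \<in> borel_measurable state_measure" by measurable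
  then have m': "(\<lambda>x. ennreal (posterior_density X y a h x)) \<in> borel_measurable state_measure"
    by (subst measurable_cong[where g="\<lambda>x. ennreal (\<kappa> / marginal X y a h * L x)"]) (simp_all add: eq)
  show ?thesis unfolding posterior_def
    by (rule density_cong[OF m' m]) (auto intro!: AE_I2 simp: eq)
qed

lemma AE_normalizer:
  assumes m: "marginal X y a h \<noteq> 0"
  shows "AE z in lborel. W z = 0 \<or> (0 < c z \<and> CC z = ennreal (c z))"
proof -
  have fin: "(\<integral>\<^sup>+x. ennreal (L x) \<partial>state_measure) < \<infinity>" "(\<integral>\<^sup>+x. ennreal (L x) \<partial>state_measure) \<noteq> 0"
  proof -
    have "(\<integral>\<^sup>+x. ennreal (\<kappa> * L x) \<partial>state_measure) = ennreal \<kappa> * (\<integral>\<^sup>+x. ennreal (L x) \<partial>state_measure)"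
      using \<kappa>_pos by (subst nn_integral_cmult[symmetric]) (auto simp: ennreal_mult L_nonneg)
    then have "ennreal \<kappa> * (\<integral>\<^sup>+x. ennreal (L x) \<partial>state_measure) = ennreal (marginal X y a h)"
      using nn_integral_L(1)[OF m] by simp
    from ennreal_mult_eq_imp_eq_divide[OF this[symmetric] \<kappa>_pos] nn_integral_L(2)[OF m]
    have "(\<integral>\<^sup>+x. ennreal (L x) \<partial>state_measure) = ennreal (marginal X y a h * (1 / \<kappa>))" by simp
    then show "(\<integral>\<^sup>+x. ennreal (L x) \<partial>state_measure) < \<infinity>" "(\<integral>\<^sup>+x. ennreal (L x) \<partial>state_measure) \<noteq> 0"
      using nn_integral_L(2)[OF m] \<kappa>_pos by auto
  qed
  have "(\<integral>\<^sup>+x. ennreal (L x) \<partial>state_measure) = (\<integral>\<^sup>+x. \<integral>\<^sup>+z. ennreal (E x z * W z) \<partial>lborel \<partial>state_measure)"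
    by (rule nn_integral_cong) (simp add: nn_integral_EW)
  also have "\<dots> = (\<integral>\<^sup>+z. \<integral>\<^sup>+x. ennreal (E x z * W z) \<partial>state_measure \<partial>lborel)"
    by (rule SL.Fubini'[symmetric]) measurable
  also have "\<dots> = (\<integral>\<^sup>+z. CC z * ennreal (W z) \<partial>lborel)"
    unfolding CC_def by (intro nn_integral_cong) (simp add: ennreal_mult E_nonneg W_nonneg nn_integral_multc)
  finally have "(\<integral>\<^sup>+z. CC z * ennreal (W z) \<partial>lborel) \<noteq> \<infinity>" using fin(1) by simp
  then have AE_fin: "AE z in lborel. CC z * ennreal (W z) \<noteq> \<infinity>"
    by (intro nn_integral_noteq_infinite) measurable
  have CC0: "CC z \<noteq> 0" for z
  proof
    assume "CC z = 0"
    then have "AE x in state_measure. ennreal (E x z) = 0"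
      unfolding CC_def by (subst (asm) nn_integral_0_iff_AE) measurable
    then have "AE x in state_measure. ennreal (L x) = 0"
      using AE_space
    proof eventually_elim
      case (elim x)
      then show ?case using E_pos[of x z] by simp
    qed
    then have "(\<integral>\<^sup>+x. ennreal (L x) \<partial>state_measure) = 0"
      by (subst nn_integral_0_iff_AE) measurable
    then show False using fin(2) by simp
  qed
  from AE_fin show ?thesis
  proof eventually_elim
    case (elim z)
    show ?case
    proof (cases "W z = 0")
      case False
      then have "CC z \<noteq> \<infinity>" using elim W_nonneg[of z] by (auto simp: ennreal_top_mult)
      then have "CC z = ennreal (c z)" by (simp add: c_def less_top)
      moreover have "c z \<noteq> 0" using CC0[of z] calculation by auto
      ultimately show ?thesis using c_nonneg[of z] by simp
    qed simp
  qed
qed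

lemma trace_class_nonnull:
  assumes m: "marginal X y a h \<noteq> 0" and \<zeta>: "1 < \<zeta>" "\<zeta> < 2" and D: "(\<integral>\<^sup>+u. D \<zeta> u \<partial>lborel) < \<infinity>"
  shows "trace_class_on_L20 (posterior X y a h) (DA_operator X y a h)"
proof -
  define M where "M = posterior X y a h"
  define k where "k = \<kappa> / marginal X y a h"
  have k: "0 < k" using \<kappa>_pos nn_integral_L(2)[OF m] by (simp add: k_def)
  have M: "M = density state_measure (\<lambda>x. ennreal (k * L x))"
    unfolding M_def k_def by (rule posterior_eq)
  have sM [measurable_cong]: "sets M = sets state_measure" by (simp add: M)
  have spM: "space M = space state_measure" by (simp add: M)
  have nnM: "(\<integral>\<^sup>+x. f x \<partial>M) = (\<integral>\<^sup>+x. ennreal (k * L x) * f x \<partial>state_measure)"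
    if "f \<in> borel_measurable state_measure" for f
    unfolding M by (rule nn_integral_density) (use that in measurable)
  have total: "(\<integral>\<^sup>+x. ennreal (k * L x) \<partial>state_measure) = 1"
  proof -
    have "(\<integral>\<^sup>+x. ennreal (k * L x) \<partial>state_measure) = (\<integral>\<^sup>+x. ennreal (1 / marginal X y a h) * ennreal (\<kappa> * L x) \<partial>state_measure)"
      using nn_integral_L(2)[OF m] \<kappa>_pos by (simp add: ennreal_mult[symmetric] L_nonneg k_def)
    also have "\<dots> = ennreal (1 / marginal X y a h) * ennreal (marginal X y a h)"
      by (subst nn_integral_cmult) (auto simp: nn_integral_L(1)[OF m])
    also have "\<dots> = 1" using nn_integral_L(2)[OF m] by (simp add: ennreal_mult[symmetric])
    finally show ?thesis .
  qed
  define \<phi> where "\<phi> x z = E x z * sqrt (k * W z / c z) / (k * L x)" for x z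
  have \<phi>m: "(\<lambda>w. \<phi> (u w) (v w)) \<in> borel_measurable N"
    if [measurable]: "u \<in> measurable N state_measure" "v \<in> borel_measurable N" for u v and N :: "'z measure"
    unfolding \<phi>_def by measurable
  have \<phi>0: "0 \<le> \<phi> x z" for x z
    unfolding \<phi>_def using k E_nonneg W_nonneg c_nonneg L_nonneg by simp
  have \<phi>\<phi>: "k * L x' * (\<phi> x z * \<phi> x' z) = E x' z / c z * (E x z * W z / L x)"
    if "x \<in> space state_measure" "x' \<in> space state_measure" for x x' z
  proof -
    have t: "0 \<le> k * W z / c z" using k W_nonneg c_nonneg by simp
    define q where "q = sqrt (k * W z / c z)"
    have "k * L x' * (\<phi> x z * \<phi> x' z) = E x z * E x' z * (q * q) / (k * L x)"
      unfolding \<phi>_def q_def[symmetric] using L_pos[OF that(2)] k by simp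
    also have "q * q = k * W z / c z"
      unfolding q_def power2_eq_square[symmetric] by (rule real_sqrt_pow2[OF t])
    finally show ?thesis using k by simp
  qed
  interpret mixture_operator M lborel "UNIV \<times> spd" \<phi> "DA_operator X y a h"
  proof (intro mixture_operator.intro mixture_operator_axioms.intro)
    have "emeasure M (space M) = 1"
      unfolding M by (subst emeasure_density) (auto simp: total intro!: trans[OF nn_integral_cong total])
    then show "finite_measure M" by (intro finite_measureI) simp
    show "sigma_finite_measure (lborel :: (real^'n) measure)" by (rule lborel.sigma_finite_measure_axioms)
    show "sets M = sets (restrict_space borel (UNIV \<times> spd))"
      unfolding sM by (rule sets_state_measure)
    show "case_prod \<phi> \<in> borel_measurable (M \<Otimes>\<^sub>M lborel)"
    proof -
      have "(\<lambda>w. \<phi> (fst w) (snd w)) \<in> borel_measurable (M \<Otimes>\<^sub>M lborel)"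
        by (rule \<phi>m) measurable
      then show ?thesis by (simp add: case_prod_beta')
    qed
    show "0 \<le> \<phi> x z" for x z by (rule \<phi>0)
    have \<phi>x: "(\<lambda>z. \<phi> x z) \<in> borel_measurable lborel" if "x \<in> space state_measure" for x
      by (rule \<phi>m) (use that in auto)
    have \<phi>2: "(\<lambda>w. \<phi> (fst w) (snd w)) \<in> borel_measurable (state_measure \<Otimes>\<^sub>M lborel)"
      by (rule \<phi>m) measurable
    show "(\<integral>\<^sup>+x. \<integral>\<^sup>+z. ennreal ((\<phi> x z)\<^sup>2) \<partial>lborel \<partial>M) < \<infinity>"
    proof -
      have "(\<lambda>x. \<integral>\<^sup>+z. ennreal ((\<phi> x z)\<^sup>2) \<partial>lborel) \<in> borel_measurable state_measure"
        using \<phi>2 by (intro lborel.borel_measurable_nn_integral) (simp add: case_prod_beta')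
      then have "(\<integral>\<^sup>+x. \<integral>\<^sup>+z. ennreal ((\<phi> x z)\<^sup>2) \<partial>lborel \<partial>M)
        = (\<integral>\<^sup>+x. ennreal (k * L x) * (\<integral>\<^sup>+z. ennreal ((\<phi> x z)\<^sup>2) \<partial>lborel) \<partial>state_measure)"
        by (rule nnM)
      also have "\<dots> = (\<integral>\<^sup>+x. \<integral>\<^sup>+z. ennreal ((E x z)\<^sup>2 * W z / (c z * L x)) \<partial>lborel \<partial>state_measure)"
      proof (rule nn_integral_cong)
        fix x assume x: "x \<in> space (state_measure :: ((real^'d^'p) \<times> (real^'d^'d)) measure)"
        have "ennreal (k * L x) * (\<integral>\<^sup>+z. ennreal ((\<phi> x z)\<^sup>2) \<partial>lborel) = (\<integral>\<^sup>+z. ennreal (k * L x) * ennreal ((\<phi> x z)\<^sup>2) \<partial>lborel)"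
          by (rule nn_integral_cmult[symmetric]) (use \<phi>x[OF x] in simp)
        also have "\<dots> = (\<integral>\<^sup>+z. ennreal ((E x z)\<^sup>2 * W z / (c z * L x)) \<partial>lborel)"
        proof (rule nn_integral_cong)
          fix z
          have "k * L x * (\<phi> x z)\<^sup>2 = (E x z)\<^sup>2 * W z / (c z * L x)"
            using \<phi>\<phi>[OF x x, of z] by (simp add: power2_eq_square ac_simps)
          then show "ennreal (k * L x) * ennreal ((\<phi> x z)\<^sup>2) = ennreal ((E x z)\<^sup>2 * W z / (c z * L x))"
            using k L_nonneg by (simp add: ennreal_mult[symmetric])
        qed
        finally show "ennreal (k * L x) * (\<integral>\<^sup>+z. ennreal ((\<phi> x z)\<^sup>2) \<partial>lborel)
          = (\<integral>\<^sup>+z. ennreal ((E x z)\<^sup>2 * W z / (c z * L x)) \<partial>lborel)" .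
      qed
      also have "\<dots> = (\<integral>\<^sup>+z. \<integral>\<^sup>+x. ennreal ((E x z)\<^sup>2 * W z / (c z * L x)) \<partial>state_measure \<partial>lborel)"
        by (rule SL.Fubini'[symmetric]) measurable
      also have "\<dots> < \<infinity>" by (rule trace_bound[OF \<zeta> D])
      finally show ?thesis .
    qed
    show "AE x in M. (\<integral>\<^sup>+x'. \<integral>\<^sup>+z. ennreal (\<phi> x z * \<phi> x' z) \<partial>lborel \<partial>M) = 1"
    proof (rule AE_I2)
      fix x assume "x \<in> space M"
      then have x: "x \<in> space state_measure" by (simp add: spM)
      have m2: "(\<lambda>w. \<phi> x (snd w) * \<phi> (fst w) (snd w)) \<in> borel_measurable (state_measure \<Otimes>\<^sub>M lborel)"
        by (rule borel_measurable_times[OF measurable_compose[OF measurable_snd \<phi>x[OF x]] \<phi>2])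
      have "(\<lambda>x'. \<integral>\<^sup>+z. ennreal (\<phi> x z * \<phi> x' z) \<partial>lborel) \<in> borel_measurable state_measure"
        using m2 by (intro lborel.borel_measurable_nn_integral) (simp add: case_prod_beta')
      then have "(\<integral>\<^sup>+x'. \<integral>\<^sup>+z. ennreal (\<phi> x z * \<phi> x' z) \<partial>lborel \<partial>M)
        = (\<integral>\<^sup>+x'. ennreal (k * L x') * (\<integral>\<^sup>+z. ennreal (\<phi> x z * \<phi> x' z) \<partial>lborel) \<partial>state_measure)"
        by (rule nnM)
      also have "\<dots> = (\<integral>\<^sup>+x'. \<integral>\<^sup>+z. ennreal (E x' z) * ennreal (E x z * W z / (c z * L x)) \<partial>lborel \<partial>state_measure)"
      proof (rule nn_integral_cong)
        fix x' assume x': "x' \<in> space (state_measure :: ((real^'d^'p) \<times> (real^'d^'d)) measure)"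
        have "ennreal (k * L x') * (\<integral>\<^sup>+z. ennreal (\<phi> x z * \<phi> x' z) \<partial>lborel)
          = (\<integral>\<^sup>+z. ennreal (k * L x') * ennreal (\<phi> x z * \<phi> x' z) \<partial>lborel)"
          by (rule nn_integral_cmult[symmetric]) (intro measurable_compose[OF _ measurable_ennreal] borel_measurable_times \<phi>x x x')
        also have "\<dots> = (\<integral>\<^sup>+z. ennreal (E x' z) * ennreal (E x z * W z / (c z * L x)) \<partial>lborel)"
        proof (rule nn_integral_cong)
          fix z
          have "k * L x' * (\<phi> x z * \<phi> x' z) = E x' z * (E x z * W z / (c z * L x))"
            using \<phi>\<phi>[OF x x', of z] by simp
          then show "ennreal (k * L x') * ennreal (\<phi> x z * \<phi> x' z) = ennreal (E x' z) * ennreal (E x z * W z / (c z * L x))"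
            using k L_nonneg \<phi>0 E_nonneg W_nonneg c_nonneg by (simp add: ennreal_mult[symmetric])
        qed
        finally show "ennreal (k * L x') * (\<integral>\<^sup>+z. ennreal (\<phi> x z * \<phi> x' z) \<partial>lborel)
          = (\<integral>\<^sup>+z. ennreal (E x' z) * ennreal (E x z * W z / (c z * L x)) \<partial>lborel)" .
      qed
      also have "\<dots> = (\<integral>\<^sup>+z. \<integral>\<^sup>+x'. ennreal (E x' z) * ennreal (E x z * W z / (c z * L x)) \<partial>state_measure \<partial>lborel)"
      proof (rule SL.Fubini'[symmetric])
        have [measurable]: "(\<lambda>w. E x (snd w)) \<in> borel_measurable (state_measure \<Otimes>\<^sub>M lborel)"
          by (rule E_measurable) (use x in auto)
        show "(\<lambda>(x', z). ennreal (E x' z) * ennreal (E x z * W z / (c z * L x))) \<in> borel_measurable (state_measure \<Otimes>\<^sub>M lborel)"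
          by (simp add: case_prod_beta')
      qed
      also have "\<dots> = (\<integral>\<^sup>+z. CC z * ennreal (E x z * W z / (c z * L x)) \<partial>lborel)"
        unfolding CC_def by (intro nn_integral_cong nn_integral_multc) measurable
      also have "\<dots> = (\<integral>\<^sup>+z. ennreal (1 / L x) * ennreal (E x z * W z) \<partial>lborel)"
      proof (rule nn_integral_cong_AE)
        show "AE z in lborel. CC z * ennreal (E x z * W z / (c z * L x)) = ennreal (1 / L x) * ennreal (E x z * W z)"
          using AE_normalizer[OF m]
        proof eventually_elim
          case (elim z)
          then show ?case
            using E_nonneg[of x z] W_nonneg[of z] L_nonneg[of x] by (auto simp: ennreal_mult[symmetric])
        qed
      qed
      also have "\<dots> = ennreal (1 / L x) * ennreal (L x)"
      proof -
        have "(\<lambda>z. E x z) \<in> borel_measurable lborel" by (rule E_measurable) (use x in auto)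
        then show ?thesis by (subst nn_integral_cmult) (auto simp: nn_integral_EW[OF x])
      qed
      also have "\<dots> = 1" using L_pos[OF x] by (simp add: ennreal_mult[symmetric])
      finally show "(\<integral>\<^sup>+x'. \<integral>\<^sup>+z. ennreal (\<phi> x z * \<phi> x' z) \<partial>lborel \<partial>M) = 1" .
    qed
    fix f x assume f: "f \<in> L20 M" and "x \<in> space M"
    then have x: "x \<in> space state_measure" by (simp add: spM)
    have fm [measurable]: "f \<in> borel_measurable state_measure"
      using f sM by (simp add: L20_def cong: measurable_cong_sets)
    have gm: "(\<lambda>x'. f x' * (\<integral>z. \<phi> x z * \<phi> x' z \<partial>lborel)) \<in> borel_measurable state_measure"
    proof -
      have m2: "(\<lambda>w. \<phi> x (snd w) * \<phi> (fst w) (snd w)) \<in> borel_measurable (state_measure \<Otimes>\<^sub>M lborel)"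
        by (rule borel_measurable_times[OF measurable_compose[OF measurable_snd \<phi>x[OF x]] \<phi>2])
      then have "(\<lambda>x'. \<integral>z. \<phi> x z * \<phi> x' z \<partial>lborel) \<in> borel_measurable state_measure"
        by (intro lborel.borel_measurable_lebesgue_integral) (simp add: case_prod_beta')
      then show ?thesis by measurable
    qed
    have "(\<integral>x'. f x' * (\<integral>z. \<phi> x z * \<phi> x' z \<partial>lborel) \<partial>M)
      = (\<integral>x'. (k * L x') *\<^sub>R (f x' * (\<integral>z. \<phi> x z * \<phi> x' z \<partial>lborel)) \<partial>state_measure)"
      unfolding M by (rule integral_density[OF gm]) (use k L_nonneg in \<open>auto intro!: AE_I2\<close>)
    also have "\<dots> = DA_operator X y a h f x"
      unfolding DA_operator_def
    proof (rule Bochner_Integration.integral_cong[OF refl])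
      fix x' assume x': "x' \<in> space (state_measure :: ((real^'d^'p) \<times> (real^'d^'d)) measure)"
      have "(k * L x') *\<^sub>R (f x' * (\<integral>z. \<phi> x z * \<phi> x' z \<partial>lborel)) = f x' * (\<integral>z. k * L x' * (\<phi> x z * \<phi> x' z) \<partial>lborel)"
        by simp
      then show "(k * L x') *\<^sub>R (f x' * (\<integral>z. \<phi> x z * \<phi> x' z \<partial>lborel)) = f x' * DA_density X y a h x' x"
        unfolding \<phi>\<phi>[OF x x'] DA_density_eq[OF x' x] .
    qed
    finally show "DA_operator X y a h f x = (\<integral>x'. f x' * (\<integral>z. \<phi> x z * \<phi> x' z \<partial>lborel) \<partial>M)" ..
  qed
  show ?thesis using trace_class unfolding M_def .
qed

text \<open>
  The marginal is an iterated Bochner integral. If it is not the finite value of the nonnegative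
  integral, it is 0, and then division by 0 makes the posterior the null measure.
\<close>

lemma trace_class_null:
  assumes m: "marginal X y a h = 0"
  shows "trace_class_on_L20 (posterior X y a h) (DA_operator X y a h)"
proof (rule trace_class_on_L20_null)
  have M: "posterior X y a h = density state_measure (\<lambda>x. 0)"
    unfolding posterior_eq m by simp
  show "emeasure (posterior X y a h) (space (posterior X y a h)) = 0"
    unfolding M by (subst emeasure_density) auto
  have sM: "sets (posterior X y a h) = sets state_measure" by (simp add: M)
  fix f assume "f \<in> L20 (posterior X y a h)"
  then have [measurable]: "f \<in> borel_measurable state_measure"
    using sM by (simp add: L20_def cong: measurable_cong_sets)
  have "(\<lambda>x. \<integral>x'. f x' * (\<integral>z. E x' z / c z * (E x z * W z / L x) \<partial>lborel) \<partial>state_measure) \<in> borel_measurable state_measure"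
    by measurable
  moreover have "DA_operator X y a h f x = (\<integral>x'. f x' * (\<integral>z. E x' z / c z * (E x z * W z / L x) \<partial>lborel) \<partial>state_measure)"
    if x: "x \<in> space state_measure" for x
    unfolding DA_operator_def
    by (rule Bochner_Integration.integral_cong) (simp_all add: DA_density_eq[OF _ x])
  ultimately have "DA_operator X y a h f \<in> borel_measurable state_measure"
    by (subst measurable_cong) auto
  then show "DA_operator X y a h f \<in> borel_measurable (posterior X y a h)"
    using sM by (simp cong: measurable_cong_sets)
qed

lemma D_eq:
  "D \<zeta> u = indicator {0<..} u * (ennreal (u powr (real CARD('d) / 2) * h u)
      / ennreal (cumulative (\<lambda>u. u powr (real CARD('d) / 2) * h u) (\<zeta> * u)))"
proof -
  have "\<Psi> t = cumulative (\<lambda>u. u powr (real CARD('d) / 2) * h u) t" for t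
    unfolding \<Psi>_def cumulative_def by (rule set_lebesgue_integral_cong) (auto simp: \<psi>_def)
  then show ?thesis by (simp add: D_def \<psi>_def indicator_def)
qed

lemma trace_class:
  assumes \<zeta>: "1 < \<zeta>" "\<zeta> < 2"
    and D: "(\<integral>\<^sup>+u. indicator {0<..} u * (ennreal (u powr (real CARD('d) / 2) * h u)
      / ennreal (cumulative (\<lambda>u. u powr (real CARD('d) / 2) * h u) (\<zeta> * u))) \<partial>lborel) < \<infinity>"
  shows "trace_class_on_L20 (posterior X y a h) (DA_operator X y a h)"
  using trace_class_null trace_class_nonnull[OF _ \<zeta> D[folded D_eq]] by blast

lemma integral_pos: "0 < (LBINT u:{0<..}. u powr (real CARD('d) / 2) * h u)"
  using H_pos[of 0] by (simp add: H_def \<psi>_def set_lebesgue_integral_def)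

end

theorem theorem2:
  fixes X :: "real^'p^'n" and y :: "real^'d^'n" and a :: real and h :: "real \<Rightarrow> real"
  assumes h: "mixing_density h"
    and S1: "rank (concat_cols X y) = CARD('p) + CARD('d)"
    and S2: "real CARD('n) > real CARD('p) + 2 * real CARD('d) - 2 * a"
    and S3: "set_integrable lborel {0<..} (\<lambda>u. u powr (real CARD('d) / 2) * h u)"
    and S4: "set_integrable lborel {0<..}
      (\<lambda>u. u powr (- ((real CARD('n) - real CARD('p) + 2 * a - 2 * real CARD('d) - 1) / 2)) * h u)"
  shows "(zero_near_origin h \<longrightarrow>
      trace_class_on_L20 (posterior X y a h) (DA_operator X y a h)) \<and>
    ((\<exists>\<kappa>\<in>class_K. \<exists>\<zeta>\<in>{1<..<2}. \<exists>g\<in>class_C CARD('d) \<kappa> \<zeta>.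
        \<exists>L>0. ((\<lambda>u. h u / g u) \<longlongrightarrow> L) (at_right 0)) \<longrightarrow>
      trace_class_on_L20 (posterior X y a h) (DA_operator X y a h)) \<and>
    ((\<exists>\<kappa>\<in>class_K. \<exists>\<zeta>\<in>{1<..<2}. \<exists>g\<in>class_C CARD('d) \<kappa> \<zeta>.
        \<exists>\<eta>>0. mono_on {0<..<\<eta>} (\<lambda>u. u powr (real CARD('d) / 2) * g u) \<and>
              mono_on {0<..<\<eta>} (\<lambda>u. h u / g u)) \<longrightarrow>
      trace_class_on_L20 (posterior X y a h) (DA_operator X y a h))"
proof -
  interpret da_setting X y a h by unfold_locales (rule h S1 S3)+
  note base = h_nonneg S3 integral_pos
  show ?thesis
  proof (intro conjI impI)
    assume "zero_near_origin h"
    then show "trace_class_on_L20 (posterior X y a h) (DA_operator X y a h)"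
      by (intro trace_class[of "3/2"] ratio_integral_finite_zero_near_origin[OF base]) auto
  next
    assume "\<exists>\<kappa>\<in>class_K. \<exists>\<zeta>\<in>{1<..<2}. \<exists>g\<in>class_C CARD('d) \<kappa> \<zeta>.
        \<exists>L>0. ((\<lambda>u. h u / g u) \<longlongrightarrow> L) (at_right 0)"
    then obtain \<kappa> \<zeta> g L where \<kappa>: "\<kappa> \<in> class_K" and \<zeta>: "1 < \<zeta>" "\<zeta> < 2" and g: "g \<in> class_C CARD('d) \<kappa> \<zeta>"
      and L: "0 < L" "((\<lambda>u. h u / g u) \<longlongrightarrow> L) (at_right 0)" by auto
    show "trace_class_on_L20 (posterior X y a h) (DA_operator X y a h)"
      by (rule trace_class[OF \<zeta> ratio_integral_finite_asymptotic[OF base \<kappa> \<zeta>(1) g L]])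
  next
    assume "\<exists>\<kappa>\<in>class_K. \<exists>\<zeta>\<in>{1<..<2}. \<exists>g\<in>class_C CARD('d) \<kappa> \<zeta>.
        \<exists>\<eta>>0. mono_on {0<..<\<eta>} (\<lambda>u. u powr (real CARD('d) / 2) * g u) \<and>
              mono_on {0<..<\<eta>} (\<lambda>u. h u / g u)"
    then obtain \<kappa> \<zeta> g \<eta> where \<kappa>: "\<kappa> \<in> class_K" and \<zeta>: "1 < \<zeta>" "\<zeta> < 2" and g: "g \<in> class_C CARD('d) \<kappa> \<zeta>"
      and \<eta>: "0 < \<eta>" "mono_on {0<..<\<eta>} (\<lambda>u. u powr (real CARD('d) / 2) * g u)"
        "mono_on {0<..<\<eta>} (\<lambda>u. h u / g u)" by auto
    show "trace_class_on_L20 (posterior X y a h) (DA_operator X y a h)"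
      by (rule trace_class[OF \<zeta> ratio_integral_finite_monotone[OF base \<kappa> \<zeta>(1) g \<eta>]])
  qed
qed

end
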